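(* Let $G$ be a second-countable locally compact abelian group and let $(X,\mu)$ be an essentially free probability-preserving Borel $G$-space. (1) If $G$ has a compact open subgroup, then $(X,\mu)$ admits a stealthy cross-section. (2) If $G=\mathbb Q_p$ for a prime $p$, then $(X,\mu)$ admits a generating stealthy cross-section.
   Context: A probability-preserving Borel $G$-space is a standard Borel space $X$ with a Borel probability measure $\mu$ and a jointly Borel $\mu$-preserving action $(g,x)\mapsto g.x$; it is essentially free if $\mu$-almost every point has trivial stabilizer. A Borel set $Y\subset X$ is a cross-section if every orbit meets $Y$ and every return-time set $Y_x=\{t\in G:t.x\in Y\}$ is locally finite (finite intersection with every compact set); cross-sections are understood after restriction to an invariant conull Borel set. $Y$ is generating if the return-time map $x\mapsto Y_x$ (identified with the counting measure of $Y_x$) is injective on an invariant conull Borel subset of $X$. Write $U_gF(x)=F((-g).x)$ for the Koopman representation on $L^2(X,\mu)$, $\widehat G$ for the dual group, and let $\varsigma_F$ be the spectral measure of $F$ on $\widehat G$, i.e. $\langle U_gF,F\rangle=\int_{\widehat G}\chi(g)\,d\varsigma_F(\chi)$ for all $g\in G$. For a cross-section $Y$ and $f\in C_c(G)$ set $N_f^Y(x)=\sum_{t\in Y_x}f(t)$, and write $F^\circ=F-\int_XF\,d\mu$. A cross-section $Y$ with $N_f^Y\in L^2(X,\mu)$ for all $f\in C_c(G)$ is stealthy if there is an open neighborhood $U\subset\widehat G$ of the trivial character such that $\varsigma_{(N_f^Y)^\circ}(U)=0$ for all $f\in C_c(G)$. *)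

theory Defs
  imports "HOL-Probability.Probability" "HOL-Computational_Algebra.Primes"
begin

section \<open>Probability-preserving Borel G-spaces\<close>

definition standard_borel :: "'x measure \<Rightarrow> bool" where
  "standard_borel M \<longleftrightarrow>
    (\<exists>T. topspace T = space M \<and> completely_metrizable_space T \<and> second_countable T \<and>
         sets M = sigma_sets (space M) {U. openin T U})"

locale pp_borel_space = prob_space M
  for M :: "'x measure"
    and act :: "'g::{topological_ab_group_add, second_countable_topology, t2_space} \<Rightarrow> 'x \<Rightarrow> 'x" +
  assumes standard_borel: "standard_borel M"
    and act_zero: "\<And>x. x \<in> space M \<Longrightarrow> act 0 x = x"
    and act_add: "\<And>g h x. x \<in> space M \<Longrightarrow> act (g + h) x = act g (act h x)"
    and act_measurable: "(\<lambda>(g, x). act g x) \<in> measurable (borel \<Otimes>\<^sub>M M) M"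
    and act_preserving: "\<And>g. distr M M (act g) = M"

definition essentially_free :: "'x measure \<Rightarrow> ('g::ab_group_add \<Rightarrow> 'x \<Rightarrow> 'x) \<Rightarrow> bool" where
  "essentially_free M act \<longleftrightarrow> (AE x in M. {g. act g x = x} = {0})"

definition invariant_conull :: "'x measure \<Rightarrow> ('g \<Rightarrow> 'x \<Rightarrow> 'x) \<Rightarrow> 'x set \<Rightarrow> bool" where
  "invariant_conull M act X0 \<longleftrightarrow>
    X0 \<in> sets M \<and> space M - X0 \<in> null_sets M \<and> (\<forall>g. \<forall>x\<in>X0. act g x \<in> X0)"

section \<open>Cross-sections\<close>

definition return_times :: "('g \<Rightarrow> 'x \<Rightarrow> 'x) \<Rightarrow> 'x set \<Rightarrow> 'x \<Rightarrow> 'g set" where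
  "return_times act Y x = {t. act t x \<in> Y}"

text \<open>A cross-section is a cross-section of some invariant conull Borel subset \<open>X0\<close>. Points outside
  \<open>X0\<close> then have no return times at all, because \<open>X0\<close> is invariant and contains \<open>Y\<close>.\<close>

definition cross_section ::
    "'x measure \<Rightarrow> ('g::topological_space \<Rightarrow> 'x \<Rightarrow> 'x) \<Rightarrow> 'x set \<Rightarrow> bool" where
  "cross_section M act Y \<longleftrightarrow>
    (\<exists>X0. invariant_conull M act X0 \<and> Y \<in> sets M \<and> Y \<subseteq> X0 \<and>
      (\<forall>x\<in>X0. return_times act Y x \<noteq> {} \<and>
              (\<forall>K. compact K \<longrightarrow> finite (return_times act Y x \<inter> K))))"

definition generating ::
    "'x measure \<Rightarrow> ('g \<Rightarrow> 'x \<Rightarrow> 'x) \<Rightarrow> 'x set \<Rightarrow> bool" where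
  "generating M act Y \<longleftrightarrow> (\<exists>X0. invariant_conull M act X0 \<and> inj_on (return_times act Y) X0)"

definition C_c :: "('g::topological_space \<Rightarrow> complex) set" where
  "C_c = {f. continuous_on UNIV f \<and> compact (closure {t. f t \<noteq> 0})}"

text \<open>For a cross-section \<open>Y\<close> and \<open>f \<in> C_c\<close> the sum below has only finitely many nonzero terms.\<close>

definition counting_function ::
    "('g \<Rightarrow> 'x \<Rightarrow> 'x) \<Rightarrow> 'x set \<Rightarrow> ('g \<Rightarrow> complex) \<Rightarrow> 'x \<Rightarrow> complex" where
  "counting_function act Y f x = (\<Sum>\<^sub>\<infinity>t\<in>return_times act Y x. f t)"

section \<open>The dual group and spectral measures\<close>

definition characters :: "('g::{topological_space, plus} \<Rightarrow> complex) set" where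
  "characters = {\<xi>. continuous_on UNIV \<xi> \<and> (\<forall>g. cmod (\<xi> g) = 1) \<and>
                    (\<forall>g h. \<xi> (g + h) = \<xi> g * \<xi> h)}"

text \<open>The compact-open topology on the set of characters.\<close>

definition dual_topology :: "('g::{topological_space, plus} \<Rightarrow> complex) topology" where
  "dual_topology = topology_generated_by
     {{\<xi> \<in> characters. \<xi> ` K \<subseteq> V} | K V. compact K \<and> open V}"

lemma topspace_dual_topology: "topspace dual_topology = characters"
proof -
  have "characters \<in> {{\<xi> \<in> characters. \<xi> ` K \<subseteq> V} | K V. compact K \<and> open V}"
    by (rule CollectI, rule exI[of _ "{}"], rule exI[of _ UNIV]) auto
  then show ?thesis
    unfolding dual_topology_def topology_generated_by_topspace by blast
qed

definition dual_borel :: "('g::{topological_space, plus} \<Rightarrow> complex) measure" where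
  "dual_borel = sigma characters {U. openin dual_topology U}"

definition square_integrable :: "'x measure \<Rightarrow> ('x \<Rightarrow> complex) \<Rightarrow> bool" where
  "square_integrable M F \<longleftrightarrow> F \<in> borel_measurable M \<and> integrable M (\<lambda>x. (cmod (F x))\<^sup>2)"

definition L2_inner :: "'x measure \<Rightarrow> ('x \<Rightarrow> complex) \<Rightarrow> ('x \<Rightarrow> complex) \<Rightarrow> complex" where
  "L2_inner M F H = (\<integral>x. F x * cnj (H x) \<partial>M)"

definition koopman :: "('g::uminus \<Rightarrow> 'x \<Rightarrow> 'x) \<Rightarrow> 'g \<Rightarrow> ('x \<Rightarrow> complex) \<Rightarrow> 'x \<Rightarrow> complex" where
  "koopman act g F x = F (act (- g) x)"

definition centred :: "'x measure \<Rightarrow> ('x \<Rightarrow> complex) \<Rightarrow> 'x \<Rightarrow> complex" where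
  "centred M F x = F x - (\<integral>y. F y \<partial>M)"

definition is_spectral_measure ::
    "'x measure \<Rightarrow> ('g::{topological_space, ab_group_add} \<Rightarrow> 'x \<Rightarrow> 'x) \<Rightarrow> ('x \<Rightarrow> complex) \<Rightarrow>
     ('g \<Rightarrow> complex) measure \<Rightarrow> bool" where
  "is_spectral_measure M act F \<sigma> \<longleftrightarrow>
    finite_measure \<sigma> \<and> sets \<sigma> = sets dual_borel \<and>
    (\<forall>g. L2_inner M (koopman act g F) F = (\<integral>\<xi>. \<xi> g \<partial>\<sigma>))"

text \<open>By Bochner's theorem every \<open>F \<in> L\<^sup>2\<close> has exactly one spectral measure; the condition
  on ``the'' spectral measure is therefore expressed by quantifying over \<open>\<sigma>\<close>.\<close>

definition stealthy ::
    "'x measure \<Rightarrow> ('g::{topological_space, ab_group_add} \<Rightarrow> 'x \<Rightarrow> 'x) \<Rightarrow> 'x set \<Rightarrow> bool" where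
  "stealthy M act Y \<longleftrightarrow>
    cross_section M act Y \<and>
    (\<forall>f\<in>C_c. square_integrable M (counting_function act Y f)) \<and>
    (\<exists>U. openin dual_topology U \<and> (\<lambda>_. 1) \<in> U \<and>
      (\<forall>f\<in>C_c. \<forall>\<sigma>. is_spectral_measure M act (centred M (counting_function act Y f)) \<sigma> \<longrightarrow>
         emeasure \<sigma> U = 0))"

definition compact_open_subgroup :: "'g::{topological_space, ab_group_add} set \<Rightarrow> bool" where
  "compact_open_subgroup K \<longleftrightarrow>
    compact K \<and> open K \<and> 0 \<in> K \<and> (\<forall>a\<in>K. \<forall>b\<in>K. a + b \<in> K) \<and> (\<forall>a\<in>K. - a \<in> K)"

section \<open>The p-adic numbers\<close>

text \<open>The topological group of p-adic numbers, as the completion of the rationals for the p-adic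
  absolute value: Cauchy sequences modulo null sequences.\<close>

definition padic_abs :: "nat \<Rightarrow> rat \<Rightarrow> real" where
  "padic_abs p q = (if q = 0 then 0 else
     (case quotient_of q of (a, b) \<Rightarrow>
        real p powi (int (multiplicity (int p) b) - int (multiplicity (int p) a))))"

definition padic_cauchy :: "nat \<Rightarrow> (nat \<Rightarrow> rat) set" where
  "padic_cauchy p = {s. \<forall>e>0. \<exists>N. \<forall>m\<ge>N. \<forall>n\<ge>N. padic_abs p (s m - s n) < e}"

definition padic_rel :: "nat \<Rightarrow> ((nat \<Rightarrow> rat) \<times> (nat \<Rightarrow> rat)) set" where
  "padic_rel p = {(s, t). s \<in> padic_cauchy p \<and> t \<in> padic_cauchy p \<and>
                          (\<lambda>n. padic_abs p (s n - t n)) \<longlonglongrightarrow> 0}"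

definition Qp :: "nat \<Rightarrow> (nat \<Rightarrow> rat) set set" where
  "Qp p = padic_cauchy p // padic_rel p"

definition Qp_rep :: "(nat \<Rightarrow> rat) set \<Rightarrow> nat \<Rightarrow> rat" where
  "Qp_rep A = (SOME s. s \<in> A)"

definition Qp_add :: "nat \<Rightarrow> (nat \<Rightarrow> rat) set \<Rightarrow> (nat \<Rightarrow> rat) set \<Rightarrow> (nat \<Rightarrow> rat) set" where
  "Qp_add p A B = padic_rel p `` {\<lambda>n. Qp_rep A n + Qp_rep B n}"

text \<open>The value 0 off the carrier is only there because the locale \<open>Metric_space\<close> wants a
  symmetric nonnegative function on the whole type.\<close>

definition Qp_dist :: "nat \<Rightarrow> (nat \<Rightarrow> rat) set \<Rightarrow> (nat \<Rightarrow> rat) set \<Rightarrow> real" where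
  "Qp_dist p A B = (if A \<in> Qp p \<and> B \<in> Qp p
     then lim (\<lambda>n. padic_abs p (Qp_rep A n - Qp_rep B n)) else 0)"

definition Qp_topology :: "nat \<Rightarrow> (nat \<Rightarrow> rat) set topology" where
  "Qp_topology p = Metric_space.mtopology (Qp p) (Qp_dist p)"

definition Qp_isomorphism ::
    "nat \<Rightarrow> ('g::{topological_space, ab_group_add} \<Rightarrow> (nat \<Rightarrow> rat) set) \<Rightarrow> bool" where
  "Qp_isomorphism p \<phi> \<longleftrightarrow>
    homeomorphic_map euclidean (Qp_topology p) \<phi> \<and> (\<forall>x y. \<phi> (x + y) = Qp_add p (\<phi> x) (\<phi> y))"

lemma padic_abs_0 [simp]: "padic_abs p 0 = 0"
  by (simp add: padic_abs_def)

lemma padic_abs_nonneg [simp]: "0 \<le> padic_abs p q"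
  by (auto simp: padic_abs_def split: prod.split)

lemma padic_abs_Fract:
  assumes p: "prime p" and a: "a \<noteq> 0" and b: "b \<noteq> 0"
  shows "padic_abs p (Fract a b) =
    real p powi (int (multiplicity (int p) b) - int (multiplicity (int p) a))"
proof -
  obtain c d where cd: "quotient_of (Fract a b) = (c, d)"
    by fastforce
  have d: "d > 0" using quotient_of_denom_pos[OF cd] .
  have "Fract c d = Fract a b" using quotient_of_eq[OF cd] .
  then have eq: "c * b = a * d" using d b by (simp add: eq_rat)
  with a d have c: "c \<noteq> 0" by auto
  have pe: "prime_elem (int p)" using p by simp
  have "multiplicity (int p) (c * b) = multiplicity (int p) (a * d)" using eq by simp
  then have "multiplicity (int p) c + multiplicity (int p) b =
             multiplicity (int p) a + multiplicity (int p) d"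
    using a b c d pe by (simp add: prime_elem_multiplicity_mult_distrib)
  then have "int (multiplicity (int p) d) - int (multiplicity (int p) c) =
             int (multiplicity (int p) b) - int (multiplicity (int p) a)" by linarith
  moreover have "Fract a b \<noteq> 0" using a b by (simp add: Zero_rat_def eq_rat)
  ultimately show ?thesis by (simp add: padic_abs_def cd)
qed

lemma padic_abs_uminus [simp]: "padic_abs p (- q) = padic_abs p q"
proof -
  have "multiplicity (int p) (- a) = multiplicity (int p) a" for a
    using multiplicity_times_unit_right[of "- 1" "int p" a] by simp
  then show ?thesis by (auto simp: padic_abs_def rat_uminus_code Let_def split: prod.split)
qed

lemma padic_abs_minus_commute: "padic_abs p (q - r) = padic_abs p (r - q)"
  using padic_abs_uminus[of p "r - q"] by simp

lemma padic_abs_ultra: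
  assumes p: "prime p"
  shows "padic_abs p (q + r) \<le> max (padic_abs p q) (padic_abs p r)"
proof (cases "q = 0 \<or> r = 0 \<or> q + r = 0")
  case True
  then show ?thesis by (auto simp: max_def)
next
  case False
  let ?v = "multiplicity (int p)"
  obtain a b where q: "q = Fract a b" "b > 0" using Rat_cases[of q] by metis
  obtain c d where r: "r = Fract c d" "d > 0" using Rat_cases[of r] by metis
  have a: "a \<noteq> 0" and c: "c \<noteq> 0" using False q r by (auto simp: Zero_rat_def eq_rat)
  have sum: "q + r = Fract (a * d + c * b) (b * d)" using q r by simp
  then have nz: "a * d + c * b \<noteq> 0" using False by (auto simp: rat_number_collapse)
  have pe: "prime_elem (int p)" and nu: "\<not> is_unit (int p)" using p by (auto simp: prime_nat_iff)
  let ?m = "min (?v (a * d)) (?v (c * b))"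
  have "int p ^ ?m dvd a * d + c * b"
    by (intro dvd_add multiplicity_dvd') auto
  then have "?m \<le> ?v (a * d + c * b)" using nz nu by (intro multiplicity_geI) auto
  then have m: "?v a + ?v d \<le> ?v (a * d + c * b) \<or> ?v c + ?v b \<le> ?v (a * d + c * b)"
    using a c q r pe by (simp add: prime_elem_multiplicity_mult_distrib min_def split: if_splits)
  have p1: "1 \<le> real p" using prime_ge_1_nat[OF p] by simp
  have "padic_abs p (q + r) = real p powi (int (?v b + ?v d) - int (?v (a * d + c * b)))"
    unfolding sum using nz q r p pe
    by (subst padic_abs_Fract) (auto simp: prime_elem_multiplicity_mult_distrib)
  moreover have "padic_abs p q = real p powi (int (?v b) - int (?v a))"
    "padic_abs p r = real p powi (int (?v d) - int (?v c))"
    using q r a c p by (auto simp: padic_abs_Fract)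
  moreover have "i \<le> j \<Longrightarrow> real p powi i \<le> real p powi j" for i j
    using p1 by (rule power_int_increasing[rotated 1])
  moreover have "int (?v b + ?v d) - int (?v (a * d + c * b)) \<le> int (?v b) - int (?v a) \<or>
      int (?v b + ?v d) - int (?v (a * d + c * b)) \<le> int (?v d) - int (?v c)"
    using m by linarith
  ultimately show ?thesis unfolding le_max_iff_disj by metis
qed

lemma padic_abs_triangle:
  assumes "prime p"
  shows "padic_abs p (x - z) \<le> padic_abs p (x - y) + padic_abs p (y - z)"
proof -
  have "padic_abs p (x - z) \<le> max (padic_abs p (x - y)) (padic_abs p (y - z))"
    using padic_abs_ultra[OF assms, of "x - y" "y - z"] by simp
  also have "\<dots> \<le> padic_abs p (x - y) + padic_abs p (y - z)" by simp
  finally show ?thesis .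
qed

lemma padic_abs_eq_0_iff [simp]: "prime p \<Longrightarrow> padic_abs p q = 0 \<longleftrightarrow> q = 0"
  by (auto simp: padic_abs_def split: prod.splits)

lemma equiv_padic_rel:
  assumes p: "prime p"
  shows "equiv (padic_cauchy p) (padic_rel p)"
proof (rule equivI)
  show "padic_rel p \<subseteq> padic_cauchy p \<times> padic_cauchy p" by (auto simp: padic_rel_def)
  show "refl_on (padic_cauchy p) (padic_rel p)"
    by (auto simp: refl_on_def padic_rel_def)
  show "sym (padic_rel p)"
    unfolding sym_def padic_rel_def using padic_abs_minus_commute[of p] by simp
  show "trans (padic_rel p)"
  proof (rule transI)
    fix s t u assume st: "(s, t) \<in> padic_rel p" and tu: "(t, u) \<in> padic_rel p"
    have "(\<lambda>n. padic_abs p (s n - t n) + padic_abs p (t n - u n)) \<longlonglongrightarrow> 0 + 0"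
      using st tu by (intro tendsto_add) (simp_all add: padic_rel_def)
    then have lim: "(\<lambda>n. padic_abs p (s n - t n) + padic_abs p (t n - u n)) \<longlonglongrightarrow> 0" by simp
    have "(\<lambda>n. padic_abs p (s n - u n)) \<longlonglongrightarrow> 0"
    proof (rule tendsto_sandwich[OF _ _ tendsto_const lim])
      show "\<forall>\<^sub>F n in sequentially. 0 \<le> padic_abs p (s n - u n)" by simp
      show "\<forall>\<^sub>F n in sequentially.
          padic_abs p (s n - u n) \<le> padic_abs p (s n - t n) + padic_abs p (t n - u n)"
        by (rule always_eventually, rule allI, rule padic_abs_triangle[OF p])
    qed
    with st tu show "(s, u) \<in> padic_rel p" by (auto simp: padic_rel_def)
  qed
qed

lemma Qp_rep:
  assumes p: "prime p" and A: "A \<in> Qp p"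
  shows "Qp_rep A \<in> A" "Qp_rep A \<in> padic_cauchy p" "padic_rel p `` {Qp_rep A} = A"
proof -
  note eq = equiv_padic_rel[OF p]
  obtain s where s: "s \<in> padic_cauchy p" "A = padic_rel p `` {s}"
    using A unfolding Qp_def by (rule quotientE)
  have "s \<in> A" using s equiv_class_self[OF eq] by blast
  then show rA: "Qp_rep A \<in> A" unfolding Qp_rep_def by (metis someI)
  then show "Qp_rep A \<in> padic_cauchy p" using s by (auto simp: padic_rel_def)
  show "padic_rel p `` {Qp_rep A} = A" using rA s equiv_class_eq[OF eq] by blast
qed

lemma convergent_padic_abs_diff:
  assumes p: "prime p" and s: "s \<in> padic_cauchy p" and t: "t \<in> padic_cauchy p"
  shows "convergent (\<lambda>n. padic_abs p (s n - t n))"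
proof (rule Cauchy_convergent, rule metric_CauchyI)
  fix e :: real assume "e > 0"
  then have e: "e / 2 > 0" by simp
  obtain N1 where N1: "\<And>m n. m \<ge> N1 \<Longrightarrow> n \<ge> N1 \<Longrightarrow> padic_abs p (s m - s n) < e / 2"
    using s e unfolding padic_cauchy_def by blast
  obtain N2 where N2: "\<And>m n. m \<ge> N2 \<Longrightarrow> n \<ge> N2 \<Longrightarrow> padic_abs p (t m - t n) < e / 2"
    using t e unfolding padic_cauchy_def by blast
  have le: "padic_abs p (s m - t m) \<le>
      padic_abs p (s m - s n) + (padic_abs p (s n - t n) + padic_abs p (t n - t m))" for m n
    using padic_abs_triangle[OF p, of "s m" "t m" "s n"] padic_abs_triangle[OF p, of "s n" "t m" "t n"]
    by linarith
  have "dist (padic_abs p (s m - t m)) (padic_abs p (s n - t n)) < e"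
    if "m \<ge> max N1 N2" "n \<ge> max N1 N2" for m n
    using le[of m n] le[of n m] N1[of m n] N1[of n m] N2[of m n] N2[of n m] that
    by (simp add: dist_real_def abs_if)
  then show "\<exists>M. \<forall>m\<ge>M. \<forall>n\<ge>M. dist (padic_abs p (s m - t m)) (padic_abs p (s n - t n)) < e"
    by blast
qed

lemma Metric_space_Qp:
  assumes p: "prime p"
  shows "Metric_space (Qp p) (Qp_dist p)"
proof -
  have lim: "(\<lambda>n. padic_abs p (Qp_rep A n - Qp_rep B n)) \<longlonglongrightarrow> Qp_dist p A B"
    if "A \<in> Qp p" "B \<in> Qp p" for A B
    using convergent_padic_abs_diff[OF p Qp_rep(2)[OF p that(1)] Qp_rep(2)[OF p that(2)]] that
    by (simp add: Qp_dist_def convergent_LIMSEQ_iff)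
  show ?thesis
  proof
    show "0 \<le> Qp_dist p A B" for A B
    proof (cases "A \<in> Qp p \<and> B \<in> Qp p")
      case True
      then show ?thesis using lim[of A B] by (intro LIMSEQ_le_const) auto
    qed (auto simp: Qp_dist_def)
    show "Qp_dist p A B = Qp_dist p B A" for A B
      unfolding Qp_dist_def by (subst padic_abs_minus_commute) simp
    show "Qp_dist p A B = 0 \<longleftrightarrow> A = B" if A: "A \<in> Qp p" and B: "B \<in> Qp p" for A B
    proof
      assume "Qp_dist p A B = 0"
      then have "(Qp_rep A, Qp_rep B) \<in> padic_rel p"
        using lim[OF A B] Qp_rep(2)[OF p A] Qp_rep(2)[OF p B] by (auto simp: padic_rel_def)
      then show "A = B"
        using equiv_class_eq[OF equiv_padic_rel[OF p]] Qp_rep(3)[OF p A] Qp_rep(3)[OF p B] by blast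
    next
      assume "A = B" then show "Qp_dist p A B = 0" by (auto simp: Qp_dist_def)
    qed
    show "Qp_dist p A C \<le> Qp_dist p A B + Qp_dist p B C"
      if "A \<in> Qp p" "B \<in> Qp p" "C \<in> Qp p" for A B C
    proof (rule LIMSEQ_le[OF lim[OF that(1,3)] tendsto_add[OF lim[OF that(1,2)] lim[OF that(2,3)]]])
      show "\<exists>N. \<forall>n\<ge>N. padic_abs p (Qp_rep A n - Qp_rep C n) \<le>
          padic_abs p (Qp_rep A n - Qp_rep B n) + padic_abs p (Qp_rep B n - Qp_rep C n)"
        using padic_abs_triangle[OF p] by blast
    qed
  qed
qed

end

theory Submission
  imports Defs
begin

text \<open>
  Both cross-sections are Borel transversals \<open>Y\<close> for the orbits of a compact open subgroup \<open>K\<close> of \<open>G\<close>,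
  so that the return times of almost every point contain exactly one element of each coset of \<open>K\<close>.

  Such a transversal is stealthy, with the annihilator of \<open>K\<close> as the required neighbourhood of the
  trivial character. Indeed the counting function of a test function that is constant on the cosets
  of \<open>K\<close> is constant. Averaging a counting function over translations by \<open>K\<close> has the effect of
  averaging the test function, so the average of the centred counting function vanishes; on the
  spectral side this average is the restriction of the spectral measure to the annihilator of \<open>K\<close>.
  The average is taken over finite subsets of \<open>K\<close> (\<open>average_nearly_constant_on_cosets\<close>), which makes
  everything hold up to an arbitrarily small error and avoids Haar measure. The annihilator is open
  because the unit circle has no nontrivial subgroup in the right half-plane. The result is
  \<open>orbit_section_stealthy\<close>.

  The existence of a transversal (\<open>orbit_section_exists\<close>) rests on countably many Borel functions that
  separate points and are continuous along orbits (\<open>separating_orbit_continuous\<close>): in each \<open>K\<close>-orbit one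
  takes the point at which the sequence of their values is lexicographically least. Such functions
  are obtained from arbitrary Borel sets by smoothing along orbits, where the integral over Haar
  measure is replaced by an essential supremum in the sense of Baire category. Every selection and
  every exceptional set is described by closed conditions on a compact set of group elements, and
  this keeps it Borel (\<open>measurable_compact_projection\<close>).

  For the \<open>p\<close>-adic numbers the transversal is chosen so as to generate
  (\<open>generating_orbit_section_exists\<close>). Let \<open>L\<close> be the union of the cosets of \<open>K\<close> by the multiples of an
  element \<open>g\<close> outside \<open>K\<close> with \<open>p * g\<close> in \<open>K\<close>, and take a transversal for \<open>L\<close>. Around each of its points \<open>y\<close>
  there is room for \<open>p\<close> points of \<open>Y\<close>, one in each coset of \<open>K\<close>, and displacing one of them by an element
  of \<open>K\<close> that encodes \<open>y\<close> injectively lets the return times recover \<open>y\<close> as well as the position of \<open>x\<close>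
  relative to \<open>y\<close>. The code is the \<open>p\<close>-adic number whose digits 0 and 1 say in which sets of a separating
  sequence \<open>y\<close> lies.
\<close>

section \<open>Topological groups\<close>

lemma open_shift: "open {x :: 'g::topological_group_add. x + a \<in> S}" if "open S"
proof -
  have "open ((\<lambda>x. x + a) -` S)"
    by (intro open_vimage that continuous_on_add continuous_on_const continuous_on_id)
  then show ?thesis by (simp add: vimage_def)
qed

lemma zero_nhd_halving:
  fixes U :: "'g::{topological_ab_group_add} set"
  assumes "open U" "0 \<in> U"
  obtains V where "open V" "0 \<in> V" "\<And>x. x \<in> V \<Longrightarrow> - x \<in> V" "\<And>x y. x \<in> V \<Longrightarrow> y \<in> V \<Longrightarrow> x + y \<in> U"
proof -
  have "\<forall>\<^sub>F z in nhds 0 \<times>\<^sub>F nhds 0. fst z + snd z \<in> U"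
    using tendsto_add_Pair[of "0::'g" 0] topological_tendstoD[OF _ assms(1)] assms(2) by simp
  then obtain P Q where P: "eventually P (nhds (0::'g))" and Q: "eventually Q (nhds (0::'g))"
    and PQ: "\<And>x y. P x \<Longrightarrow> Q y \<Longrightarrow> x + y \<in> U"
    unfolding eventually_prod_filter by auto
  obtain A where A: "open A" "0 \<in> A" "\<And>x. x \<in> A \<Longrightarrow> P x" using P unfolding eventually_nhds by auto
  obtain B where B: "open B" "0 \<in> B" "\<And>x. x \<in> B \<Longrightarrow> Q x" using Q unfolding eventually_nhds by auto
  let ?C = "A \<inter> B"
  have "continuous_on UNIV (uminus :: 'g \<Rightarrow> 'g)"
    unfolding continuous_on_def by (intro ballI tendsto_minus tendsto_ident_at)
  then have "open (uminus -` ?C)" using A B by (intro open_vimage) auto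
  then have "open (?C \<inter> uminus -` ?C)" using A B by auto
  with A B PQ show ?thesis by (intro that[of "?C \<inter> uminus -` ?C"]) auto
qed

text \<open>A Lebesgue number argument. Every point of the support has a neighbourhood on which \<open>f\<close> hardly
  varies; finitely many of them cover the support, and the intersection of the corresponding
  neighbourhoods of 0 serves all points at once.\<close>

lemma compactly_supported_uniformly_continuous:
  fixes f :: "'g::topological_ab_group_add \<Rightarrow> 'b::real_normed_vector"
  assumes f: "continuous_on UNIV f" and C: "compact C" and supp: "\<And>x. x \<notin> C \<Longrightarrow> f x = 0" and e: "e > 0"
  obtains V where "open V" "0 \<in> V" "\<forall>x y. x - y \<in> V \<longrightarrow> norm (f x - f y) < e"
proof -
  \<comment> \<open>two steps are needed: from the centre \<open>a\<close> to \<open>x\<close>, and from \<open>x\<close> to \<open>y\<close>\<close>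
  have "\<exists>V. open V \<and> 0 \<in> V \<and> (\<forall>x\<in>V. - x \<in> V) \<and> (\<forall>x\<in>V. \<forall>y\<in>V. dist (f (x + y + a)) (f a) < e / 2)" for a
  proof -
    have "open (f -` ball (f a) (e / 2))" using f by (intro open_vimage) auto
    note op = open_shift[OF this, of a]
    have "0 \<in> {x. x + a \<in> f -` ball (f a) (e / 2)}" using e by simp
    with op obtain V where V: "open V" "0 \<in> V" "\<And>x. x \<in> V \<Longrightarrow> - x \<in> V"
        "\<And>x y. x \<in> V \<Longrightarrow> y \<in> V \<Longrightarrow> x + y \<in> {x. x + a \<in> f -` ball (f a) (e / 2)}"
      by (rule zero_nhd_halving) blast
    show ?thesis
    proof (intro exI[of _ V] conjI ballI V)
      fix x y assume "x \<in> V" "y \<in> V"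
      then show "dist (f (x + y + a)) (f a) < e / 2" using V(4) by (simp add: dist_commute)
    qed
  qed
  then obtain V where V: "\<And>a. open (V a)" "\<And>a. 0 \<in> V a" "\<And>a x. x \<in> V a \<Longrightarrow> - x \<in> V a"
     "\<And>a x y. x \<in> V a \<Longrightarrow> y \<in> V a \<Longrightarrow> dist (f (x + y + a)) (f a) < e / 2" by metis
  let ?W = "\<lambda>a. {x. x + (- a) \<in> V a}"
  have "C \<subseteq> (\<Union>a\<in>C. ?W a)" using V(2) by auto
  then obtain D where D: "D \<subseteq> C" "finite D" "C \<subseteq> (\<Union>a\<in>D. ?W a)"
    by (rule compactE_image[OF C open_shift[OF V(1)]])
  let ?N = "\<Inter>a\<in>D. V a"
  have close: "norm (f x - f y) < e" if "x - y \<in> ?N" "x \<in> C" for x y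
  proof -
    obtain a where a: "a \<in> D" "x - a \<in> V a" using D(3) \<open>x \<in> C\<close> by auto
    have "y - x \<in> V a" using V(3)[of "x - y" a] that a by auto
    then have "dist (f (x - a + (y - x) + a)) (f a) < e / 2" "dist (f (x - a + 0 + a)) (f a) < e / 2"
      using V(4)[of "x - a" a "y - x"] V(4)[of "x - a" a 0] V(2) a by auto
    then have "dist (f y) (f a) < e / 2" "dist (f x) (f a) < e / 2" by (simp_all add: algebra_simps)
    then have "dist (f x) (f y) < e" using dist_triangle2[of "f x" "f y" "f a"] by linarith
    then show ?thesis by (simp add: dist_norm)
  qed
  show ?thesis
  proof (rule that[of ?N]; (intro allI impI)?)
    fix x y assume xy: "x - y \<in> ?N"
    then have yx: "y - x \<in> ?N" using V(3)[of "x - y"] by auto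
    consider "x \<in> C" | "y \<in> C" | "x \<notin> C" "y \<notin> C" by blast
    then show "norm (f x - f y) < e"
      using close[OF xy] close[OF yx] supp[of x] supp[of y] e norm_minus_commute[of "f x" "f y"]
      by cases simp_all
  qed (use D V in auto)
qed

section \<open>Baire category\<close>

definition meagre :: "'a::topological_space set \<Rightarrow> bool" where
  "meagre S \<longleftrightarrow> (\<exists>\<C>. countable \<C> \<and> (\<forall>C\<in>\<C>. closed C \<and> interior C = {}) \<and> S \<subseteq> \<Union>\<C>)"

lemma meagreE:
  assumes "meagre S"
  obtains \<C> where "countable \<C>" "\<forall>C\<in>\<C>. closed C \<and> interior C = {}" "S \<subseteq> \<Union>\<C>"
proof -
  from assms[unfolded meagre_def] obtain \<C>
    where C: "countable \<C> \<and> (\<forall>C\<in>\<C>. closed C \<and> interior C = {}) \<and> S \<subseteq> \<Union>\<C>" ..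
  show thesis by (rule that[of \<C>]) (use C in simp_all)
qed

lemma meagreI:
  assumes "countable \<C>" "\<And>C. C \<in> \<C> \<Longrightarrow> closed C" "\<And>C. C \<in> \<C> \<Longrightarrow> interior C = {}" "S \<subseteq> \<Union>\<C>"
  shows "meagre S"
  unfolding meagre_def by (rule exI[of _ \<C>]) (simp add: assms)

lemma meagre_subset:
  assumes "meagre T" "S \<subseteq> T" shows "meagre S"
proof -
  from assms(1) obtain \<C> where C: "countable \<C>" "\<forall>C\<in>\<C>. closed C \<and> interior C = {}" "T \<subseteq> \<Union>\<C>"
    by (rule meagreE)
  then show ?thesis using subset_trans[OF assms(2) C(3)] by (intro meagreI[of \<C>]) simp_all
qed

lemma meagre_closed: "closed C \<Longrightarrow> interior C = {} \<Longrightarrow> meagre C"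
  by (rule meagreI[of "{C}"]) simp_all

lemma meagre_empty [simp]: "meagre {}"
  by (rule meagre_closed) simp_all

lemma meagre_UN:
  assumes I: "countable I" and S: "\<And>i. i \<in> I \<Longrightarrow> meagre (S i)"
  shows "meagre (\<Union>i\<in>I. S i)"
proof -
  have "\<forall>i\<in>I. \<exists>\<C>. countable \<C> \<and> (\<forall>C\<in>\<C>. closed C \<and> interior C = {}) \<and> S i \<subseteq> \<Union>\<C>"
    using S unfolding meagre_def by simp
  from bchoice[OF this] obtain \<C>
    where C: "\<forall>i\<in>I. countable (\<C> i) \<and> (\<forall>C\<in>\<C> i. closed C \<and> interior C = {}) \<and> S i \<subseteq> \<Union>(\<C> i)" ..
  show ?thesis
  proof (rule meagreI[of "\<Union>i\<in>I. \<C> i"])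
    show "countable (\<Union>i\<in>I. \<C> i)" using I C by simp
    show "(\<Union>i\<in>I. S i) \<subseteq> \<Union>(\<Union>i\<in>I. \<C> i)"
    proof (rule UN_least)
      fix i assume i: "i \<in> I"
      then have "S i \<subseteq> \<Union>(\<C> i)" using C by simp
      also have "\<dots> \<subseteq> \<Union>(\<Union>i\<in>I. \<C> i)" by (intro Union_mono UN_upper i)
      finally show "S i \<subseteq> \<Union>(\<Union>i\<in>I. \<C> i)" .
    qed
  qed (use C in auto)
qed

lemma meagre_Un: "meagre S \<Longrightarrow> meagre T \<Longrightarrow> meagre (S \<union> T)"
  using meagre_UN[of "{True, False}" "\<lambda>b. if b then S else T"] by (simp add: Un_commute)

lemma meagre_shift:
  fixes S :: "'g::topological_ab_group_add set"
  assumes "meagre S"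
  shows "meagre {x. x + a \<in> S}"
proof -
  from assms obtain \<C> where C: "countable \<C>" "\<forall>C\<in>\<C>. closed C \<and> interior C = {}" "S \<subseteq> \<Union>\<C>"
    by (rule meagreE)
  have "meagre {x. x + a \<in> C}" if "C \<in> \<C>" for C
  proof (rule meagre_closed)
    show "closed {x. x + a \<in> C}"
      using open_shift[of "- C" a] C(2) that by (auto simp: closed_def Collect_neg_eq)
    have "T = {}" if T: "open T" "T \<subseteq> {x. x + a \<in> C}" for T
    proof -
      have "x \<in> C" if "x + (- a) \<in> T" for x
        using subsetD[OF T(2) that] by simp
      then have "{x. x + (- a) \<in> T} \<subseteq> interior C"
        by (intro interior_maximal open_shift[OF T(1)]) auto
      then have none: "x + (- a) \<notin> T" for x using C(2) \<open>C \<in> \<C>\<close> by auto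
      show ?thesis
      proof (rule equals0I)
        fix y assume "y \<in> T"
        then show False using none[of "y + a"] by simp
      qed
    qed
    then show "interior {x. x + a \<in> C} = {}" by (simp add: interior_subset)
  qed
  then have "meagre (\<Union>C\<in>\<C>. {x. x + a \<in> C})" using C(1) by (intro meagre_UN)
  then show ?thesis
    by (rule meagre_subset) (use C(3) in auto)
qed

lemma Hausdorff_space_t2: "Hausdorff_space (euclidean :: 'a::t2_space topology)"
  unfolding Hausdorff_space_def using hausdorff by (auto simp: disjnt_def)

lemma open_meagre_imp_empty:
  fixes V :: "'g::t2_space set"
  assumes lc: "locally_compact_space (euclidean :: 'g topology)" and "open V" "meagre V"
  shows "V = {}"
proof -
  from \<open>meagre V\<close> obtain \<C> where C: "countable \<C>" "\<forall>C\<in>\<C>. closed C \<and> interior C = {}" "V \<subseteq> \<Union>\<C>"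
    by (rule meagreE)
  have "euclidean interior_of \<Union>\<C> = {}"
    using lc locally_compact_Hausdorff_imp_regular_space[OF lc Hausdorff_space_t2] C
    by (intro Baire_category_alt) auto
  then show ?thesis using interior_maximal[OF C(3) \<open>open V\<close>] by simp
qed

lemma meagre_boundary_open:
  assumes "open U" shows "meagre (closure U - U)"
proof (rule meagre_closed)
  show "closed (closure U - U)" using assms by (intro closed_Diff closed_closure)
  have "U \<inter> interior (closure U - U) = {}"
    using interior_subset[of "closure U - U"] by auto
  then have "closure U \<inter> interior (closure U - U) = {}"
    using open_Int_closure_eq_empty[OF open_interior, of "closure U - U" U] by (simp add: Int_commute)
  then show "interior (closure U - U) = {}"
    using interior_subset[of "closure U - U"] by auto
qed

text \<open>A set which is meagre on some small open set inside every open set is meagre: the small sets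
  fill up an open dense set, countably many of them suffice, and the rest is nowhere dense.\<close>

lemma meagre_if_densely_meagre:
  assumes B: "countable B" "topological_basis B" "{} \<notin> B" and V: "open V"
    and dense: "\<And>W. W \<in> B \<Longrightarrow> W \<subseteq> V \<Longrightarrow> \<exists>W'\<in>B. W' \<subseteq> W \<and> meagre (W' \<inter> S)"
  shows "meagre (V \<inter> S)"
proof -
  define F where "F = {W \<in> B. meagre (W \<inter> S)}"
  have F: "W \<in> B" "meagre (W \<inter> S)" if "W \<in> F" for W using that by (auto simp: F_def)
  have "open (\<Union>F)" using F(1) topological_basis_open[OF B(2)] by (intro open_Union) auto
  have V_sub: "V \<subseteq> closure (\<Union>F)"
  proof (rule ccontr)
    assume "\<not> V \<subseteq> closure (\<Union>F)"
    then obtain v where v: "v \<in> V - closure (\<Union>F)" by auto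
    have "open (V - closure (\<Union>F))" using V by (intro open_Diff) auto
    then obtain W where W: "W \<in> B" "W \<subseteq> V - closure (\<Union>F)"
      using topological_basisE[OF B(2) _ v] by metis
    then obtain W' where W': "W' \<in> B" "W' \<subseteq> W" "meagre (W' \<inter> S)" using dense[of W] by auto
    then have "W' \<in> F" by (simp add: F_def)
    then have "W' \<subseteq> closure (\<Union>F)" using closure_subset by (metis Union_upper order_trans)
    then have "W' = {}" using W(2) W'(2) by auto
    then show False using B(3) W'(1) by simp
  qed
  have "F \<subseteq> B" using F(1) by auto
  then have "meagre (\<Union>W\<in>F. W \<inter> S)" using countable_subset B(1) F(2) by (intro meagre_UN) auto
  then have m: "meagre ((closure (\<Union>F) - \<Union>F) \<union> (\<Union>W\<in>F. W \<inter> S))"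
    by (intro meagre_Un meagre_boundary_open \<open>open (\<Union>F)\<close>)
  show ?thesis
  proof (rule meagre_subset[OF m], rule subsetI)
    fix x assume x: "x \<in> V \<inter> S"
    then have "x \<in> closure (\<Union>F)" using V_sub by auto
    then show "x \<in> (closure (\<Union>F) - \<Union>F) \<union> (\<Union>W\<in>F. W \<inter> S)" using x by auto
  qed
qed

text \<open>The category analogue of the measurability part of Fubini's theorem, together with the Baire
  property of the sections. The two statements are proved simultaneously, by induction over the
  product \<open>\<sigma>\<close>-algebra, because complements mix them: by the Baire property, the complement of a
  section is meagre on \<open>V\<close> iff the section is nonmeagre on every basic \<open>W\<close> inside \<open>V\<close>.\<close>

lemma category_sections:
  fixes B :: "'g::{second_countable_topology, t2_space} set set" and M :: "'x measure"
  assumes lc: "locally_compact_space (euclidean :: 'g topology)"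
    and B: "countable B" "topological_basis B" "{} \<notin> B"
    and E: "E \<in> sets (borel \<Otimes>\<^sub>M M)"
  shows "\<And>V. V \<in> B \<Longrightarrow> {x \<in> space M. meagre ((\<lambda>g. (g, x)) -` E \<inter> V)} \<in> sets M"
    and "\<And>x V. x \<in> space M \<Longrightarrow> V \<in> B \<Longrightarrow> \<not> meagre ((\<lambda>g. (g, x)) -` E \<inter> V) \<Longrightarrow>
            \<exists>W\<in>B. W \<subseteq> V \<and> meagre (W - (\<lambda>g. (g, x)) -` E)"
proof -
  let ?s = "\<lambda>x E. (\<lambda>g::'g. (g, x)) -` E"
  define good where "good E \<longleftrightarrow> (\<forall>V\<in>B. {x \<in> space M. meagre (?s x E \<inter> V)} \<in> sets M) \<and>
     (\<forall>x\<in>space M. \<forall>V\<in>B. \<not> meagre (?s x E \<inter> V) \<longrightarrow> (\<exists>W\<in>B. W \<subseteq> V \<and> meagre (W - ?s x E)))" for E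
  define \<G> where "\<G> = {E. E \<subseteq> UNIV \<times> space M \<and> good E}"
  have opB: "open V" if "V \<in> B" for V using B(2) that by (rule topological_basis_open)
  have nonm: "\<not> meagre V" if "V \<in> B" for V
    using open_meagre_imp_empty[OF lc opB[OF that]] that B(3) by auto
  have compl: "UNIV \<times> space M - E \<in> \<G>" if E: "E \<in> \<G>" for E
  proof -
    have s: "?s x (UNIV \<times> space M - E) = - ?s x E" if "x \<in> space M" for x using that by auto
    have key: "meagre (- ?s x E \<inter> V) \<longleftrightarrow> (\<forall>W\<in>B. W \<subseteq> V \<longrightarrow> \<not> meagre (?s x E \<inter> W))"
      if x: "x \<in> space M" and V: "V \<in> B" for x V
    proof (intro iffI ballI impI notI)
      fix W assume m: "meagre (- ?s x E \<inter> V)" and W: "W \<in> B" "W \<subseteq> V" and "meagre (?s x E \<inter> W)"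
      then have "meagre ((- ?s x E \<inter> V) \<union> (?s x E \<inter> W))" by (intro meagre_Un)
      then have "meagre W" by (rule meagre_subset) (use W in auto)
      then show False using nonm W by blast
    next
      assume R: "\<forall>W\<in>B. W \<subseteq> V \<longrightarrow> \<not> meagre (?s x E \<inter> W)"
      have "meagre (V \<inter> - ?s x E)"
      proof (rule meagre_if_densely_meagre[OF B opB[OF V]])
        fix W assume "W \<in> B" "W \<subseteq> V"
        then show "\<exists>W'\<in>B. W' \<subseteq> W \<and> meagre (W' \<inter> - ?s x E)"
          using R E x by (simp add: \<G>_def good_def Diff_eq)
      qed
      then show "meagre (- ?s x E \<inter> V)" by (simp add: Int_commute)
    qed
    have "{x \<in> space M. meagre (?s x (UNIV \<times> space M - E) \<inter> V)} \<in> sets M" if V: "V \<in> B" for V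
    proof -
      have "{x \<in> space M. meagre (?s x (UNIV \<times> space M - E) \<inter> V)} =
         space M - (\<Union>W\<in>{W\<in>B. W \<subseteq> V}. {x \<in> space M. meagre (?s x E \<inter> W)})"
        using key[OF _ V] s by auto
      also have "\<dots> \<in> sets M"
      proof (intro sets.Diff sets.top sets.countable_UN'')
        show "countable {W \<in> B. W \<subseteq> V}" by (rule countable_subset[OF _ B(1)]) auto
        fix W assume "W \<in> {W\<in>B. W \<subseteq> V}"
        then show "{x \<in> space M. meagre (?s x E \<inter> W)} \<in> sets M" using E by (auto simp: \<G>_def good_def)
      qed
      finally show ?thesis .
    qed
    moreover have "\<exists>W\<in>B. W \<subseteq> V \<and> meagre (W - ?s x (UNIV \<times> space M - E))"
      if "x \<in> space M" "V \<in> B" "\<not> meagre (?s x (UNIV \<times> space M - E) \<inter> V)" for x V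
    proof -
      have "\<not> (\<forall>W\<in>B. W \<subseteq> V \<longrightarrow> \<not> meagre (?s x E \<inter> W))"
        using key[OF that(1,2)] s[OF that(1)] that(3) by simp
      then obtain W where "W \<in> B" "W \<subseteq> V" "meagre (?s x E \<inter> W)" by blast
      then show ?thesis using s[OF that(1)] by (intro bexI[of _ W]) (auto simp: Int_commute Diff_eq)
    qed
    ultimately show ?thesis unfolding \<G>_def good_def by auto
  qed
  have un: "(\<Union>i. A i) \<in> \<G>" if A: "range A \<subseteq> \<G>" for A :: "nat \<Rightarrow> _"
  proof -
    have s: "meagre (?s x (\<Union>i. A i) \<inter> V) \<longleftrightarrow> (\<forall>i. meagre (?s x (A i) \<inter> V))" for x V
    proof
      assume "\<forall>i. meagre (?s x (A i) \<inter> V)"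
      then have "meagre (\<Union>i. ?s x (A i) \<inter> V)" by (intro meagre_UN) auto
      then show "meagre (?s x (\<Union>i. A i) \<inter> V)" by (rule meagre_subset) auto
    next
      assume "meagre (?s x (\<Union>i. A i) \<inter> V)"
      then have "meagre (?s x (A i) \<inter> V)" for i by (rule meagre_subset) auto
      then show "\<forall>i. meagre (?s x (A i) \<inter> V)" ..
    qed
    have Ai: "A i \<subseteq> UNIV \<times> space M" "good (A i)" for i using A unfolding \<G>_def by auto
    have "good (\<Union>i. A i)"
      unfolding good_def
    proof (intro conjI ballI impI)
      fix V assume V: "V \<in> B"
      then have "{x \<in> space M. meagre (?s x (A i) \<inter> V)} \<in> sets M" for i
        using Ai(2)[of i] by (auto simp: good_def)
      then show "{x \<in> space M. meagre (?s x (\<Union>i. A i) \<inter> V)} \<in> sets M"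
        unfolding s by (rule sets.sets_Collect_countable_All)
    next
      fix x V assume x: "x \<in> space M" and V: "V \<in> B" and n: "\<not> meagre (?s x (\<Union>i. A i) \<inter> V)"
      then obtain i where "\<not> meagre (?s x (A i) \<inter> V)" using s by auto
      then obtain W where "W \<in> B" "W \<subseteq> V" "meagre (W - ?s x (A i))"
        using Ai(2)[of i] x V unfolding good_def by blast
      moreover have "W - ?s x (\<Union>i. A i) \<subseteq> W - ?s x (A i)" by auto
      ultimately show "\<exists>W\<in>B. W \<subseteq> V \<and> meagre (W - ?s x (\<Union>i. A i))"
        using meagre_subset by blast
    qed
    then show ?thesis using Ai(1) unfolding \<G>_def by auto
  qed
  have sa: "sigma_algebra (UNIV \<times> space M) \<G>"
  proof (rule sigma_algebra_iff2[THEN iffD2], intro conjI ballI allI impI)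
    show "{} \<in> \<G>" by (auto simp: \<G>_def good_def)
  qed (use compl un in \<open>auto simp: \<G>_def\<close>)
  have open_strip: "S \<times> space M \<in> \<G>" if S: "open S" for S
  proof -
    have s: "?s x (S \<times> space M) = S" if "x \<in> space M" for x using that by auto
    have "{x \<in> space M. meagre (?s x (S \<times> space M) \<inter> V)} \<in> sets M" for V
    proof -
      have "{x \<in> space M. meagre (?s x (S \<times> space M) \<inter> V)} = (if meagre (S \<inter> V) then space M else {})"
        using s by auto
      then show ?thesis by simp
    qed
    moreover have "\<exists>W\<in>B. W \<subseteq> V \<and> meagre (W - S)" if "V \<in> B" "\<not> meagre (S \<inter> V)" for V
    proof -
      have "S \<inter> V \<noteq> {}" using that by (metis meagre_empty)
      then obtain v where "v \<in> S \<inter> V" by auto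
      moreover have "open (S \<inter> V)" using S opB[OF that(1)] by auto
      ultimately obtain W where W: "W \<in> B" "W \<subseteq> S \<inter> V"
        using topological_basisE[OF B(2)] by metis
      then have "meagre (W - S)" by (intro meagre_subset[OF meagre_empty]) auto
      then show ?thesis using W by blast
    qed
    ultimately show ?thesis using s unfolding \<G>_def good_def by auto
  qed
  have strip: "UNIV \<times> A \<in> \<G>" if A: "A \<in> sets M" for A
  proof -
    have s: "?s x (UNIV \<times> A) = (if x \<in> A then UNIV else {})" for x by auto
    have "{x \<in> space M. meagre (?s x (UNIV \<times> A) \<inter> V)} = space M - A" if "V \<in> B" for V
      using nonm[OF that] s by auto
    moreover have "\<exists>W\<in>B. W \<subseteq> V \<and> meagre (W - ?s x (UNIV \<times> A))"
       if "V \<in> B" "\<not> meagre (?s x (UNIV \<times> A) \<inter> V)" for x V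
       using that s by (intro bexI[of _ V]) (auto split: if_splits)
    ultimately show ?thesis using A sets.sets_into_space[OF A] unfolding \<G>_def good_def by auto
  qed
  \<comment> \<open>both projections are measurable for the \<open>\<sigma>\<close>-algebra of good sets, which therefore contains
    the product \<open>\<sigma>\<close>-algebra\<close>
  let ?N = "measure_of (UNIV \<times> space M) \<G> (\<lambda>_. 0)"
  have N: "sets ?N = \<G>" "space ?N = UNIV \<times> space M"
    using sigma_algebra.sets_measure_of_eq[OF sa] sigma_algebra.space_measure_of_eq[OF sa] by auto
  have "fst \<in> measurable ?N borel"
  proof (rule borel_measurableI)
    fix S :: "'g set" assume "open S"
    moreover have "fst -` S \<inter> space ?N = S \<times> space M" unfolding N by auto
    ultimately show "fst -` S \<inter> space ?N \<in> sets ?N" using open_strip N by auto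
  qed
  moreover have "snd \<in> measurable ?N M"
  proof (rule measurableI)
    fix A assume A: "A \<in> sets M"
    have "snd -` A \<inter> space ?N = UNIV \<times> A" unfolding N using sets.sets_into_space[OF A] by auto
    then show "snd -` A \<inter> space ?N \<in> sets ?N" using strip A N by auto
  qed (auto simp: N)
  ultimately have "(\<lambda>z. (fst z, snd z)) \<in> measurable ?N (borel \<Otimes>\<^sub>M M)" by (rule measurable_Pair)
  then have id: "(\<lambda>z. z) \<in> measurable ?N (borel \<Otimes>\<^sub>M M)" by simp
  have "E \<subseteq> UNIV \<times> space M" using sets.sets_into_space[OF E] by (auto simp: space_pair_measure)
  then have "E \<in> \<G>"
    using measurable_sets[OF id E] N by (simp add: vimage_def Int_absorb2)
  then show "\<And>V. V \<in> B \<Longrightarrow> {x \<in> space M. meagre (?s x E \<inter> V)} \<in> sets M"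
    and "\<And>x V. x \<in> space M \<Longrightarrow> V \<in> B \<Longrightarrow> \<not> meagre (?s x E \<inter> V) \<Longrightarrow>
            \<exists>W\<in>B. W \<subseteq> V \<and> meagre (W - ?s x E)"
    unfolding \<G>_def good_def by auto
qed

section \<open>Functions that are continuous along orbits\<close>

lemma countable_basis_nonempty:
  obtains B :: "'a::second_countable_topology set set"
  where "countable B" "topological_basis B" "{} \<notin> B"
proof -
  obtain B :: "'a set set" where B: "countable B" "topological_basis B"
    using ex_countable_basis by blast
  have "topological_basis (B - {{}})"
  proof (rule topological_basisI)
    fix U x assume "open U" "x \<in> (U :: 'a set)"
    then obtain W where "W \<in> B" "x \<in> W" "W \<subseteq> U" using topological_basisE[OF B(2)] by metis
    then show "\<exists>W\<in>B - {{}}. x \<in> W \<and> W \<subseteq> U" by (intro bexI[of _ W]) auto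
  qed (use B(2) topological_basis_open in auto)
  then show ?thesis using B(1) by (intro that[of "B - {{}}"]) auto
qed

lemma bump_function:
  fixes W :: "'g::t2_space set"
  assumes lc: "locally_compact_space (euclidean :: 'g topology)" and W: "open W" "w \<in> W"
  obtains h :: "'g \<Rightarrow> real" and C where "continuous_on UNIV h" "compact C" "\<forall>g. g \<notin> C \<longrightarrow> h g = 0"
    "\<forall>g. g \<notin> W \<longrightarrow> h g = 0" "\<forall>g. 0 \<le> h g \<and> h g \<le> 1" "h w = 1"
proof -
  obtain U C where U: "open U" "compact C" "w \<in> U" "U \<subseteq> C"
    using lc unfolding locally_compact_space_def by simp metis
  have "completely_regular_space (euclidean :: 'g topology)"
    by (rule locally_compact_regular_imp_completely_regular_space[OF lc]) (simp add: Hausdorff_space_t2)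
  moreover have "closed (- (W \<inter> U))" using W U by auto
  ultimately obtain f :: "'g \<Rightarrow> real" where f: "continuous_map euclidean (top_of_set {0..1}) f" "f w = 0"
      "f ` (- (W \<inter> U)) \<subseteq> {1}"
    unfolding completely_regular_space_def using W(2) U(3) by (metis Compl_iff Diff_iff IntI UNIV_I closed_closedin topspace_euclidean)
  have c: "continuous_on UNIV f" and r: "f g \<in> {0..1}" for g
    using f(1) by (auto simp: continuous_map_in_subtopology)
  have off: "f g = 1" if "g \<notin> W \<inter> U" for g using f(3) that by blast
  show ?thesis
  proof (rule that[of "\<lambda>g. 1 - f g" C]; (intro allI impI)?)
    show "continuous_on UNIV (\<lambda>g. 1 - f g)" using c by (intro continuous_intros)
    show "1 - f g = 0" if "g \<notin> C" for g using off[of g] that U(4) by auto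
    show "1 - f g = 0" if "g \<notin> W" for g using off[of g] that by auto
    show "0 \<le> 1 - f g \<and> 1 - f g \<le> 1" for g using r[of g] by auto
  qed (use U f(2) in auto)
qed

locale lc_borel_space = pp_borel_space M act
  for M :: "'x measure"
    and act :: "'g::{topological_ab_group_add, second_countable_topology, t2_space} \<Rightarrow> 'x \<Rightarrow> 'x" +
  assumes locally_compact: "locally_compact_space (euclidean :: 'g topology)"
begin

lemma act_in_space [simp]: "x \<in> space M \<Longrightarrow> act g x \<in> space M"
  using measurable_space[OF act_measurable, of "(g, x)"] by (simp add: space_pair_measure)

lemma measurable_act [measurable]:
  assumes [measurable]: "f \<in> borel_measurable N" "k \<in> measurable N M"
  shows "(\<lambda>x. act (f x) (k x)) \<in> measurable N M"
proof -
  have "(\<lambda>x. (\<lambda>(g, x). act g x) (f x, k x)) \<in> measurable N M"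
    by (intro measurable_compose[OF _ act_measurable]) measurable
  then show ?thesis by simp
qed

lemma act_act: "x \<in> space M \<Longrightarrow> act g (act h x) = act (g + h) x"
  by (simp add: act_add)

lemma act_minus_cancel: "x \<in> space M \<Longrightarrow> act (- g) (act g x) = x"
  by (simp add: act_act act_zero)

lemma countable_separating_sets:
  obtains A :: "nat \<Rightarrow> 'x set" where "\<forall>n. A n \<in> sets M"
    "\<forall>x\<in>space M. \<forall>y\<in>space M. (\<forall>n. x \<in> A n \<longleftrightarrow> y \<in> A n) \<longrightarrow> x = y"
proof -
  obtain T where T: "topspace T = space M" "completely_metrizable_space T" "second_countable T"
     "sets M = sigma_sets (space M) {U. openin T U}"
    using standard_borel unfolding standard_borel_def by blast
  obtain B where B: "countable B" "\<And>V. V \<in> B \<Longrightarrow> openin T V"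
      "\<And>U x. openin T U \<Longrightarrow> x \<in> U \<Longrightarrow> \<exists>V\<in>B. x \<in> V \<and> V \<subseteq> U"
    using T(3) unfolding second_countable_def by (auto simp: Bex_def)
  have haus: "Hausdorff_space T"
    using T(2) completely_metrizable_imp_metrizable_space metrizable_imp_Hausdorff_space by blast
  let ?A = "from_nat_into (insert {} B)"
  have rng: "range ?A = insert {} B" using B(1) by (intro range_from_nat_into) auto
  show ?thesis
  proof (rule that[of ?A]; intro allI ballI impI)
    fix n
    have "?A n \<in> insert {} B" using rng by blast
    then have "openin T (?A n)" using B(2) by auto
    then show "?A n \<in> sets M" using T(4) by (auto intro: sigma_sets.Basic)
  next
    fix x y assume xy: "x \<in> space M" "y \<in> space M" "\<forall>n. x \<in> ?A n \<longleftrightarrow> y \<in> ?A n"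
    show "x = y"
    proof (rule ccontr)
      assume "x \<noteq> y"
      then obtain U V where "openin T U" "openin T V" "x \<in> U" "y \<in> V" "disjnt U V"
        using haus xy T(1) unfolding Hausdorff_space_def by metis
      moreover then obtain W where W: "W \<in> B" "x \<in> W" "W \<subseteq> U" using B(3) by blast
      moreover obtain n where "?A n = W" using rng W(1) by (metis imageE insertI2)
      ultimately show False using spec[OF xy(3), of n] by (auto simp: disjnt_iff)
    qed
  qed
qed

definition hits :: "'x set \<Rightarrow> 'x \<Rightarrow> 'g set" where
  "hits A x = {g. act g x \<in> A}"

lemma hits_category:
  assumes A: "A \<in> sets M" and B: "countable B" "topological_basis B" "{} \<notin> B"
  shows "V \<in> B \<Longrightarrow> {x \<in> space M. meagre (hits A x \<inter> V)} \<in> sets M"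
    and "x \<in> space M \<Longrightarrow> V \<in> B \<Longrightarrow> \<not> meagre (hits A x \<inter> V) \<Longrightarrow> \<exists>W\<in>B. W \<subseteq> V \<and> meagre (W - hits A x)"
proof -
  let ?E = "(\<lambda>(g, x). act g x) -` A \<inter> space (borel \<Otimes>\<^sub>M M)"
  have E: "?E \<in> sets (borel \<Otimes>\<^sub>M M)" by (rule measurable_sets[OF act_measurable A])
  have sec: "(\<lambda>g. (g, x)) -` ?E = hits A x" if "x \<in> space M" for x
    using that by (auto simp: hits_def space_pair_measure)
  note cs = category_sections[OF locally_compact B E]
  show "{x \<in> space M. meagre (hits A x \<inter> V)} \<in> sets M" if "V \<in> B"
    using cs(1)[OF that] sec by (simp cong: conj_cong)
  show "\<exists>W\<in>B. W \<subseteq> V \<and> meagre (W - hits A x)" if "x \<in> space M" "V \<in> B" "\<not> meagre (hits A x \<inter> V)"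
    using cs(2)[of x V] that sec by simp
qed

lemma hits_meagre_measurable:
  assumes A: "A \<in> sets M" and U: "open U"
  shows "{x \<in> space M. meagre (hits A x \<inter> U)} \<in> sets M"
proof -
  obtain B :: "'g set set" where B: "countable B" "topological_basis B" "{} \<notin> B"
    by (rule countable_basis_nonempty)
  obtain B' where B': "B' \<subseteq> B" "U = \<Union>B'"
    using B(2) U unfolding topological_basis_def by metis
  have cB': "countable B'" using B'(1) B(1) countable_subset by blast
  have "meagre (hits A x \<inter> U) \<longleftrightarrow> (\<forall>V\<in>B'. meagre (hits A x \<inter> V))" for x
  proof
    assume m: "meagre (hits A x \<inter> U)"
    show "\<forall>V\<in>B'. meagre (hits A x \<inter> V)"
      by (intro ballI meagre_subset[OF m]) (auto simp: B'(2))
  next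
    assume "\<forall>V\<in>B'. meagre (hits A x \<inter> V)"
    then have "meagre (\<Union>V\<in>B'. hits A x \<inter> V)" using cB' by (intro meagre_UN) auto
    then show "meagre (hits A x \<inter> U)" by (rule meagre_subset) (auto simp: B'(2))
  qed
  then have "{x \<in> space M. meagre (hits A x \<inter> U)} =
      space M - (\<Union>V\<in>B'. space M - {x \<in> space M. meagre (hits A x \<inter> V)})" by auto
  also have "\<dots> \<in> sets M"
    using hits_category(1)[OF A B] B'(1) cB' by (intro sets.Diff sets.top sets.countable_UN'') auto
  finally show ?thesis .
qed

lemma hits_Borel:
  assumes "A \<in> sets M" "x \<in> space M" shows "hits A x \<in> sets borel"
proof -
  have "(\<lambda>g. act g x) \<in> measurable borel M" using assms by measurable
  from measurable_sets[OF this assms(1)] show ?thesis by (simp add: hits_def vimage_def)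
qed

text \<open>The strip \<open>D \<times> space M\<close> has all its sections equal to \<open>D\<close>, so this is an instance of the statement
  about sections.\<close>

lemma Borel_Baire_property:
  assumes B: "countable B" "topological_basis B" "{} \<notin> B" and D: "D \<in> sets (borel :: 'g measure)"
    and n: "\<not> meagre D"
  shows "\<exists>W\<in>B. meagre (W - D)"
proof -
  obtain x where x: "x \<in> space M" using not_empty by blast
  have "\<exists>V\<in>B. \<not> meagre (D \<inter> V)"
  proof (rule ccontr)
    assume "\<not> ?thesis"
    then have "meagre (\<Union>V\<in>B. D \<inter> V)" using B(1) by (intro meagre_UN) auto
    moreover have "D \<subseteq> (\<Union>V\<in>B. D \<inter> V)"
      using topological_basisE[OF B(2) open_UNIV] by auto
    ultimately show False using n meagre_subset by blast
  qed
  then obtain V where V: "V \<in> B" "\<not> meagre (D \<inter> V)" by blast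
  have "D \<times> space M \<in> sets (borel \<Otimes>\<^sub>M M)" using D by auto
  moreover have "(\<lambda>g. (g, x)) -` (D \<times> space M) = D" using x by auto
  ultimately show ?thesis using category_sections(2)[OF locally_compact B _ x V(1), of "D \<times> space M"] V(2) by auto
qed

text \<open>The essential supremum, in the sense of category, of a bump function \<open>h\<close> over the times at which
  \<open>x\<close> hits \<open>A\<close>. It plays the part of the Haar integral of \<open>h\<close> over these times: replacing \<open>x\<close> by
  \<open>act k x\<close> amounts to translating \<open>h\<close>, so it varies continuously along the orbit however irregular
  \<open>A\<close> is, and it ignores small sets of times. The value 0 keeps the supremum defined when \<open>h\<close> only
  sees a meagre set of hitting times.\<close>

definition category_sup :: "'x set \<Rightarrow> ('g \<Rightarrow> real) \<Rightarrow> 'x \<Rightarrow> real" where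
  "category_sup A h x = Sup (insert 0 {q. 0 \<le> q \<and> \<not> meagre (hits A x \<inter> {g. q < h g})})"

lemma category_sup_greater_iff:
  assumes h: "\<forall>g. h g \<le> 1" and a: "0 \<le> a"
  shows "a < category_sup A h x \<longleftrightarrow> \<not> meagre (hits A x \<inter> {g. a < h g})"
proof -
  let ?Q = "insert 0 {q. 0 \<le> q \<and> \<not> meagre (hits A x \<inter> {g. q < h g})}"
  have "q \<le> 1" if "q \<in> ?Q" for q
  proof (rule ccontr)
    assume "\<not> q \<le> 1"
    then have "\<not> q < h g" for g using h by (auto simp: not_less intro: order_trans[of _ 1])
    then have "{g. q < h g} = {}" by simp
    then show False using that \<open>\<not> q \<le> 1\<close> by auto
  qed
  then have bdd: "bdd_above ?Q" by (intro bdd_aboveI)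
  show ?thesis
  proof
    assume "a < category_sup A h x"
    then obtain q where q: "q \<in> ?Q" "a < q"
      unfolding category_sup_def using less_cSup_iff[OF _ bdd] by auto
    then have n: "\<not> meagre (hits A x \<inter> {g. q < h g})" using a by auto
    show "\<not> meagre (hits A x \<inter> {g. a < h g})"
    proof
      assume "meagre (hits A x \<inter> {g. a < h g})"
      then have "meagre (hits A x \<inter> {g. q < h g})" by (rule meagre_subset) (use q in auto)
      then show False using n by simp
    qed
  next
    assume n: "\<not> meagre (hits A x \<inter> {g. a < h g})"
    have "\<exists>n. \<not> meagre (hits A x \<inter> {g. a + 1 / real (Suc n) < h g})"
    proof (rule ccontr)
      assume "\<not> ?thesis"
      then have m: "meagre (\<Union>n. hits A x \<inter> {g. a + 1 / real (Suc n) < h g})" by (intro meagre_UN) auto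
      have "hits A x \<inter> {g. a < h g} \<subseteq> (\<Union>n. hits A x \<inter> {g. a + 1 / real (Suc n) < h g})"
      proof
        fix g assume g: "g \<in> hits A x \<inter> {g. a < h g}"
        then obtain n where "inverse (real (Suc n)) < h g - a" using reals_Archimedean[of "h g - a"] by auto
        then show "g \<in> (\<Union>n. hits A x \<inter> {g. a + 1 / real (Suc n) < h g})"
          using g by (auto intro!: exI[of _ n] simp: inverse_eq_divide)
      qed
      then show False using n meagre_subset[OF m] by blast
    qed
    then obtain n where "\<not> meagre (hits A x \<inter> {g. a + 1 / real (Suc n) < h g})" by blast
    then have "a + 1 / real (Suc n) \<in> ?Q" using a by auto
    then have "a + 1 / real (Suc n) \<le> category_sup A h x"
      unfolding category_sup_def by (rule cSup_upper) (rule bdd)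
    then show "a < category_sup A h x" by (rule less_le_trans[rotated]) simp
  qed
qed

lemma category_sup_nonneg:
  assumes h: "\<forall>g. h g \<le> 1" shows "0 \<le> category_sup A h x"
proof (rule ccontr)
  assume "\<not> 0 \<le> category_sup A h x"
  then have "\<not> 0 < category_sup A h x" by simp
  then have "{q. 0 \<le> q \<and> \<not> meagre (hits A x \<inter> {g. q < h g})} \<subseteq> {}"
  proof -
    assume "\<not> 0 < category_sup A h x"
    then have m: "meagre (hits A x \<inter> {g. 0 < h g})" using category_sup_greater_iff[OF h order_refl] by blast
    have "meagre (hits A x \<inter> {g. q < h g})" if "0 \<le> q" for q
      by (rule meagre_subset[OF m]) (use that in auto)
    then show ?thesis by auto
  qed
  then have "{q. 0 \<le> q \<and> \<not> meagre (hits A x \<inter> {g. q < h g})} = {}" by (rule subset_empty[THEN iffD1])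
  then have "category_sup A h x = 0" unfolding category_sup_def by (simp only: cSup_singleton)
  then show False using \<open>\<not> 0 \<le> category_sup A h x\<close> by simp
qed

lemma category_sup_measurable:
  assumes A: "A \<in> sets M" and h: "continuous_on UNIV h" "\<forall>g. h g \<le> 1"
  shows "category_sup A h \<in> borel_measurable M"
proof (rule borel_measurableI_greater)
  fix a
  show "{x \<in> space M. a < category_sup A h x} \<in> sets M"
  proof (cases "0 \<le> a")
    case True
    have "open (h -` {a<..})" using h(1) by (intro open_vimage) auto
    then have "open {g. a < h g}" by (simp add: vimage_def)
    then have m: "{x \<in> space M. meagre (hits A x \<inter> {g. a < h g})} \<in> sets M"
      by (rule hits_meagre_measurable[OF A])
    have "{x \<in> space M. a < category_sup A h x} = space M - {x \<in> space M. meagre (hits A x \<inter> {g. a < h g})}"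
      using category_sup_greater_iff[OF h(2) True] by auto
    then show ?thesis using m by auto
  next
    case False
    then have "{x \<in> space M. a < category_sup A h x} = space M"
      using less_le_trans[OF _ category_sup_nonneg[OF h(2)], of a] by auto
    then show ?thesis by simp
  qed
qed

text \<open>The hitting times of \<open>act k x\<close> are those of \<open>x\<close> shifted by \<open>k\<close>, meagreness is invariant under shifts,
  and a small shift changes \<open>h\<close> by little, uniformly.\<close>

lemma category_sup_continuous:
  assumes h: "continuous_on UNIV h" "\<forall>g. h g \<le> 1" and C: "compact C" "\<And>g. g \<notin> C \<Longrightarrow> h g = 0"
    and x: "x \<in> space M"
  shows "continuous_on UNIV (\<lambda>g. category_sup A h (act g x))"
proof -
  have step: "category_sup A h (act k x) \<le> category_sup A h (act k' x) + e"
    if e: "e > 0" and V: "\<forall>g g'. g - g' \<in> V \<longrightarrow> norm (h g - h g') < e" and k: "k' - k \<in> V" for e V k k'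
  proof (rule ccontr)
    let ?c = "category_sup A h (act k' x)"
    have c0: "0 \<le> ?c" by (rule category_sup_nonneg[OF h(2)])
    assume "\<not> ?thesis"
    then have "?c + e < category_sup A h (act k x)" by simp
    then have n: "\<not> meagre (hits A (act k x) \<inter> {g. ?c + e < h g})"
      using category_sup_greater_iff[OF h(2), of "?c + e" A "act k x"] c0 e by auto
    have m: "meagre (hits A (act k' x) \<inter> {g. ?c < h g})"
      using category_sup_greater_iff[OF h(2) c0, of A "act k' x"] by auto
    have "meagre {g. g + (k - k') \<in> hits A (act k' x) \<inter> {g. ?c < h g}}" by (rule meagre_shift[OF m])
    then have "meagre (hits A (act k x) \<inter> {g. ?c + e < h g})"
    proof (rule meagre_subset, intro subsetI CollectI IntI)
      fix g assume g: "g \<in> hits A (act k x) \<inter> {g. ?c + e < h g}"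
      then show "g + (k - k') \<in> hits A (act k' x)" using x by (simp add: hits_def act_act algebra_simps)
      have "norm (h g - h (g + (k - k'))) < e" using k by (intro V[rule_format]) (simp add: algebra_simps)
      then show "?c < h (g + (k - k'))" using g by (simp add: abs_if split: if_splits)
    qed
    then show False using n by simp
  qed
  show ?thesis
  proof (rule continuous_at_imp_continuous_on, rule ballI, unfold continuous_at, rule tendstoI)
    fix k and e :: real assume e: "e > 0"
    obtain V where V: "open V" "0 \<in> V" "\<forall>g g'. g - g' \<in> V \<longrightarrow> norm (h g - h g') < e / 2"
      by (rule compactly_supported_uniformly_continuous[OF h(1) C half_gt_zero[OF e]])
    obtain V' where V': "open V'" "0 \<in> V'" "\<And>g. g \<in> V' \<Longrightarrow> - g \<in> V'"
       "\<And>x y. x \<in> V' \<Longrightarrow> y \<in> V' \<Longrightarrow> x + y \<in> V"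
      by (rule zero_nhd_halving[OF V(1,2)]) blast
    have V'V: "g \<in> V" if "g \<in> V'" for g using V'(4)[OF that V'(2)] by simp
    have "dist (category_sup A h (act g x)) (category_sup A h (act k x)) < e" if "g + (- k) \<in> V'" for g
    proof -
      have "g - k \<in> V" "k - g \<in> V" using V'V that V'(3)[OF that] by auto
      then have "category_sup A h (act g x) \<le> category_sup A h (act k x) + e / 2"
        "category_sup A h (act k x) \<le> category_sup A h (act g x) + e / 2"
        using step[OF half_gt_zero[OF e] V(3)] by blast+
      then show ?thesis using e by (simp add: dist_real_def abs_if)
    qed
    then show "\<forall>\<^sub>F g in at k. dist (category_sup A h (act g x)) (category_sup A h (act k x)) < e"
      unfolding eventually_at_topological using open_shift[OF V'(1), of "- k"] V'(2)
      by (intro exI[of _ "{g. g + (- k) \<in> V'}"]) auto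
  qed
qed

text \<open>The functions are the category suprema of countably many bump functions for countably many sets
  that separate points. If they all agree at \<open>x\<close> and \<open>y\<close>, then for each of these sets the hitting
  times of \<open>x\<close> and of \<open>y\<close> differ by a meagre set only. By Baire's theorem some time \<open>g\<close> avoids all these
  meagre sets, so that no set of the family separates \<open>act g x\<close> from \<open>act g y\<close>.\<close>

lemma separating_orbit_continuous:
  obtains \<Psi> :: "nat \<Rightarrow> 'x \<Rightarrow> real" where "\<forall>n. \<Psi> n \<in> borel_measurable M"
    "\<forall>n. \<forall>x\<in>space M. continuous_on UNIV (\<lambda>g. \<Psi> n (act g x))"
    "\<forall>x\<in>space M. \<forall>y\<in>space M. (\<forall>n. \<Psi> n x = \<Psi> n y) \<longrightarrow> x = y"
proof -
  obtain B :: "'g set set" where B: "countable B" "topological_basis B" "{} \<notin> B"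
    by (rule countable_basis_nonempty)
  have opB: "open V" if "V \<in> B" for V using B(2) that by (rule topological_basis_open)
  obtain A :: "nat \<Rightarrow> 'x set" where A0: "\<forall>n. A n \<in> sets M"
    "\<forall>x\<in>space M. \<forall>y\<in>space M. (\<forall>n. x \<in> A n \<longleftrightarrow> y \<in> A n) \<longrightarrow> x = y"
    by (rule countable_separating_sets)
  have A: "A n \<in> sets M" for n using A0(1) by simp
  have "\<forall>W\<in>B. \<exists>h :: 'g \<Rightarrow> real. continuous_on UNIV h \<and> (\<forall>g. h g \<le> 1) \<and>
      (\<exists>C. compact C \<and> (\<forall>g. g \<notin> C \<longrightarrow> h g = 0)) \<and> (\<forall>g. g \<notin> W \<longrightarrow> h g = 0) \<and> (\<exists>w. 0 < h w)"
  proof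
    fix W assume W: "W \<in> B"
    obtain w where w: "w \<in> W" using B(3) W by (cases "W = {}") auto
    obtain h :: "'g \<Rightarrow> real" and C where "continuous_on UNIV h" "compact C" "\<forall>g. g \<notin> C \<longrightarrow> h g = 0"
      "\<forall>g. g \<notin> W \<longrightarrow> h g = 0" "\<forall>g. 0 \<le> h g \<and> h g \<le> 1" "h w = 1"
      by (rule bump_function[OF locally_compact opB[OF W] w])
    then show "\<exists>h :: 'g \<Rightarrow> real. continuous_on UNIV h \<and> (\<forall>g. h g \<le> 1) \<and>
      (\<exists>C. compact C \<and> (\<forall>g. g \<notin> C \<longrightarrow> h g = 0)) \<and> (\<forall>g. g \<notin> W \<longrightarrow> h g = 0) \<and> (\<exists>w. 0 < h w)"
      by (intro exI[of _ h] conjI exI[of _ C] exI[of _ w]) simp_all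
  qed
  from bchoice[OF this] obtain h :: "'g set \<Rightarrow> 'g \<Rightarrow> real"
    where h: "\<forall>W\<in>B. continuous_on UNIV (h W) \<and> (\<forall>g. h W g \<le> 1) \<and>
      (\<exists>C. compact C \<and> (\<forall>g. g \<notin> C \<longrightarrow> h W g = 0)) \<and> (\<forall>g. g \<notin> W \<longrightarrow> h W g = 0) \<and> (\<exists>w. 0 < h W w)" ..
  have hc: "continuous_on UNIV (h W)" and h1: "\<forall>g. h W g \<le> 1"
    and hW: "\<And>g. g \<notin> W \<Longrightarrow> h W g = 0" and hpos: "\<exists>w. 0 < h W w" if "W \<in> B" for W
    using h that by simp_all
  obtain W0 where "W0 \<in> B" "undefined \<in> W0" "W0 \<subseteq> UNIV"
    by (rule topological_basisE[OF B(2) open_UNIV UNIV_I])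
  then have "B \<noteq> {}" by auto
  define e where "e = from_nat_into B"
  have e: "e n \<in> B" for n unfolding e_def using \<open>B \<noteq> {}\<close> by (rule from_nat_into)
  have e_onto: "\<exists>n. e n = W" if "W \<in> B" for W
    unfolding e_def using from_nat_into_to_nat_on[OF B(1) that] by blast
  define \<Psi> where "\<Psi> n = category_sup (A (fst (prod_decode n))) (h (e (snd (prod_decode n))))" for n
  show ?thesis
  proof (rule that[of \<Psi>]; intro allI ballI impI)
    show "\<Psi> n \<in> borel_measurable M" for n
      unfolding \<Psi>_def by (intro category_sup_measurable A hc h1 e)
  next
    fix n x assume x: "x \<in> space M"
    show "continuous_on UNIV (\<lambda>g. \<Psi> n (act g x))"
    proof -
      let ?W = "e (snd (prod_decode n))"
      have "\<exists>C. compact C \<and> (\<forall>g. g \<notin> C \<longrightarrow> h ?W g = 0)" using bspec[OF h e] by simp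
      then obtain C where C: "compact C" "\<forall>g. g \<notin> C \<longrightarrow> h ?W g = 0" by blast
      show ?thesis unfolding \<Psi>_def
        by (rule category_sup_continuous[OF hc[OF e] h1[OF e] C(1) C(2)[rule_format] x])
    qed
  next
    fix x y assume x: "x \<in> space M" and y: "y \<in> space M" and eq: "\<forall>n. \<Psi> n x = \<Psi> n y"
    have sup_eq: "category_sup (A n) (h W) x = category_sup (A n) (h W) y" if W: "W \<in> B" for n W
    proof -
      obtain m where "e m = W" using e_onto[OF W] by blast
      then show ?thesis using spec[OF eq, of "prod_encode (n, m)"] by (simp add: \<Psi>_def)
    qed
    have *: "meagre (hits (A n) x - hits (A n) y)"
      if x: "x \<in> space M" and y: "y \<in> space M"
        and sup_eq: "\<And>W. W \<in> B \<Longrightarrow> category_sup (A n) (h W) x = category_sup (A n) (h W) y" for n x y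
    proof (rule ccontr)
      assume n: "\<not> ?thesis"
      \<comment> \<open>on some basic set \<open>W\<close> the times in the difference are comeagre\<close>
      obtain W where W: "W \<in> B" "meagre (W - (hits (A n) x - hits (A n) y))"
        using Borel_Baire_property[OF B, of "hits (A n) x - hits (A n) y"] n hits_Borel[OF A x] hits_Borel[OF A y] by blast
      let ?P = "{g. 0 < h W g}"
      have P: "open ?P" "?P \<noteq> {}" "?P \<subseteq> W"
      proof -
        have "open (h W -` {0<..})" using hc[OF W(1)] by (intro open_vimage) auto
        then show "open ?P" by (simp add: vimage_def)
        show "?P \<noteq> {}" using hpos[OF W(1)] by auto
        show "?P \<subseteq> W" using hW[OF W(1)] by force
      qed
      have "meagre (hits (A n) y \<inter> ?P)"
        by (rule meagre_subset[OF W(2)]) (use P(3) in auto)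
      then have "\<not> 0 < category_sup (A n) (h W) y"
        using category_sup_greater_iff[OF h1[OF W(1)] order_refl] by blast
      then have "meagre (hits (A n) x \<inter> ?P)"
        using category_sup_greater_iff[OF h1[OF W(1)] order_refl, of "A n" x] sup_eq[OF W(1)] by auto
      then have "meagre ((hits (A n) x \<inter> ?P) \<union> (W - (hits (A n) x - hits (A n) y)))"
        by (intro meagre_Un W)
      then have "meagre ?P" by (rule meagre_subset) (use P(3) in auto)
      then show False using open_meagre_imp_empty[OF locally_compact P(1)] P(2) by blast
    qed
    have "meagre (\<Union>n. (hits (A n) x - hits (A n) y) \<union> (hits (A n) y - hits (A n) x))"
      using *[OF x y] *[OF y x] sup_eq by (intro meagre_UN meagre_Un) auto
    then have "(\<Union>n. (hits (A n) x - hits (A n) y) \<union> (hits (A n) y - hits (A n) x)) \<noteq> UNIV"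
      using open_meagre_imp_empty[OF locally_compact open_UNIV] by auto
    then obtain g where "\<And>n. g \<in> hits (A n) x \<longleftrightarrow> g \<in> hits (A n) y" by auto
    then have "\<forall>n. act g x \<in> A n \<longleftrightarrow> act g y \<in> A n" by (simp add: hits_def)
    then have "act g x = act g y" using A0(2) x y by simp
    then have "act (- g) (act g x) = act (- g) (act g y)" by (rule arg_cong)
    then show "x = y" unfolding act_minus_cancel[OF x] act_minus_cancel[OF y] .
  qed
qed

end

section \<open>Borel transversals for compact subgroups\<close>

lemma countable_dense_subset:
  fixes C :: "'a::second_countable_topology set"
  obtains D where "countable D" "D \<subseteq> C" "C \<subseteq> closure D"
proof -
  obtain B :: "'a set set" where B: "countable B" "topological_basis B" "{} \<notin> B"
    by (rule countable_basis_nonempty)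
  define d where "d V = (SOME x. x \<in> V \<inter> C)" for V
  have d: "d V \<in> V \<inter> C" if "V \<inter> C \<noteq> {}" for V
    unfolding d_def using that by (intro someI_ex[of "\<lambda>x. x \<in> V \<inter> C"]) auto
  let ?D = "d ` {V \<in> B. V \<inter> C \<noteq> {}}"
  show ?thesis
  proof (rule that[of ?D])
    show "countable ?D" by (intro countable_image countable_subset[OF _ B(1)]) auto
    show "?D \<subseteq> C" using d by auto
    show "C \<subseteq> closure ?D"
    proof
      fix x assume x: "x \<in> C"
      show "x \<in> closure ?D"
      proof (rule ccontr)
        assume "x \<notin> closure ?D"
        then have xD: "x \<in> - closure ?D" by simp
        have op: "open (- closure ?D)" by (intro open_Compl closed_closure)
        obtain V where V: "V \<in> B" "x \<in> V" "V \<subseteq> - closure ?D"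
          by (rule topological_basisE[OF B(2) op xD])
        then have ne: "V \<inter> C \<noteq> {}" using x by auto
        then have "d V \<in> ?D" using V(1) by (intro imageI) simp
        then have "d V \<in> closure ?D" by (rule subsetD[OF closure_subset])
        moreover have "d V \<in> V" using d[OF ne] by simp
        then have "d V \<in> - closure ?D" by (rule subsetD[OF V(3)])
        ultimately show False by simp
      qed
    qed
  qed
qed

text \<open>Projections of Borel sets need not be Borel. For closed conditions on a compact set of parameters
  they are: an exact solution exists as soon as there are solutions up to any error of any finite
  number of the conditions, and these can be sought in a countable dense set.\<close>

lemma measurable_compact_projection:
  fixes q :: "nat \<Rightarrow> 'g::{second_countable_topology, t2_space} \<Rightarrow> 'x \<Rightarrow> real"
  assumes C: "compact C" and cont: "\<And>i x. x \<in> space M \<Longrightarrow> continuous_on UNIV (\<lambda>g. q i g x)"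
    and meas: "\<And>i g. q i g \<in> borel_measurable M"
  shows "{x \<in> space M. \<exists>g\<in>C. \<forall>i. q i g x \<le> 0} \<in> sets M"
proof -
  obtain D where D: "countable D" "D \<subseteq> C" "C \<subseteq> closure D" by (rule countable_dense_subset)
  have eq: "(\<exists>g\<in>C. \<forall>i. q i g x \<le> 0) \<longleftrightarrow> (\<forall>N. \<exists>g\<in>D. \<forall>i\<in>{..<N}. q i g x < 1 / real (Suc N))"
    if x: "x \<in> space M" for x
  proof (intro iffI allI)
    fix N assume "\<exists>g\<in>C. \<forall>i. q i g x \<le> 0"
    then obtain g where g: "g \<in> C" "\<forall>i. q i g x \<le> 0" by blast
    let ?O = "\<Inter>i\<in>{..<N}. (\<lambda>g. q i g x) -` {..<1 / real (Suc N)}"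
    have "open ?O" using cont[OF x] by (intro open_INT ballI open_vimage) auto
    have "q i g x < 1 / real (Suc N)" for i
    proof -
      have "q i g x \<le> 0" using g(2) by simp
      also have "0 < 1 / real (Suc N)" by simp
      finally show ?thesis .
    qed
    then have "g \<in> ?O" by simp
    moreover have "g \<in> closure D" using g(1) D(3) by blast
    ultimately have "?O \<inter> D \<noteq> {}" using open_Int_closure_eq_empty[OF \<open>open ?O\<close>, of D] by blast
    then obtain g' where "g' \<in> ?O" "g' \<in> D" by blast
    then show "\<exists>g\<in>D. \<forall>i\<in>{..<N}. q i g x < 1 / real (Suc N)" by (intro bexI[of _ g']) auto
  next
    assume R: "\<forall>N. \<exists>g\<in>D. \<forall>i\<in>{..<N}. q i g x < 1 / real (Suc N)"
    let ?F = "\<lambda>N. \<Inter>i\<in>{..<N}. (\<lambda>g. q i g x) -` {..1 / real (Suc N)}"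
    have "C \<inter> (\<Inter>N\<in>UNIV. ?F N) \<noteq> {}"
    proof (rule compact_imp_fip_image[OF C])
      show "closed (?F N)" for N
        using cont[OF x] by (intro closed_INT ballI closed_vimage) auto
      fix I :: "nat set" assume "finite I"
      then obtain N where N: "\<forall>n\<in>I. n \<le> N" using finite_nat_set_iff_bounded_le by blast
      obtain g where g: "g \<in> D" "\<forall>i\<in>{..<N}. q i g x < 1 / real (Suc N)" using R by blast
      have "g \<in> ?F n" if "n \<in> I" for n
      proof -
        have n: "n \<le> N" using N that by blast
        then have "1 / real (Suc N) \<le> 1 / real (Suc n)" by (simp add: frac_le)
        then have "q i g x \<le> 1 / real (Suc n)" if "i < n" for i
          using g(2) n that by (meson lessThan_iff less_le_trans less_imp_le)
        then show ?thesis by simp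
      qed
      then show "C \<inter> (\<Inter>N\<in>I. ?F N) \<noteq> {}" using g(1) D(2) by blast
    qed
    then obtain g where g: "g \<in> C" "g \<in> (\<Inter>N\<in>UNIV. ?F N)" by blast
    have "q i g x \<le> 0" for i
    proof (rule ccontr)
      assume "\<not> q i g x \<le> 0"
      then obtain n where n: "inverse (real (Suc n)) < q i g x" using reals_Archimedean[of "q i g x"] by auto
      have "g \<in> ?F (Suc (max i n))" using g(2) by blast
      then have "q i g x \<le> 1 / real (Suc (Suc (max i n)))" by (auto simp: less_Suc_eq_le)
      also have "\<dots> \<le> 1 / real (Suc n)" by (simp add: frac_le)
      finally show False using n by (simp add: inverse_eq_divide)
    qed
    then show "\<exists>g\<in>C. \<forall>i. q i g x \<le> 0" using g(1) by blast
  qed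
  have "{x \<in> space M. \<exists>g\<in>C. \<forall>i. q i g x \<le> 0} =
      {x \<in> space M. \<forall>N. x \<in> (\<Union>g\<in>D. {x \<in> space M. \<forall>i\<in>{..<N}. q i g x < 1 / real (Suc N)})}"
    using eq by auto
  also have "\<dots> \<in> sets M"
  proof (rule sets.sets_Collect_countable_All)
    fix N
    have "{x \<in> space M. \<forall>i\<in>{..<N}. q i g x < 1 / real (Suc N)} \<in> sets M" for g
      using meas by (intro sets.sets_Collect_finite_All) auto
    then have U: "(\<Union>g\<in>D. {x \<in> space M. \<forall>i\<in>{..<N}. q i g x < 1 / real (Suc N)}) \<in> sets M"
      using D(1) by (intro sets.countable_UN'') auto
    then show "{x \<in> space M. x \<in> (\<Union>g\<in>D. {x \<in> space M. \<forall>i\<in>{..<N}. q i g x < 1 / real (Suc N)})} \<in> sets M"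
    proof -
      have "{x \<in> space M. x \<in> (\<Union>g\<in>D. {x \<in> space M. \<forall>i\<in>{..<N}. q i g x < 1 / real (Suc N)})} =
        (\<Union>g\<in>D. {x \<in> space M. \<forall>i\<in>{..<N}. q i g x < 1 / real (Suc N)})" by auto
      then show ?thesis using U by (simp only:)
    qed
  qed
  finally show ?thesis .
qed

text \<open>The sequences in \<open>Q\<close> whose first \<open>n\<close> entries are lexicographically minimal. A compact set of
  sequences has a lexicographically least element; choosing it is what turns functions that are
  continuous along orbits into a selection of one point in each orbit of a compact group.\<close>

primrec lex_prefix :: "nat \<Rightarrow> (nat \<Rightarrow> real) set \<Rightarrow> (nat \<Rightarrow> real) set" where
  "lex_prefix 0 Q = Q"
| "lex_prefix (Suc n) Q = {s \<in> lex_prefix n Q. \<forall>t\<in>lex_prefix n Q. s n \<le> t n}"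

definition lex_min :: "(nat \<Rightarrow> real) set \<Rightarrow> nat \<Rightarrow> real" where
  "lex_min Q n = Inf ((\<lambda>s. s n) ` lex_prefix n Q)"

lemma lex_prefix_step:
  assumes c: "compact (lex_prefix n Q)" and ne: "lex_prefix n Q \<noteq> {}"
  shows "\<And>s. s \<in> lex_prefix n Q \<Longrightarrow> lex_min Q n \<le> s n"
    and "lex_prefix (Suc n) Q = {s \<in> lex_prefix n Q. s n = lex_min Q n}"
    and "lex_prefix (Suc n) Q \<noteq> {}"
proof -
  have "continuous_on (lex_prefix n Q) (\<lambda>s. s n)"
    by (rule continuous_on_subset[OF continuous_on_product_coordinates]) simp
  from continuous_attains_inf[OF c ne this] obtain s0
    where s0: "s0 \<in> lex_prefix n Q" "\<forall>t\<in>lex_prefix n Q. s0 n \<le> t n" by blast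
  have m: "lex_min Q n = s0 n"
    unfolding lex_min_def using s0 by (intro cInf_eq_minimum) auto
  show "\<And>s. s \<in> lex_prefix n Q \<Longrightarrow> lex_min Q n \<le> s n" using s0(2) m by simp
  show "lex_prefix (Suc n) Q = {s \<in> lex_prefix n Q. s n = lex_min Q n}"
    unfolding m lex_prefix.simps using s0 by (auto intro: antisym)
  then show "lex_prefix (Suc n) Q \<noteq> {}" using s0(1) m by auto
qed

lemma lex_prefix_compact:
  assumes Q: "compact Q" "Q \<noteq> {}"
  shows "compact (lex_prefix n Q) \<and> lex_prefix n Q \<noteq> {} \<and> lex_prefix n Q = {s \<in> Q. \<forall>i<n. s i = lex_min Q i}"
proof (induction n)
  case 0
  then show ?case using Q by simp
next
  case (Suc n)
  note c = Suc[THEN conjunct1] and ne = Suc[THEN conjunct2, THEN conjunct1] and eq = Suc[THEN conjunct2, THEN conjunct2]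
  have "continuous_on UNIV (\<lambda>s :: nat \<Rightarrow> real. s n)" by (rule continuous_on_product_coordinates)
  then have "closed ((\<lambda>s :: nat \<Rightarrow> real. s n) -` {lex_min Q n})" by (intro closed_vimage) auto
  then have "compact (lex_prefix n Q \<inter> (\<lambda>s. s n) -` {lex_min Q n})" by (rule compact_Int_closed[OF c])
  moreover have "lex_prefix n Q \<inter> (\<lambda>s. s n) -` {lex_min Q n} = lex_prefix (Suc n) Q"
    unfolding lex_prefix_step(2)[OF c ne] by auto
  moreover have "lex_prefix (Suc n) Q = {s \<in> Q. \<forall>i<Suc n. s i = lex_min Q i}"
    unfolding lex_prefix_step(2)[OF c ne] unfolding eq by (auto simp: less_Suc_eq)
  moreover have "lex_prefix (Suc n) Q \<noteq> {}" by (rule lex_prefix_step(3)[OF c ne])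
  ultimately show ?case by (simp only:) simp
qed

lemmas compact_lex_prefix = lex_prefix_compact[THEN conjunct1]
  and lex_prefix_nonempty = lex_prefix_compact[THEN conjunct2, THEN conjunct1]
  and lex_prefix_eq = lex_prefix_compact[THEN conjunct2, THEN conjunct2]

text \<open>In this form the recursion for the least element is a projection along \<open>Q\<close>, hence measurable when
  \<open>Q\<close> is the image of a compact set of parameters.\<close>

lemma lex_min_le_iff:
  assumes Q: "compact Q" "Q \<noteq> {}"
  shows "lex_min Q n \<le> a \<longleftrightarrow> (\<exists>s\<in>Q. (\<forall>i<n. s i = lex_min Q i) \<and> s n \<le> a)"
proof
  assume a: "lex_min Q n \<le> a"
  obtain s where "s \<in> lex_prefix (Suc n) Q" using lex_prefix_nonempty[OF Q, of "Suc n"] by blast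
  then have "s \<in> Q \<and> (\<forall>i<Suc n. s i = lex_min Q i)" unfolding lex_prefix_eq[OF Q] by simp
  then show "\<exists>s\<in>Q. (\<forall>i<n. s i = lex_min Q i) \<and> s n \<le> a"
    using a by (intro bexI[of _ s]) simp_all
next
  assume "\<exists>s\<in>Q. (\<forall>i<n. s i = lex_min Q i) \<and> s n \<le> a"
  then obtain s where s: "s \<in> Q" "\<forall>i<n. s i = lex_min Q i" "s n \<le> a" by blast
  then have "s \<in> lex_prefix n Q" unfolding lex_prefix_eq[OF Q] by simp
  then have "lex_min Q n \<le> s n"
    by (rule lex_prefix_step(1)[OF compact_lex_prefix[OF Q] lex_prefix_nonempty[OF Q]])
  then show "lex_min Q n \<le> a" using s(3) by simp
qed

lemma lex_min_in:
  assumes Q: "compact Q" "Q \<noteq> {}"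
  shows "lex_min Q \<in> Q"
proof -
  have "Q \<inter> (\<Inter>i\<in>UNIV. (\<lambda>s. s i) -` {lex_min Q i}) \<noteq> {}"
  proof (rule compact_imp_fip_image[OF Q(1)])
    fix i :: nat
    have "continuous_on UNIV (\<lambda>s :: nat \<Rightarrow> real. s i)" by (rule continuous_on_product_coordinates)
    then show "closed ((\<lambda>s. s i) -` {lex_min Q i})" by (intro closed_vimage) auto
  next
    fix I :: "nat set" assume "finite I"
    then obtain N where N: "\<forall>n\<in>I. n < N" using finite_nat_set_iff_bounded by blast
    have "{s \<in> Q. \<forall>i<N. s i = lex_min Q i} \<noteq> {}"
      using lex_prefix_nonempty[OF Q, of N] unfolding lex_prefix_eq[OF Q] .
    then show "Q \<inter> (\<Inter>i\<in>I. (\<lambda>s. s i) -` {lex_min Q i}) \<noteq> {}" using N by auto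
  qed
  then obtain s where s: "s \<in> Q" "\<forall>i. s i = lex_min Q i" by auto
  then have "s = lex_min Q" by (intro ext) simp
  then show ?thesis using s(1) by simp
qed

context lc_borel_space
begin

definition free_part :: "'x set" where
  "free_part = {x \<in> space M. \<forall>g. act g x = x \<longrightarrow> g = 0}"

lemma punctured_sigma_compact:
  obtains \<C> :: "'g set set" where "countable \<C>" "\<forall>C\<in>\<C>. compact C" "\<Union>\<C> = - {0}"
proof -
  obtain B :: "'g set set" where B: "countable B" "topological_basis B" "{} \<notin> B"
    by (rule countable_basis_nonempty)
  let ?C = "closure ` {V \<in> B. compact (closure V) \<and> 0 \<notin> closure V}"
  show ?thesis
  proof (rule that[of ?C])
    show "countable ?C" by (intro countable_image countable_subset[OF _ B(1)]) auto
    show "\<forall>C\<in>?C. compact C" by auto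
    show "\<Union>?C = - {0}"
    proof
      show "\<Union>?C \<subseteq> - {0}" by auto
      show "- {0} \<subseteq> \<Union>?C"
      proof
        fix g :: 'g assume "g \<in> - {0}"
        then obtain U W where UW: "open U" "open W" "g \<in> U" "0 \<in> W" "U \<inter> W = {}"
          using hausdorff[of g 0] by auto
        obtain U' C where U': "open U'" "compact C" "g \<in> U'" "U' \<subseteq> C"
          using locally_compact unfolding locally_compact_space_def by simp metis
        have "open (U \<inter> U')" "g \<in> U \<inter> U'" using UW U' by auto
        then obtain V where V: "V \<in> B" "g \<in> V" "V \<subseteq> U \<inter> U'"
          using topological_basisE[OF B(2)] by metis
        have "closure V \<subseteq> C" using V(3) U'(2,4) by (intro closure_minimal compact_imp_closed) auto
        then have "compact (closure V)" using U'(2) by (metis closed_closure compact_Int_closed inf.absorb_iff2)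
        moreover have "closure V \<subseteq> - W" using V(3) UW by (intro closure_minimal) auto
        ultimately have "closure V \<in> ?C" using V(1) UW(4) by auto
        then show "g \<in> \<Union>?C" using V(2) closure_subset by blast
      qed
    qed
  qed
qed

text \<open>A point has a nontrivial stabilizer iff it is fixed by an element of one of countably many compact
  sets that cover the nonzero elements; being fixed is a closed condition, tested by functions that
  are continuous along orbits and separate points.\<close>

lemma free_part_measurable: "free_part \<in> sets M"
proof -
  obtain \<Psi> :: "nat \<Rightarrow> 'x \<Rightarrow> real" where \<Psi>: "\<forall>n. \<Psi> n \<in> borel_measurable M"
    "\<forall>n. \<forall>x\<in>space M. continuous_on UNIV (\<lambda>g. \<Psi> n (act g x))"
    "\<forall>x\<in>space M. \<forall>y\<in>space M. (\<forall>n. \<Psi> n x = \<Psi> n y) \<longrightarrow> x = y"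
    by (rule separating_orbit_continuous)
  have [measurable]: "\<Psi> n \<in> borel_measurable M" for n using \<Psi>(1) by simp
  obtain \<C> :: "'g set set" where C: "countable \<C>" "\<forall>C\<in>\<C>. compact C" "\<Union>\<C> = - {0}"
    by (rule punctured_sigma_compact)
  let ?F = "\<lambda>C. {x \<in> space M. \<exists>g\<in>C. \<forall>i. \<bar>\<Psi> i (act g x) - \<Psi> i x\<bar> \<le> 0}"
  have fixes_iff: "act g x = x \<longleftrightarrow> (\<forall>i. \<bar>\<Psi> i (act g x) - \<Psi> i x\<bar> \<le> 0)" if "x \<in> space M" for g x
    using \<Psi>(3) that by auto
  have "free_part = space M - (\<Union>C\<in>\<C>. ?F C)"
  proof (intro set_eqI iffI)
    fix x assume "x \<in> free_part"
    then have x: "x \<in> space M" "\<forall>g. act g x = x \<longrightarrow> g = 0" by (auto simp: free_part_def)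
    have "x \<notin> ?F C" if "C \<in> \<C>" for C
    proof
      assume "x \<in> ?F C"
      then obtain g where "g \<in> C" "act g x = x" using fixes_iff[OF x(1)] by blast
      then have "0 \<in> \<Union>\<C>" using x(2) that by blast
      then show False using C(3) by simp
    qed
    then show "x \<in> space M - (\<Union>C\<in>\<C>. ?F C)" using x(1) by blast
  next
    fix x assume x: "x \<in> space M - (\<Union>C\<in>\<C>. ?F C)"
    have "g = 0" if "act g x = x" for g
    proof (rule ccontr)
      assume "g \<noteq> 0"
      then obtain C where "C \<in> \<C>" "g \<in> C" using C(3) by blast
      then show False using x that fixes_iff[of x g] by blast
    qed
    then show "x \<in> free_part" using x by (simp add: free_part_def)
  qed
  moreover have "?F C \<in> sets M" if "C \<in> \<C>" for C
  proof (rule measurable_compact_projection)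
    show "compact C" using C(2) that by blast
    show "continuous_on UNIV (\<lambda>g. \<bar>\<Psi> i (act g x) - \<Psi> i x\<bar>)" if "x \<in> space M" for i x
      using \<Psi>(2) that by (intro continuous_intros) simp
  qed measurable
  ultimately show ?thesis using C(1) by (auto intro!: sets.countable_UN'')
qed

text \<open>Invariance uses that the group is abelian: all points of an orbit have the same stabilizer.\<close>

lemma free_part_invariant_conull:
  assumes "essentially_free M act"
  shows "invariant_conull M act free_part"
proof -
  have "AE x in M. x \<in> free_part"
    using assms AE_space unfolding essentially_free_def by eventually_elim (auto simp: free_part_def)
  then have "{x \<in> space M. x \<notin> free_part} \<in> null_sets M"
    using free_part_measurable by (subst (asm) AE_iff_null) auto
  then have "space M - free_part \<in> null_sets M" by (simp add: set_diff_eq)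
  moreover have "act h x \<in> free_part" if x: "x \<in> free_part" for h x
  proof -
    have xs: "x \<in> space M" using x by (simp add: free_part_def)
    have "g = 0" if "act g (act h x) = act h x" for g
    proof -
      have "act (- h) (act g (act h x)) = act (- h) (act h x)" using that by simp
      then have "act g x = x" using xs by (simp add: act_act act_zero algebra_simps)
      then show ?thesis using x by (simp add: free_part_def)
    qed
    then show ?thesis using xs by (simp add: free_part_def)
  qed
  ultimately show ?thesis unfolding invariant_conull_def using free_part_measurable by blast
qed

text \<open>A Borel transversal \<open>Y\<close> for the orbits of \<open>K\<close> in \<open>X0\<close>, together with the unique time \<open>\<tau> x\<close> in \<open>K\<close> at
  which \<open>x\<close> reaches it. The time is part of the structure because its measurability is what makes
  the counting functions measurable.\<close>

definition orbit_section :: "'g set \<Rightarrow> 'x set \<Rightarrow> 'x set \<Rightarrow> ('x \<Rightarrow> 'g) \<Rightarrow> bool" where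
  "orbit_section K X0 Y \<tau> \<longleftrightarrow> invariant_conull M act X0 \<and> Y \<in> sets M \<and> Y \<subseteq> X0 \<and> \<tau> \<in> borel_measurable M \<and>
    (\<forall>x\<in>X0. \<tau> x \<in> K \<and> (\<forall>k\<in>K. act k x \<in> Y \<longleftrightarrow> k = \<tau> x))"

text \<open>Functions that separate points and are continuous along orbits map every \<open>K\<close>-orbit injectively
  onto a compact set of sequences, and \<open>Y\<close> consists of the points that are sent to the least
  sequence of their orbit. The entries of the least sequence are \<open>K\<close>-invariant Borel functions, so
  that \<open>Y\<close> is Borel, and so is the hitting time, whose preimages are projections along compact sets.
  On the free part the time is unique.\<close>

lemma orbit_section_exists:
  assumes free: "essentially_free M act" and K: "compact_open_subgroup K"
  obtains Y \<tau> where "orbit_section K free_part Y \<tau>"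
proof -
  obtain \<Psi> :: "nat \<Rightarrow> 'x \<Rightarrow> real" where \<Psi>: "\<forall>n. \<Psi> n \<in> borel_measurable M"
    "\<forall>n. \<forall>x\<in>space M. continuous_on UNIV (\<lambda>g. \<Psi> n (act g x))"
    "\<forall>x\<in>space M. \<forall>y\<in>space M. (\<forall>n. \<Psi> n x = \<Psi> n y) \<longrightarrow> x = y"
    by (rule separating_orbit_continuous)
  have [measurable]: "\<Psi> n \<in> borel_measurable M" for n using \<Psi>(1) by simp
  have Kc: "compact K" and K0: "0 \<in> K" and Kadd: "\<And>a b. a \<in> K \<Longrightarrow> b \<in> K \<Longrightarrow> a + b \<in> K"
    and Kmin: "\<And>a. a \<in> K \<Longrightarrow> - a \<in> K"
    using K by (simp_all add: compact_open_subgroup_def)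
  have Kdiff: "a - b \<in> K" if "a \<in> K" "b \<in> K" for a b using Kadd[OF that(1) Kmin[OF that(2)]] by simp
  define Q where "Q x = (\<lambda>g i. \<Psi> i (act g x)) ` K" for x
  define m where "m x = lex_min (Q x)" for x
  have Q: "compact (Q x)" "Q x \<noteq> {}" if "x \<in> space M" for x
  proof -
    have "continuous_on UNIV (\<lambda>g i. \<Psi> i (act g x))"
      using \<Psi>(2) that by (intro continuous_on_coordinatewise_then_product) simp
    then have "continuous_on K (\<lambda>g i. \<Psi> i (act g x))" by (rule continuous_on_subset) simp
    then show "compact (Q x)" unfolding Q_def by (rule compact_continuous_image[OF _ Kc])
    show "Q x \<noteq> {}" using K0 unfolding Q_def by auto
  qed
  have m_attained: "\<exists>k\<in>K. \<forall>i. \<Psi> i (act k x) = m x i" if "x \<in> space M" for x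
  proof -
    have "m x \<in> Q x" unfolding m_def using Q[OF that] by (rule lex_min_in)
    then obtain k where "k \<in> K" "m x = (\<lambda>i. \<Psi> i (act k x))" unfolding Q_def by blast
    then show ?thesis by (intro bexI[of _ k]) simp_all
  qed
  have m_invariant: "m (act k x) = m x" if x: "x \<in> space M" and k: "k \<in> K" for x k
  proof -
    have "Q (act k x) = Q x"
    proof (intro set_eqI iffI)
      fix s assume "s \<in> Q (act k x)"
      then obtain g where "g \<in> K" "s = (\<lambda>i. \<Psi> i (act g (act k x)))" unfolding Q_def by blast
      then show "s \<in> Q x" unfolding Q_def using x Kadd k by (intro image_eqI[of _ _ "g + k"]) (simp_all add: act_act)
    next
      fix s assume "s \<in> Q x"
      then obtain g where "g \<in> K" "s = (\<lambda>i. \<Psi> i (act g x))" unfolding Q_def by blast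
      then show "s \<in> Q (act k x)" unfolding Q_def using x Kdiff k
        by (intro image_eqI[of _ _ "g - k"]) (simp_all add: act_act)
    qed
    then show ?thesis by (simp add: m_def)
  qed
  have m_measurable [measurable]: "(\<lambda>x. m x n) \<in> borel_measurable M" for n
  proof (induction n rule: less_induct)
    case (less n)
    show ?case
    proof (rule borel_measurableI_le)
      fix a
      let ?q = "\<lambda>i g x. if i < n then \<bar>\<Psi> i (act g x) - m x i\<bar> else if i = n then \<Psi> n (act g x) - a else 0"
      have "m x n \<le> a \<longleftrightarrow> (\<exists>g\<in>K. \<forall>i. ?q i g x \<le> 0)" if x: "x \<in> space M" for x
      proof -
        have "m x n \<le> a \<longleftrightarrow> (\<exists>g\<in>K. (\<forall>i<n. \<Psi> i (act g x) = m x i) \<and> \<Psi> n (act g x) \<le> a)"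
          unfolding m_def lex_min_le_iff[OF Q[OF x]] by (simp add: Q_def)
        also have "\<dots> \<longleftrightarrow> (\<exists>g\<in>K. \<forall>i. ?q i g x \<le> 0)"
        proof (rule bex_cong[OF refl])
          fix g
          show "(\<forall>i<n. \<Psi> i (act g x) = m x i) \<and> \<Psi> n (act g x) \<le> a \<longleftrightarrow> (\<forall>i. ?q i g x \<le> 0)"
          proof (intro iffI conjI allI impI)
            assume R: "\<forall>i. ?q i g x \<le> 0"
            show "\<Psi> i (act g x) = m x i" if "i < n" for i using spec[OF R, of i] that by simp
            show "\<Psi> n (act g x) \<le> a" using spec[OF R, of n] by simp
          qed auto
        qed
        finally show ?thesis .
      qed
      then have "{x \<in> space M. m x n \<le> a} = {x \<in> space M. \<exists>g\<in>K. \<forall>i. ?q i g x \<le> 0}" by blast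
      also have "\<dots> \<in> sets M"
      proof (rule measurable_compact_projection[OF Kc])
        show "continuous_on UNIV (\<lambda>g. ?q i g x)" if "x \<in> space M" for i x
        proof -
          have "continuous_on UNIV (\<lambda>g. \<Psi> j (act g x))" for j using \<Psi>(2) that by simp
          then show ?thesis
            by (cases "i < n"; cases "i = n") (simp_all, (intro continuous_intros; simp)+)
        qed
        show "?q i g \<in> borel_measurable M" for i g
        proof (cases "i < n")
          case True
          then have [measurable]: "(\<lambda>x. m x i) \<in> borel_measurable M" by (rule less)
          show ?thesis using True by simp
        qed simp
      qed
      finally show "{x \<in> space M. m x n \<le> a} \<in> sets M" .
    qed
  qed
  define Y where "Y = {x \<in> free_part. \<forall>i. \<Psi> i x = m x i}"
  have Y_hit: "act k x \<in> Y \<longleftrightarrow> (\<forall>i. \<Psi> i (act k x) = m x i)" if x: "x \<in> free_part" and k: "k \<in> K" for x k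
  proof -
    have "act k x \<in> free_part"
      using free_part_invariant_conull[OF free] x by (simp add: invariant_conull_def)
    moreover have "m (act k x) = m x" using m_invariant[OF _ k] x by (simp add: free_part_def)
    ultimately show ?thesis by (simp add: Y_def)
  qed
  have unique: "\<exists>!k. k \<in> K \<and> act k x \<in> Y" if x: "x \<in> free_part" for x
  proof -
    have xs: "x \<in> space M" using x by (simp add: free_part_def)
    obtain k where k: "k \<in> K" "\<forall>i. \<Psi> i (act k x) = m x i" using m_attained[OF xs] by blast
    show ?thesis
    proof (rule ex1I[of _ k])
      show "k \<in> K \<and> act k x \<in> Y" using k Y_hit[OF x] by simp
      fix k' assume k': "k' \<in> K \<and> act k' x \<in> Y"
      then have "\<forall>i. \<Psi> i (act k' x) = \<Psi> i (act k x)" using k Y_hit[OF x, of k'] by simp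
      then have "act k' x = act k x" using \<Psi>(3) xs by simp
      then have "act (- k) (act k' x) = act (- k) (act k x)" by simp
      then have "act (k' - k) x = x" using xs by (simp add: act_act act_zero algebra_simps)
      then have "k' - k = 0" using x unfolding free_part_def by blast
      then show "k' = k" by simp
    qed
  qed
  define \<tau> where "\<tau> x = (if x \<in> free_part then THE k. k \<in> K \<and> act k x \<in> Y else 0)" for x
  have \<tau>: "\<tau> x \<in> K \<and> act (\<tau> x) x \<in> Y" if "x \<in> free_part" for x
    using theI'[OF unique[OF that]] that by (simp add: \<tau>_def)
  have \<tau>_eq: "k = \<tau> x" if "x \<in> free_part" "k \<in> K" "act k x \<in> Y" for x k
    using unique[OF that(1)] \<tau>[OF that(1)] that(2,3) by blast
  have "\<tau> \<in> borel_measurable M"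
    unfolding borel_eq_closed
  proof (rule measurable_measure_of)
    fix C :: "'g set" assume "C \<in> Collect closed"
    then have C: "compact (K \<inter> C)" using Kc by (auto intro: compact_Int_closed)
    let ?q = "\<lambda>i g x. \<bar>\<Psi> i (act g x) - m x i\<bar>"
    have "{x \<in> space M. \<exists>g\<in>K \<inter> C. \<forall>i. ?q i g x \<le> 0} \<in> sets M"
    proof (rule measurable_compact_projection[OF C])
      show "continuous_on UNIV (\<lambda>g. ?q i g x)" if "x \<in> space M" for i x
        using \<Psi>(2) that by (intro continuous_intros) simp
    qed measurable
    then have "({x \<in> space M. \<exists>g\<in>K \<inter> C. \<forall>i. ?q i g x \<le> 0} \<inter> free_part) \<union> (if 0 \<in> C then space M - free_part else {}) \<in> sets M"
      using free_part_measurable by auto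
    moreover have "\<tau> -` C \<inter> space M = ({x \<in> space M. \<exists>g\<in>K \<inter> C. \<forall>i. ?q i g x \<le> 0} \<inter> free_part) \<union> (if 0 \<in> C then space M - free_part else {})"
    proof -
      have iff: "\<tau> x \<in> C \<longleftrightarrow> (\<exists>g\<in>K \<inter> C. \<forall>i. ?q i g x \<le> 0)" if x: "x \<in> free_part" for x
      proof
        assume "\<tau> x \<in> C"
        moreover have "\<tau> x \<in> K" "\<forall>i. ?q i (\<tau> x) x \<le> 0" using \<tau>[OF x] Y_hit[OF x] by auto
        ultimately show "\<exists>g\<in>K \<inter> C. \<forall>i. ?q i g x \<le> 0" by blast
      next
        assume "\<exists>g\<in>K \<inter> C. \<forall>i. ?q i g x \<le> 0"
        then obtain g where g: "g \<in> K" "g \<in> C" "\<forall>i. ?q i g x \<le> 0" by blast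
        then have "act g x \<in> Y" using Y_hit[OF x] by simp
        then show "\<tau> x \<in> C" using \<tau>_eq[OF x g(1)] g(2) by simp
      qed
      show ?thesis
      proof (rule set_eqI)
        fix x
        show "x \<in> \<tau> -` C \<inter> space M \<longleftrightarrow> x \<in> ({x \<in> space M. \<exists>g\<in>K \<inter> C. \<forall>i. ?q i g x \<le> 0} \<inter> free_part) \<union> (if 0 \<in> C then space M - free_part else {})"
        proof (cases "x \<in> free_part")
          case True
          then show ?thesis using iff[OF True] by (simp add: conj_commute)
        next
          case False
          then show ?thesis by (simp add: \<tau>_def)
        qed
      qed
    qed
    ultimately show "\<tau> -` C \<inter> space M \<in> sets M" by simp
  qed auto
  moreover have "Y \<in> sets M"
  proof -
    have "{x \<in> space M. \<forall>i. \<Psi> i x = m x i} \<in> sets M" by measurable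
    then have "free_part \<inter> {x \<in> space M. \<forall>i. \<Psi> i x = m x i} \<in> sets M" using free_part_measurable by auto
    moreover have "free_part \<inter> {x \<in> space M. \<forall>i. \<Psi> i x = m x i} = Y" by (auto simp: Y_def free_part_def)
    ultimately show ?thesis by simp
  qed
  moreover have "\<tau> x \<in> K \<and> (\<forall>k\<in>K. act k x \<in> Y \<longleftrightarrow> k = \<tau> x)" if "x \<in> free_part" for x
    using \<tau>[OF that] \<tau>_eq[OF that] by auto
  ultimately have "orbit_section K free_part Y \<tau>"
    unfolding orbit_section_def using free_part_invariant_conull[OF free] by (auto simp: Y_def)
  then show ?thesis by (rule that)
qed

end

section \<open>Averaging over a compact open subgroup\<close>

lemma compact_open_subgroupD:
  assumes "compact_open_subgroup K"
  shows "compact K" "open K" "0 \<in> K" "\<And>a b. a \<in> K \<Longrightarrow> b \<in> K \<Longrightarrow> a + b \<in> K" "\<And>a. a \<in> K \<Longrightarrow> - a \<in> K"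
    "\<And>a b. a \<in> K \<Longrightarrow> b \<in> K \<Longrightarrow> a - b \<in> K"
proof -
  show K: "compact K" "open K" "0 \<in> K" "\<And>a b. a \<in> K \<Longrightarrow> b \<in> K \<Longrightarrow> a + b \<in> K" "\<And>a. a \<in> K \<Longrightarrow> - a \<in> K"
    using assms by (simp_all add: compact_open_subgroup_def)
  show "a - b \<in> K" if "a \<in> K" "b \<in> K" for a b using K(4)[OF that(1) K(5)[OF that(2)]] by simp
qed

definition list_average :: "'g::ab_group_add list \<Rightarrow> ('g \<Rightarrow> complex) \<Rightarrow> 'g \<Rightarrow> complex" where
  "list_average ks f s = (\<Sum>k\<leftarrow>ks. f (s + k)) / of_nat (length ks)"

lemma list_average_nth: "list_average ks f s = (\<Sum>i<length ks. f (s + ks ! i)) / of_nat (length ks)"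
  by (simp add: list_average_def sum_list_sum_nth atLeast0LessThan)

lemma norm_list_average_diff_le:
  assumes "ks \<noteq> []" "\<And>k. k \<in> set ks \<Longrightarrow> norm (f (x + k) - f (y + k)) \<le> e"
  shows "norm (list_average ks f x - list_average ks f y) \<le> e"
proof -
  have "norm ((\<Sum>i<length ks. f (x + ks ! i)) - (\<Sum>i<length ks. f (y + ks ! i)))
      \<le> (\<Sum>i<length ks. norm (f (x + ks ! i) - f (y + ks ! i)))"
    unfolding sum_subtractf[symmetric] by (rule norm_sum)
  also have "\<dots> \<le> (\<Sum>i<length ks. e)" by (intro sum_mono assms(2)) simp
  finally have "norm ((\<Sum>i<length ks. f (x + ks ! i)) - (\<Sum>i<length ks. f (y + ks ! i))) \<le> length ks * e" by simp
  then show ?thesis using assms(1)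
    unfolding list_average_nth diff_divide_distrib[symmetric] norm_divide
    by (simp add: field_simps)
qed

lemma sum_list_concat_shift:
  "(\<Sum>k\<leftarrow>concat (map (\<lambda>p. map ((+) p) ks) ps). f (s + k)) = (\<Sum>p\<leftarrow>ps. \<Sum>k\<leftarrow>ks. f (s + p + k))"
  for f :: "'g::ab_group_add \<Rightarrow> complex"
  by (induction ps) (simp_all add: o_def algebra_simps)

lemma list_average_concat:
  fixes f :: "'g::ab_group_add \<Rightarrow> complex"
  assumes "ks \<noteq> []"
  shows "list_average (concat (map (\<lambda>p. map ((+) p) ks) ps)) f s = list_average ps (list_average ks f) s"
proof -
  have len: "length (concat (map (\<lambda>p. map ((+) p) ks) ps)) = length ps * length ks"
    by (induction ps) simp_all
  have "(\<Sum>p\<leftarrow>ps. list_average ks f (s + p)) = (\<Sum>p\<leftarrow>ps. \<Sum>k\<leftarrow>ks. f (s + p + k)) / of_nat (length ks)"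
    by (induction ps) (simp_all add: list_average_def add_divide_distrib)
  then show ?thesis unfolding list_average_def[of "concat _"] len sum_list_concat_shift
    by (simp add: list_average_def mult.commute)
qed

text \<open>The averages at \<open>s\<close> and at \<open>s'\<close> are compared by pairing the translates of \<open>s\<close> with those of \<open>s'\<close>.
  One pair can be chosen close, since the translates form a net; there the values of \<open>f\<close> differ by
  at most \<open>e\<close>. The other pairs are arbitrary and contribute at most \<open>e + d\<close> each. So one averaging
  step multiplies the excess of the oscillation over \<open>e\<close> by \<open>1 - 1 / n\<close>.\<close>

lemma average_contracts:
  fixes f :: "'g::ab_group_add \<Rightarrow> complex"
  assumes K: "\<And>a b. a \<in> K \<Longrightarrow> b \<in> K \<Longrightarrow> a + b \<in> K" "\<And>a b. a \<in> K \<Longrightarrow> b \<in> K \<Longrightarrow> a - b \<in> K"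
    and ps: "distinct ps" "ps \<noteq> []" "set ps \<subseteq> K" "\<And>k. k \<in> K \<Longrightarrow> \<exists>p\<in>set ps. k - p \<in> V"
    and V: "\<And>x y. x - y \<in> V \<Longrightarrow> norm (f x - f y) \<le> e"
    and d: "\<And>x y. x - y \<in> K \<Longrightarrow> norm (f x - f y) \<le> e + d"
    and s: "s - s' \<in> K"
  shows "norm (list_average ps f s - list_average ps f s') \<le> e + (1 - 1 / real (length ps)) * d"
proof -
  let ?P = "set ps" and ?n = "length ps"
  have n: "card ?P = ?n" "?n > 0" using ps by (simp_all add: distinct_card)
  have avg: "list_average ps f t = (\<Sum>p\<in>?P. f (t + p)) / of_nat ?n" for t
    by (simp add: list_average_def sum_list_distinct_conv_sum_set[OF ps(1)])
  obtain p1 where p1: "p1 \<in> ?P" using ps(2) by (cases ps) auto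
  then have "s - s' + p1 \<in> K" using K(1)[OF s] ps(3) by blast
  then obtain p2 where p2: "p2 \<in> ?P" "s - s' + p1 - p2 \<in> V" using ps(4) by blast
  have "card (?P - {p1}) = card (?P - {p2})" using p1 p2(1) by simp
  then obtain h where h: "bij_betw h (?P - {p1}) (?P - {p2})"
    using finite_same_card_bij[of "?P - {p1}" "?P - {p2}"] by auto
  have 1: "(\<Sum>p\<in>?P. f (s + p)) = f (s + p1) + (\<Sum>p\<in>?P - {p1}. f (s + p))"
    using p1 by (intro sum.remove) auto
  have "(\<Sum>p\<in>?P. f (s' + p)) = f (s' + p2) + (\<Sum>p\<in>?P - {p2}. f (s' + p))"
    using p2(1) by (intro sum.remove) auto
  also have "(\<Sum>p\<in>?P - {p2}. f (s' + p)) = (\<Sum>p\<in>?P - {p1}. f (s' + h p))"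
    by (rule sum.reindex_bij_betw[OF h, symmetric])
  finally have 2: "(\<Sum>p\<in>?P. f (s + p)) - (\<Sum>p\<in>?P. f (s' + p))
      = (f (s + p1) - f (s' + p2)) + (\<Sum>p\<in>?P - {p1}. f (s + p) - f (s' + h p))"
    unfolding 1 by (simp add: sum_subtractf)
  have "norm (f (s + p1) - f (s' + p2)) \<le> e" using p2(2) by (intro V) (simp add: algebra_simps)
  moreover have "norm (\<Sum>p\<in>?P - {p1}. f (s + p) - f (s' + h p)) \<le> (\<Sum>p\<in>?P - {p1}. e + d)"
  proof (rule sum_norm_le, rule d)
    fix p assume p: "p \<in> ?P - {p1}"
    then have "h p \<in> ?P" using bij_betwE[OF h] by blast
    then have "p - h p \<in> K" using p ps(3) by (intro K(2)) auto
    then have "(s - s') + (p - h p) \<in> K" by (rule K(1)[OF s])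
    then show "s + p - (s' + h p) \<in> K" by (simp add: algebra_simps)
  qed
  moreover have "(\<Sum>p\<in>?P - {p1}. e + d) = (real ?n - 1) * (e + d)"
  proof -
    have "1 \<le> card ?P" using n by linarith
    then have "real (card ?P - 1) = real ?n - 1" unfolding n(1)[symmetric] by (simp only: of_nat_diff of_nat_1)
    then show ?thesis using p1 by simp
  qed
  ultimately have "norm (f (s + p1) - f (s' + p2)) + norm (\<Sum>p\<in>?P - {p1}. f (s + p) - f (s' + h p))
      \<le> e + (real ?n - 1) * (e + d)"
    by (simp only: add_mono)
  then have "norm ((\<Sum>p\<in>?P. f (s + p)) - (\<Sum>p\<in>?P. f (s' + p))) \<le> e + (real ?n - 1) * (e + d)"
    unfolding 2 by (rule order_trans[OF norm_triangle_ineq])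
  also have "\<dots> = real ?n * (e + (1 - 1 / real ?n) * d)" using n(2) by (simp add: field_simps)
  finally show ?thesis using n(2)
    unfolding avg diff_divide_distrib[symmetric] norm_divide by (simp add: field_simps)
qed

lemma C_cD:
  assumes "f \<in> C_c"
  shows "continuous_on UNIV f" "compact (closure {t. f t \<noteq> 0})" "t \<notin> closure {t. f t \<noteq> 0} \<Longrightarrow> f t = 0"
proof -
  show "continuous_on UNIV f" "compact (closure {t. f t \<noteq> 0})" using assms by (simp_all add: C_c_def)
  show "f t = 0" if "t \<notin> closure {t. f t \<noteq> 0}"
    using that subsetD[OF closure_subset, of t "{t. f t \<noteq> 0}"] by auto
qed

lemma C_c_bounded:
  assumes f: "f \<in> C_c"
  obtains b where "0 \<le> b" "\<forall>t. norm (f t) \<le> b"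
proof -
  let ?C = "closure {t. f t \<noteq> 0}"
  have "compact (f ` ?C)"
    by (rule compact_continuous_image[OF continuous_on_subset[OF C_cD(1)[OF f]] C_cD(2)[OF f]]) simp
  then obtain b where b: "\<forall>z\<in>f ` ?C. norm z \<le> b" using compact_imp_bounded bounded_iff by blast
  show ?thesis
  proof (rule that[of "max b 0"]; (intro allI)?)
    show "norm (f t) \<le> max b 0" for t
      using b C_cD(3)[OF f, of t] by (cases "t \<in> ?C") (auto intro: max.coboundedI1)
  qed simp
qed

text \<open>This replaces the average over the Haar measure of \<open>K\<close>. Averages inherit the modulus of continuity
  of \<open>f\<close>, so one net of \<open>K\<close> serves for all steps of the iteration, and the oscillation along the
  cosets of \<open>K\<close> decreases geometrically to the error that the net allows.\<close>

lemma average_nearly_constant_on_cosets: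
  fixes f :: "'g::{topological_ab_group_add, t2_space} \<Rightarrow> complex"
  assumes K: "compact_open_subgroup K" and f: "f \<in> C_c" and e: "e > 0"
  obtains ks where "ks \<noteq> []" "set ks \<subseteq> K"
    "\<forall>s s'. s - s' \<in> K \<longrightarrow> norm (list_average ks f s - list_average ks f s') \<le> e"
proof -
  note KD = compact_open_subgroupD[OF K]
  have e2: "e / 2 > 0" using e by simp
  obtain V where V: "open V" "0 \<in> V" "\<forall>x y. x - y \<in> V \<longrightarrow> norm (f x - f y) < e / 2"
    by (rule compactly_supported_uniformly_continuous[OF C_cD[OF f] e2])
  obtain b where b: "0 \<le> b" "\<forall>t. norm (f t) \<le> b" by (rule C_c_bounded[OF f])
  have "K \<subseteq> (\<Union>p\<in>K. {x. x + (- p) \<in> V})" using V(2) by auto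
  then obtain P where P: "P \<subseteq> K" "finite P" "K \<subseteq> (\<Union>p\<in>P. {x. x + (- p) \<in> V})"
    by (rule compactE_image[OF KD(1) open_shift[OF V(1)]])
  obtain ps where ps: "set ps = P" "distinct ps" using finite_distinct_list[OF P(2)] by blast
  have "ps \<noteq> []" using P(3) KD(3) ps(1) by auto
  define c where "c = 1 - 1 / real (length ps)"
  have c: "0 \<le> c" "c < 1" using \<open>ps \<noteq> []\<close> by (cases ps; simp add: c_def)+
  have cover: "\<exists>p\<in>set ps. k - p \<in> V" if "k \<in> K" for k using subsetD[OF P(3) that] ps(1) by auto
  have iter: "\<exists>ks. ks \<noteq> [] \<and> set ks \<subseteq> K \<and>
      (\<forall>s s'. s - s' \<in> K \<longrightarrow> norm (list_average ks f s - list_average ks f s') \<le> e / 2 + c ^ m * (2 * b))" for m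
  proof (induction m)
    case 0
    have "norm (f s - f s') \<le> e / 2 + 2 * b" for s s'
      using norm_triangle_ineq4[of "f s" "f s'"] b(2)[rule_format, of s] b(2)[rule_format, of s'] e by linarith
    then show ?case using KD(3) by (intro exI[of _ "[0]"]) (simp add: list_average_def)
  next
    case (Suc m)
    then obtain ks where ks: "ks \<noteq> []" "set ks \<subseteq> K"
      "\<forall>s s'. s - s' \<in> K \<longrightarrow> norm (list_average ks f s - list_average ks f s') \<le> e / 2 + c ^ m * (2 * b)"
      by blast
    let ?ks = "concat (map (\<lambda>p. map ((+) p) ks) ps)"
    have "norm (list_average ?ks f s - list_average ?ks f s') \<le> e / 2 + c * (c ^ m * (2 * b))"
      if s: "s - s' \<in> K" for s s'
      unfolding list_average_concat[OF ks(1)] c_def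
    proof (rule average_contracts[OF KD(4) KD(6) ps(2) \<open>ps \<noteq> []\<close> _ cover _ _ s])
      show "set ps \<subseteq> K" using ps(1) P(1) by simp
      show "norm (list_average ks f x - list_average ks f y) \<le> e / 2" if "x - y \<in> V" for x y
      proof (rule norm_list_average_diff_le[OF ks(1)])
        fix k show "norm (f (x + k) - f (y + k)) \<le> e / 2"
          using V(3)[rule_format, of "x + k" "y + k"] that by simp
      qed
      show "norm (list_average ks f x - list_average ks f y) \<le> e / 2 + (1 - 1 / real (length ps)) ^ m * (2 * b)"
        if "x - y \<in> K" for x y
        using ks(3) that unfolding c_def by blast
    qed
    moreover have "set ?ks \<subseteq> K" using ks(2) ps(1) P(1) KD(4) by auto
    moreover have "?ks \<noteq> []" using ks(1) \<open>ps \<noteq> []\<close> by (cases ps) simp_all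
    ultimately show ?case by (intro exI[of _ ?ks]) (simp add: mult.assoc)
  qed
  have "(\<lambda>m. c ^ m * (2 * b)) \<longlonglongrightarrow> 0 * (2 * b)"
    using c by (intro tendsto_mult LIMSEQ_power_zero tendsto_const) simp
  then have "(\<lambda>m. c ^ m * (2 * b)) \<longlonglongrightarrow> 0" by simp
  then have "\<forall>\<^sub>F m in sequentially. c ^ m * (2 * b) < e / 2" using e2 by (rule order_tendstoD)
  then obtain m where m: "c ^ m * (2 * b) < e / 2" unfolding eventually_sequentially by blast
  obtain ks where ks: "ks \<noteq> []" "set ks \<subseteq> K"
    "\<forall>s s'. s - s' \<in> K \<longrightarrow> norm (list_average ks f s - list_average ks f s') \<le> e / 2 + c ^ m * (2 * b)"
    using iter[of m] by blast
  show ?thesis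
  proof (rule that[OF ks(1,2)], intro allI impI)
    fix s s' assume "s - s' \<in> K"
    then have "norm (list_average ks f s - list_average ks f s') \<le> e / 2 + c ^ m * (2 * b)" using ks(3) by blast
    then show "norm (list_average ks f s - list_average ks f s') \<le> e" using m by linarith
  qed
qed

section \<open>Spectral measures\<close>

lemma character_zero: "\<xi> \<in> characters \<Longrightarrow> \<xi> (0::'g::{topological_space, ab_group_add}) = 1"
proof -
  assume \<xi>: "\<xi> \<in> characters"
  then have "\<xi> (0 + 0) = \<xi> 0 * \<xi> 0" "cmod (\<xi> 0) = 1" unfolding characters_def by blast+
  then show ?thesis by auto
qed

lemma character_diff:
  fixes \<xi> :: "'g::{topological_space, ab_group_add} \<Rightarrow> complex"
  assumes \<xi>: "\<xi> \<in> characters"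
  shows "\<xi> (a - b) = \<xi> a * cnj (\<xi> b)"
proof -
  have add: "\<xi> (x + y) = \<xi> x * \<xi> y" and n: "cmod (\<xi> x) = 1" for x y using \<xi> unfolding characters_def by blast+
  have "\<xi> (- b) * \<xi> b = 1" using add[of "- b" b] character_zero[OF \<xi>] by simp
  moreover have "cnj (\<xi> b) * \<xi> b = 1"
    using n[of b] complex_norm_square[of "\<xi> b"] by (simp add: mult.commute)
  ultimately have "\<xi> (- b) * \<xi> b = cnj (\<xi> b) * \<xi> b" by simp
  then have "\<xi> (- b) = cnj (\<xi> b)" using n[of b] by auto
  then show ?thesis using add[of a "- b"] by simp
qed

lemma space_dual_borel: "space dual_borel = characters"
  unfolding dual_borel_def by (rule space_measure_of_conv)

lemma openin_dual_borel: "openin dual_topology U \<Longrightarrow> U \<in> sets dual_borel"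
  unfolding dual_borel_def
proof (subst sets_measure_of)
  show "{U :: ('a \<Rightarrow> complex) set. openin dual_topology U} \<subseteq> Pow characters"
    using openin_subset topspace_dual_topology by blast
qed (auto intro: sigma_sets.Basic)

lemma openin_dual_subbasis:
  assumes "compact K" "open V" shows "openin dual_topology {\<xi> \<in> characters. \<xi> ` K \<subseteq> V}"
  unfolding dual_topology_def using assms by (intro topology_generated_by_Basis) auto

lemma character_evaluation_measurable:
  "(\<lambda>\<xi>. \<xi> (g::'g::{topological_space, ab_group_add})) \<in> borel_measurable dual_borel"
proof (rule borel_measurableI)
  fix V :: "complex set" assume "open V"
  then have "openin dual_topology {\<xi> \<in> characters. \<xi> ` {g} \<subseteq> V}" by (intro openin_dual_subbasis) auto
  then have "{\<xi> \<in> characters. \<xi> ` {g} \<subseteq> V} \<in> sets dual_borel" by (rule openin_dual_borel)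
  moreover have "{\<xi> \<in> characters. \<xi> ` {g} \<subseteq> V} = (\<lambda>\<xi>. \<xi> g) -` V \<inter> space dual_borel"
    by (auto simp: space_dual_borel)
  ultimately show "(\<lambda>\<xi>. \<xi> g) -` V \<inter> space dual_borel \<in> sets dual_borel" by simp
qed

text \<open>For \<open>z\<close> on the unit circle with positive real part, \<open>1 - Re (z\<^sup>2) \<ge> 2 * (1 - Re z)\<close>. So if the values of
  \<open>\<xi>\<close> on \<open>K\<close> stay in the half-plane, repeated doubling forces \<open>1 - Re (\<xi> k)\<close> to vanish. Consequently the
  annihilator of \<open>K\<close> is open in the dual group.\<close>

lemma subgroup_in_halfplane:
  assumes \<xi>: "\<xi> \<in> characters" and K: "compact_open_subgroup K" and re: "\<And>k. k \<in> K \<Longrightarrow> Re (\<xi> k) > 0"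
    and k: "k \<in> K"
  shows "\<xi> k = 1"
proof -
  have add: "\<xi> (x + y) = \<xi> x * \<xi> y" and n: "cmod (\<xi> x) = 1" for x y
    using \<xi> unfolding characters_def by blast+
  have sq: "(Re (\<xi> x))\<^sup>2 + (Im (\<xi> x))\<^sup>2 = 1" for x
    using n[of x] cmod_power2[of "\<xi> x"] by simp
  have le1: "Re (\<xi> x) \<le> 1" for x using n[of x] complex_Re_le_cmod[of "\<xi> x"] by simp
  have halve: "\<forall>k\<in>K. 1 - Re (\<xi> k) \<le> (1 / 2) ^ m" for m
  proof (induction m)
    case 0
    then show ?case using re by (auto intro: less_imp_le)
  next
    case (Suc m)
    show ?case
    proof
      fix k assume k: "k \<in> K"
      let ?r = "Re (\<xi> k)"
      have "k + k \<in> K" using compact_open_subgroupD(4)[OF K k k] .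
      then have "1 - Re (\<xi> (k + k)) \<le> (1 / 2) ^ m" using Suc by blast
      moreover have "Re (\<xi> (k + k)) = 2 * ?r\<^sup>2 - 1"
        using sq[of k] by (simp add: add power2_eq_square)
      moreover have "0 \<le> (1 - ?r) * ?r" using le1[of k] re[OF k] by simp
      ultimately show "1 - ?r \<le> (1 / 2) ^ Suc m" by (simp add: power2_eq_square algebra_simps)
    qed
  qed
  have lim: "(\<lambda>m. (1 / 2 :: real) ^ m) \<longlonglongrightarrow> 0" by (rule LIMSEQ_power_zero) simp
  have "1 - Re (\<xi> k) \<le> 0"
    by (rule LIMSEQ_le_const[OF lim]) (use halve k in blast)
  then have "Re (\<xi> k) = 1" using le1[of k] by simp
  moreover from this have "Im (\<xi> k) = 0" using sq[of k] by simp
  ultimately show ?thesis by (simp add: complex_eq_iff)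
qed

context lc_borel_space
begin

lemma norm_integral_le_const:
  fixes f :: "'x \<Rightarrow> complex"
  assumes "integrable M f" "AE x in M. norm (f x) \<le> B"
  shows "norm (\<integral>x. f x \<partial>M) \<le> B"
proof -
  have "norm (\<integral>x. f x \<partial>M) \<le> (\<integral>x. norm (f x) \<partial>M)" by (rule integral_norm_bound)
  also have "\<dots> \<le> B" using assms by (intro integral_le_const integrable_norm)
  finally show ?thesis .
qed

text \<open>On the spectral side, averaging \<open>F\<close> over translations by elements \<open>k\<close> of \<open>K\<close> is multiplication by
  the average of \<open>\<xi> k\<close>, which equals 1 on the annihilator of \<open>K\<close>. So \<open>\<sigma> U\<close> is at most the squared
  norm of the averaged function. That norm is written as an average of the inner products
  \<open>\<langle>U\<^bsub>k - l\<^esub> F, F\<rangle>\<close>, which is small because the inner average over \<open>k\<close> is already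
  uniformly small.\<close>

lemma spectral_measure_null_on_annihilator:
  assumes X0: "invariant_conull M act X0" and F: "F \<in> borel_measurable M"
    and b: "\<And>x. x \<in> space M \<Longrightarrow> norm (F x) \<le> b"
    and avg: "\<And>e::real. e > 0 \<Longrightarrow> \<exists>ks. ks \<noteq> [] \<and> set ks \<subseteq> K \<and>
       (\<forall>x\<in>X0. norm (\<Sum>i<length ks. F (act (- (ks ! i)) x)) \<le> e * real (length ks))"
    and \<sigma>: "is_spectral_measure M act F \<sigma>"
    and U: "U \<in> sets dual_borel" "\<And>\<xi> k. \<xi> \<in> U \<Longrightarrow> k \<in> K \<Longrightarrow> \<xi> k = 1"
  shows "emeasure \<sigma> U = 0"
proof -
  interpret \<sigma>: finite_measure \<sigma> using \<sigma> by (simp add: is_spectral_measure_def)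
  have sets_\<sigma>: "sets \<sigma> = sets dual_borel" using \<sigma> by (simp add: is_spectral_measure_def)
  have space_\<sigma>: "space \<sigma> = characters" using sets_eq_imp_space_eq[OF sets_\<sigma>] space_dual_borel by simp
  have spec: "L2_inner M (koopman act g F) F = (\<integral>\<xi>. \<xi> g \<partial>\<sigma>)" for g
    using \<sigma> by (simp add: is_spectral_measure_def)
  have ev [measurable]: "(\<lambda>\<xi>. \<xi> g) \<in> borel_measurable \<sigma>" for g
    using character_evaluation_measurable[of g] measurable_cong_sets[OF sets_\<sigma> refl] by blast
  have nev: "norm (\<xi> g) = 1" if "\<xi> \<in> characters" for \<xi> and g :: 'g using that unfolding characters_def by blast
  have ev_int: "integrable \<sigma> (\<lambda>\<xi>. \<xi> g)" for g
    by (rule \<sigma>.integrable_const_bound[of _ 1]) (auto simp: space_\<sigma> nev)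
  have [measurable]: "F \<in> borel_measurable M" by (rule F)
  have "0 \<le> b" using b not_empty norm_ge_zero order_trans by blast
  have sub: "X0 \<subseteq> space M" using X0 sets.sets_into_space unfolding invariant_conull_def by blast
  have AE_X0: "AE x in M. x \<in> X0"
    using X0 AE_not_in[of "space M - X0" M] AE_space unfolding invariant_conull_def by (auto elim: AE_mp)
  have [measurable]: "(\<lambda>x. F (act g x)) \<in> borel_measurable M" for g
    by (rule measurable_compose[OF _ F]) measurable
  have "cnj \<in> borel_measurable borel" by (intro borel_measurable_continuous_onI continuous_intros)
  then have [measurable]: "(\<lambda>x. cnj (F x)) \<in> borel_measurable M" by (rule measurable_compose[OF F])
  have prod_int: "integrable M (\<lambda>x. F (act g x) * cnj (F x))" for g
  proof (rule integrable_const_bound[of _ "b * b"])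
    show "AE x in M. norm (F (act g x) * cnj (F x)) \<le> b * b"
      using AE_space by eventually_elim (simp add: norm_mult b mult_mono \<open>0 \<le> b\<close>)
  qed measurable
  have bound: "measure \<sigma> U \<le> e * b" if e: "e > 0" for e
  proof -
    obtain ks where ks: "ks \<noteq> []" "set ks \<subseteq> K"
       "\<forall>x\<in>X0. norm (\<Sum>i<length ks. F (act (- (ks ! i)) x)) \<le> e * real (length ks)" using avg[OF e] by blast
    let ?n = "length ks"
    have n: "real ?n > 0" using ks(1) by simp
    have char: "(\<Sum>j<?n. \<Sum>i<?n. \<xi> (ks ! i - ks ! j)) = complex_of_real ((norm (\<Sum>i<?n. \<xi> (ks ! i)))\<^sup>2)"
      if "\<xi> \<in> characters" for \<xi>
    proof -
      have "(\<Sum>j<?n. \<Sum>i<?n. \<xi> (ks ! i - ks ! j)) = (\<Sum>i<?n. \<xi> (ks ! i)) * cnj (\<Sum>i<?n. \<xi> (ks ! i))"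
        unfolding character_diff[OF that] cnj_sum sum_product by (rule sum.swap)
      then show ?thesis unfolding complex_norm_square .
    qed
    have "(\<Sum>j<?n. \<Sum>i<?n. L2_inner M (koopman act (ks ! i - ks ! j) F) F)
        = (\<Sum>j<?n. \<Sum>i<?n. (\<integral>\<xi>. \<xi> (ks ! i - ks ! j) \<partial>\<sigma>))" by (simp only: spec)
    also have "\<dots> = (\<Sum>j<?n. (\<integral>\<xi>. (\<Sum>i<?n. \<xi> (ks ! i - ks ! j)) \<partial>\<sigma>))"
      by (intro sum.cong refl Bochner_Integration.integral_sum[symmetric] ev_int)
    also have "\<dots> = (\<integral>\<xi>. (\<Sum>j<?n. \<Sum>i<?n. \<xi> (ks ! i - ks ! j)) \<partial>\<sigma>)"
      by (intro Bochner_Integration.integral_sum[symmetric] Bochner_Integration.integrable_sum ev_int)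
    also have "\<dots> = (\<integral>\<xi>. complex_of_real ((norm (\<Sum>i<?n. \<xi> (ks ! i)))\<^sup>2) \<partial>\<sigma>)"
      by (intro Bochner_Integration.integral_cong) (simp_all add: space_\<sigma> char)
    also have "\<dots> = complex_of_real (\<integral>\<xi>. (norm (\<Sum>i<?n. \<xi> (ks ! i)))\<^sup>2 \<partial>\<sigma>)" by (rule integral_complex_of_real)
    finally have inner_eq: "(\<Sum>j<?n. \<Sum>i<?n. L2_inner M (koopman act (ks ! i - ks ! j) F) F) = \<dots>" .
    have "(real ?n)\<^sup>2 * measure \<sigma> U = (\<integral>\<xi>. (real ?n)\<^sup>2 * indicator U \<xi> \<partial>\<sigma>)"
      using U(1) sets_\<sigma> by simp
    also have "\<dots> \<le> (\<integral>\<xi>. (norm (\<Sum>i<?n. \<xi> (ks ! i)))\<^sup>2 \<partial>\<sigma>)"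
    proof (rule integral_mono)
      show "integrable \<sigma> (\<lambda>\<xi>. (real ?n)\<^sup>2 * indicator U \<xi>)"
        using U(1) sets_\<sigma> by (intro integrable_mult_right) (auto simp: \<sigma>.emeasure_finite less_top[symmetric])
      show "integrable \<sigma> (\<lambda>\<xi>. (norm (\<Sum>i<?n. \<xi> (ks ! i)))\<^sup>2)"
      proof (rule \<sigma>.integrable_const_bound[of _ "(real ?n)\<^sup>2"])
        have "norm (\<Sum>i<?n. \<xi> (ks ! i)) \<le> real ?n" if "\<xi> \<in> characters" for \<xi>
          using sum_norm_le[of "{..<?n}" "\<lambda>i. \<xi> (ks ! i)" "\<lambda>_. 1"] nev[OF that] by simp
        then show "AE \<xi> in \<sigma>. norm ((norm (\<Sum>i<?n. \<xi> (ks ! i)))\<^sup>2) \<le> (real ?n)\<^sup>2"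
          by (intro AE_I2) (simp add: space_\<sigma> power_mono)
      qed measurable
      show "(real ?n)\<^sup>2 * indicator U \<xi> \<le> (norm (\<Sum>i<?n. \<xi> (ks ! i)))\<^sup>2" for \<xi>
      proof (cases "\<xi> \<in> U")
        case True
        have "\<xi> (ks ! i) = 1" if "i < ?n" for i using U(2)[OF True] ks(2) nth_mem[OF that] by blast
        then show ?thesis using True by simp
      qed simp
    qed
    also have "\<dots> = norm (\<Sum>j<?n. \<Sum>i<?n. L2_inner M (koopman act (ks ! i - ks ! j) F) F)"
      unfolding inner_eq norm_of_real by (rule abs_of_nonneg[symmetric]) simp
    also have "(\<Sum>j<?n. \<Sum>i<?n. L2_inner M (koopman act (ks ! i - ks ! j) F) F)
        = (\<integral>x. (\<Sum>j<?n. \<Sum>i<?n. F (act (- (ks ! i - ks ! j)) x) * cnj (F x)) \<partial>M)"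
      (is "?l = _")
    proof -
      have "?l = (\<Sum>j<?n. \<integral>x. (\<Sum>i<?n. F (act (- (ks ! i - ks ! j)) x) * cnj (F x)) \<partial>M)"
        unfolding L2_inner_def koopman_def
        by (intro sum.cong refl Bochner_Integration.integral_sum[symmetric] prod_int)
      also have "\<dots> = (\<integral>x. (\<Sum>j<?n. \<Sum>i<?n. F (act (- (ks ! i - ks ! j)) x) * cnj (F x)) \<partial>M)"
        by (intro Bochner_Integration.integral_sum[symmetric] Bochner_Integration.integrable_sum prod_int)
      finally show ?thesis .
    qed
    also have "norm \<dots> \<le> (real ?n * (e * real ?n)) * b"
    proof (rule norm_integral_le_const)
      show "integrable M (\<lambda>x. \<Sum>j<?n. \<Sum>i<?n. F (act (- (ks ! i - ks ! j)) x) * cnj (F x))"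
        by (intro Bochner_Integration.integrable_sum prod_int)
      show "AE x in M. norm (\<Sum>j<?n. \<Sum>i<?n. F (act (- (ks ! i - ks ! j)) x) * cnj (F x)) \<le> (real ?n * (e * real ?n)) * b"
        using AE_X0
      proof eventually_elim
        fix x assume x: "x \<in> X0"
        then have xs: "x \<in> space M" using sub by blast
        have "(\<Sum>j<?n. \<Sum>i<?n. F (act (- (ks ! i - ks ! j)) x) * cnj (F x))
           = (\<Sum>j<?n. \<Sum>i<?n. F (act (- (ks ! i)) (act (ks ! j) x))) * cnj (F x)"
          by (simp add: sum_distrib_right act_act[OF xs])
        also have "norm \<dots> \<le> (real ?n * (e * real ?n)) * b"
          unfolding norm_mult complex_mod_cnj
        proof (rule mult_mono)
          have "act (ks ! j) x \<in> X0" for j using X0 x unfolding invariant_conull_def by blast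
          then have "norm (\<Sum>i<?n. F (act (- (ks ! i)) (act (ks ! j) x))) \<le> e * real ?n" for j
            using ks(3) by blast
          then have "norm (\<Sum>j<?n. \<Sum>i<?n. F (act (- (ks ! i)) (act (ks ! j) x))) \<le> (\<Sum>j<?n. e * real ?n)"
            by (intro sum_norm_le)
          then show "norm (\<Sum>j<?n. \<Sum>i<?n. F (act (- (ks ! i)) (act (ks ! j) x))) \<le> real ?n * (e * real ?n)" by simp
        qed (use b[OF xs] e in auto)
        finally show "norm (\<Sum>j<?n. \<Sum>i<?n. F (act (- (ks ! i - ks ! j)) x) * cnj (F x)) \<le> (real ?n * (e * real ?n)) * b" .
      qed
    qed
    finally have "(real ?n)\<^sup>2 * measure \<sigma> U \<le> (real ?n)\<^sup>2 * (e * b)"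
      by (simp add: power2_eq_square mult.assoc mult.left_commute)
    then show ?thesis using n by simp
  qed
  have "measure \<sigma> U \<le> 0"
  proof (rule field_le_epsilon)
    fix e :: real assume e: "e > 0"
    have "measure \<sigma> U \<le> e / (b + 1) * b" using e \<open>0 \<le> b\<close> by (intro bound) simp
    also have "\<dots> \<le> e" using e \<open>0 \<le> b\<close> by (simp add: field_simps)
    finally show "measure \<sigma> U \<le> 0 + e" by simp
  qed
  then show ?thesis using measure_nonneg[of \<sigma> U] by (simp add: \<sigma>.emeasure_eq_measure)
qed


section \<open>Transversals of a compact open subgroup are stealthy\<close>

lemma orbit_sectionD:
  assumes "orbit_section K X0 Y \<tau>"
  shows "invariant_conull M act X0" "Y \<in> sets M" "Y \<subseteq> X0" "\<tau> \<in> borel_measurable M"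
    "\<And>x. x \<in> X0 \<Longrightarrow> \<tau> x \<in> K" "\<And>x k. x \<in> X0 \<Longrightarrow> k \<in> K \<Longrightarrow> act k x \<in> Y \<longleftrightarrow> k = \<tau> x"
    "X0 \<subseteq> space M" "X0 \<in> sets M" "\<And>x g. x \<in> X0 \<Longrightarrow> act g x \<in> X0"
proof -
  show I: "invariant_conull M act X0" "Y \<in> sets M" "Y \<subseteq> X0" "\<tau> \<in> borel_measurable M"
    using assms by (simp_all add: orbit_section_def)
  show "\<tau> x \<in> K" if "x \<in> X0" for x using assms that unfolding orbit_section_def by blast
  show "act k x \<in> Y \<longleftrightarrow> k = \<tau> x" if "x \<in> X0" "k \<in> K" for x k
    using assms that unfolding orbit_section_def by blast
  show X: "X0 \<in> sets M" using I(1) by (simp add: invariant_conull_def)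
  show "X0 \<subseteq> space M" by (rule sets.sets_into_space[OF X])
  show "act g x \<in> X0" if "x \<in> X0" for x g using I(1) that by (simp add: invariant_conull_def)
qed

lemma orbit_section_shift:
  assumes K: "compact_open_subgroup K" and S: "orbit_section K X0 Y \<tau>" and x: "x \<in> X0" and k: "k \<in> K"
  shows "\<tau> (act k x) = \<tau> x - k"
proof -
  note KD = compact_open_subgroupD[OF K] and SD = orbit_sectionD[OF S]
  have "act (\<tau> x - k) (act k x) = act (\<tau> x) x" using x SD(7) by (simp add: act_act subset_iff)
  moreover have "act (\<tau> x) x \<in> Y" using SD(6)[OF x SD(5)[OF x]] by simp
  ultimately have "act (\<tau> x - k) (act k x) \<in> Y" by simp
  then show ?thesis using SD(6)[OF SD(9)[OF x] KD(6)[OF SD(5)[OF x] k]] by simp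
qed

text \<open>A transversal of the \<open>K\<close>-orbits produces exactly one return time in every coset of \<open>K\<close>.\<close>

lemma return_time_in_coset:
  assumes S: "orbit_section K X0 Y \<tau>" and x: "x \<in> X0" and t: "t - c \<in> K"
  shows "t \<in> return_times act Y x \<longleftrightarrow> t = c + \<tau> (act c x)"
proof -
  note SD = orbit_sectionD[OF S]
  have "act (t - c) (act c x) = act t x" using x SD(7) by (simp add: act_act subset_iff)
  then have "t \<in> return_times act Y x \<longleftrightarrow> t - c = \<tau> (act c x)"
    using SD(6)[OF SD(9)[OF x] t, of c] by (simp add: return_times_def)
  then show ?thesis by (auto simp: algebra_simps)
qed

lemma coset_representatives:
  assumes K: "compact_open_subgroup (K :: 'g set)" and C: "compact C"
  obtains R where "finite R" "\<forall>g\<in>C. \<exists>c\<in>R. g - c \<in> K" "\<forall>c\<in>R. \<forall>c'\<in>R. c - c' \<in> K \<longrightarrow> c = c'"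
proof -
  note KD = compact_open_subgroupD[OF K]
  have "C \<subseteq> (\<Union>p\<in>C. {x. x + (- p) \<in> K})" using KD(3) by auto
  then obtain D where D: "D \<subseteq> C" "finite D" "C \<subseteq> (\<Union>p\<in>D. {x. x + (- p) \<in> K})"
    by (rule compactE_image[OF C open_shift[OF KD(2)]])
  define r where "r g = (SOME c. c - g \<in> K)" for g
  have r: "r g - g \<in> K" for g
    unfolding r_def by (rule someI[of _ g]) (simp add: KD(3))
  have r_cong: "r g = r g'" if "g - g' \<in> K" for g g'
  proof -
    have "c - g \<in> K \<longleftrightarrow> c - g' \<in> K" for c
      using KD(4)[OF _ that, of "c - g"] KD(6)[OF _ that, of "c - g'"] by auto
    then show ?thesis by (simp add: r_def)
  qed
  show ?thesis
  proof (rule that[of "r ` D"])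
    show "finite (r ` D)" using D(2) by simp
    show "\<forall>g\<in>C. \<exists>c\<in>r ` D. g - c \<in> K"
    proof
      fix g assume "g \<in> C"
      then obtain d where d: "d \<in> D" "g - d \<in> K" using D(3) by auto
      then have "g - r d \<in> K" using KD(6)[OF d(2) r[of d]] by simp
      then show "\<exists>c\<in>r ` D. g - c \<in> K" using d(1) by blast
    qed
    show "\<forall>c\<in>r ` D. \<forall>c'\<in>r ` D. c - c' \<in> K \<longrightarrow> c = c'"
    proof (intro ballI impI)
      fix c c' assume "c \<in> r ` D" "c' \<in> r ` D" and cc: "c - c' \<in> K"
      then obtain d d' where d: "c = r d" "c' = r d'" by blast
      have "(c - c') - (r d - d) + (r d' - d') \<in> K" by (intro KD(4) KD(6) cc r)
      then have "d - d' \<in> K" unfolding d by (simp add: algebra_simps)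
      then show "c = c'" unfolding d by (rule r_cong)
    qed
  qed
qed

lemma counting_function_eq:
  assumes S: "orbit_section K X0 Y \<tau>" and x: "x \<in> X0"
    and R: "finite R" "\<forall>c\<in>R. \<forall>c'\<in>R. c - c' \<in> K \<longrightarrow> c = c'"
    and K: "compact_open_subgroup K"
    and f: "\<And>t. f t \<noteq> 0 \<Longrightarrow> \<exists>c\<in>R. t - c \<in> K"
  shows "counting_function act Y f x = (\<Sum>c\<in>R. f (c + \<tau> (act c x)))"
proof -
  note KD = compact_open_subgroupD[OF K] and SD = orbit_sectionD[OF S]
  let ?t = "\<lambda>c. c + \<tau> (act c x)"
  have t: "?t c - c \<in> K" for c using SD(5)[OF SD(9)[OF x], of c] by simp
  have inj: "inj_on ?t R"
  proof (rule inj_onI)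
    fix c c' assume c: "c \<in> R" "c' \<in> R" and eq: "?t c = ?t c'"
    have "(?t c' - c') - (?t c - c) \<in> K" by (rule KD(6)[OF t t])
    then have "c - c' \<in> K" unfolding eq by simp
    then show "c = c'" using R(2) c by blast
  qed
  have "counting_function act Y f x = infsum f (?t ` R)"
    unfolding counting_function_def
  proof (rule infsum_cong_neutral)
    fix t assume "t \<in> ?t ` R - return_times act Y x"
    then show "f t = 0" using return_time_in_coset[OF S x t] by blast
  next
    fix t assume t': "t \<in> return_times act Y x - ?t ` R"
    show "f t = 0"
    proof (rule ccontr)
      assume "f t \<noteq> 0"
      then obtain c where "c \<in> R" "t - c \<in> K" using f by blast
      then show False using return_time_in_coset[OF S x, of t c] t' by blast
    qed
  qed simp
  also have "\<dots> = sum f (?t ` R)" using R(1) by simp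
  also have "\<dots> = (\<Sum>c\<in>R. f (?t c))" by (simp add: sum.reindex[OF inj])
  finally show ?thesis .
qed

lemma counting_function_outside:
  assumes S: "orbit_section K X0 Y \<tau>" and x: "x \<in> space M" "x \<notin> X0"
  shows "counting_function act Y f x = 0"
proof -
  note SD = orbit_sectionD[OF S]
  have "act t x \<notin> Y" for t
  proof
    assume "act t x \<in> Y"
    then have "act (- t) (act t x) \<in> X0" using SD(3,9) by blast
    then show False using x act_minus_cancel by simp
  qed
  then show ?thesis by (simp add: counting_function_def return_times_def)
qed

lemma orbit_section_cross_section:
  assumes K: "compact_open_subgroup K" and S: "orbit_section K X0 Y \<tau>"
  shows "cross_section M act Y"
proof -
  note KD = compact_open_subgroupD[OF K] and SD = orbit_sectionD[OF S]
  have "return_times act Y x \<noteq> {} \<and> (\<forall>C. compact C \<longrightarrow> finite (return_times act Y x \<inter> C))" if x: "x \<in> X0" for x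
  proof (intro conjI allI impI)
    have "\<tau> x \<in> return_times act Y x"
      using SD(6)[OF x SD(5)[OF x]] by (simp add: return_times_def)
    then show "return_times act Y x \<noteq> {}" by blast
    fix C :: "'g set" assume "compact C"
    then obtain R where R: "finite R" "\<forall>g\<in>C. \<exists>c\<in>R. g - c \<in> K" "\<forall>c\<in>R. \<forall>c'\<in>R. c - c' \<in> K \<longrightarrow> c = c'"
      by (rule coset_representatives[OF K])
    have "return_times act Y x \<inter> C \<subseteq> (\<lambda>c. c + \<tau> (act c x)) ` R"
    proof
      fix t assume t: "t \<in> return_times act Y x \<inter> C"
      then obtain c where c: "c \<in> R" "t - c \<in> K" using R(2) by blast
      then have "t = c + \<tau> (act c x)" using return_time_in_coset[OF S x c(2)] t by blast
      then show "t \<in> (\<lambda>c. c + \<tau> (act c x)) ` R" using c(1) by blast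
    qed
    then show "finite (return_times act Y x \<inter> C)" using R(1) finite_subset by blast
  qed
  then show ?thesis unfolding cross_section_def using SD(1-3) by blast
qed

text \<open>The counting function adds up \<open>f\<close> at one point of each of the finitely many cosets of \<open>K\<close> that meet
  its support. Translating \<open>x\<close> by an element of \<open>K\<close> translates each of these points inside its coset.
  After averaging, \<open>f\<close> is almost constant on cosets, so the average of the counting function is
  almost a constant, whatever the points are. That constant must be close to the integral, and the
  averages of the centred counting function are uniformly small. Hence the spectral measures do not
  charge the annihilator of \<open>K\<close>.\<close>

lemma orbit_section_stealthy:
  assumes K: "compact_open_subgroup K" and S: "orbit_section K X0 Y \<tau>"
  shows "stealthy M act Y"
proof -
  note KD = compact_open_subgroupD[OF K] and SD = orbit_sectionD[OF S]
  have [measurable]: "\<tau> \<in> borel_measurable M" by (rule SD(4))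
  let ?N = "counting_function act Y"
  have AE_X0: "AE x in M. x \<in> X0"
    using SD(1) AE_not_in[of "space M - X0" M] AE_space unfolding invariant_conull_def by (auto elim: AE_mp)
  define U :: "('g \<Rightarrow> complex) set" where "U = {\<xi> \<in> characters. \<xi> ` K \<subseteq> {z. 0 < Re z}}"
  have U_open: "openin dual_topology U"
    unfolding U_def by (intro openin_dual_subbasis KD(1) open_halfspace_Re_gt)
  have U_one: "(\<lambda>_. 1) \<in> U" by (auto simp: U_def characters_def)
  have U_triv: "\<xi> k = 1" if "\<xi> \<in> U" "k \<in> K" for \<xi> k
    using that by (intro subgroup_in_halfplane[OF _ K]) (auto simp: U_def)
  have main: "square_integrable M (?N f) \<and> (\<forall>\<sigma>. is_spectral_measure M act (centred M (?N f)) \<sigma> \<longrightarrow> emeasure \<sigma> U = 0)"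
    if f: "f \<in> C_c" for f
  proof -
    obtain b where b: "0 \<le> b" "\<forall>t. norm (f t) \<le> b" by (rule C_c_bounded[OF f])
    obtain R where R: "finite R" "\<forall>g\<in>closure {t. f t \<noteq> 0}. \<exists>c\<in>R. g - c \<in> K" "\<forall>c\<in>R. \<forall>c'\<in>R. c - c' \<in> K \<longrightarrow> c = c'"
      by (rule coset_representatives[OF K C_cD(2)[OF f]])
    have supp: "\<exists>c\<in>R. t - c \<in> K" if "f t \<noteq> 0" for t using R(2) C_cD(3)[OF f, of t] that by blast
    have N_eq: "?N f x = (\<Sum>c\<in>R. f (c + \<tau> (act c x)))" if "x \<in> X0" for x
      by (rule counting_function_eq[OF S that R(1,3) K supp])
    have N_out: "?N f x = 0" if "x \<in> space M" "x \<notin> X0" for x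
      by (rule counting_function_outside[OF S that])
    have f_meas: "f \<in> borel_measurable borel" using C_cD(1)[OF f] by (rule borel_measurable_continuous_onI)
    have N_meas [measurable]: "?N f \<in> borel_measurable M"
    proof -
      have [measurable]: "X0 \<in> sets M" by (rule SD(8))
      have "(\<lambda>x. \<Sum>c\<in>R. f (c + \<tau> (act c x))) \<in> borel_measurable M"
        by (intro borel_measurable_sum measurable_compose[OF _ f_meas]) measurable
      then have "(\<lambda>x. if x \<in> X0 then \<Sum>c\<in>R. f (c + \<tau> (act c x)) else 0) \<in> borel_measurable M" by measurable
      then show ?thesis by (rule measurable_cong[THEN iffD2, rotated]) (simp add: N_eq N_out)
    qed
    define B where "B = real (card R) * b"
    have N_bound: "norm (?N f x) \<le> B" if "x \<in> space M" for x
    proof (cases "x \<in> X0")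
      case True
      have "norm (\<Sum>c\<in>R. f (c + \<tau> (act c x))) \<le> (\<Sum>c\<in>R. b)" using b(2) by (intro sum_norm_le) simp
      then show ?thesis by (simp add: N_eq[OF True] B_def)
    next
      case False
      then show ?thesis using N_out[OF that False] b(1) by (simp add: B_def)
    qed
    have N_int: "integrable M (?N f)"
      using N_bound by (intro integrable_const_bound[of _ B]) (auto simp: AE_space)
    have sq: "square_integrable M (?N f)"
      unfolding square_integrable_def
    proof
      show "integrable M (\<lambda>x. (cmod (?N f x))\<^sup>2)"
        using N_bound by (intro integrable_const_bound[of _ "B\<^sup>2"]) (auto simp: power_mono)
    qed (rule N_meas)
    define m where "m = (\<integral>x. ?N f x \<partial>M)"
    have F: "centred M (?N f) x = ?N f x - m" for x by (simp add: centred_def m_def)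
    have "norm m \<le> B" unfolding m_def
      by (rule norm_integral_le_const[OF N_int]) (use N_bound in simp)
    have F_bound: "norm (centred M (?N f) x) \<le> 2 * B" if "x \<in> space M" for x
      using norm_triangle_ineq4[of "?N f x" m] N_bound[OF that] \<open>norm m \<le> B\<close> unfolding F by linarith
    have F_meas: "centred M (?N f) \<in> borel_measurable M" unfolding centred_def by measurable
    have avg: "\<exists>ks. ks \<noteq> [] \<and> set ks \<subseteq> K \<and>
       (\<forall>x\<in>X0. norm (\<Sum>i<length ks. centred M (?N f) (act (- (ks ! i)) x)) \<le> e * real (length ks))"
      if e: "e > 0" for e :: real
    proof -
      \<comment> \<open>an error \<open>d\<close> on each of \<open>card R\<close> cosets is counted twice: for the average and for its mean;
        the summand 1 covers the case of no cosets\<close>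
      define d where "d = e / (2 * (real (card R) + 1))"
      have d: "d > 0" "2 * (real (card R) * d) \<le> e" using e by (simp_all add: d_def field_simps)
      obtain ks where ks: "ks \<noteq> []" "set ks \<subseteq> K"
        "\<forall>s s'. s - s' \<in> K \<longrightarrow> norm (list_average ks f s - list_average ks f s') \<le> d"
        by (rule average_nearly_constant_on_cosets[OF K f d(1)])
      let ?n = "length ks"
      have n: "?n > 0" using ks(1) by simp
      define a where "a = (\<Sum>c\<in>R. list_average ks f c)"
      have sum_eq: "(\<Sum>i<?n. ?N f (act (- (ks ! i)) x)) = of_nat ?n * (\<Sum>c\<in>R. list_average ks f (c + \<tau> (act c x)))"
        if x: "x \<in> X0" for x
      proof -
        have "?N f (act (- (ks ! i)) x) = (\<Sum>c\<in>R. f (c + \<tau> (act c x) + ks ! i))" if i: "i < ?n" for i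
        proof -
          have k: "- (ks ! i) \<in> K" using ks(2) nth_mem[OF i] KD(5) by blast
          have "act c (act (- (ks ! i)) x) = act (- (ks ! i)) (act c x)" for c
            using x SD(7) by (simp add: act_act subset_iff)
          then have "\<tau> (act c (act (- (ks ! i)) x)) = \<tau> (act c x) + ks ! i" for c
            using orbit_section_shift[OF K S SD(9)[OF x] k, of c] by simp
          then show ?thesis unfolding N_eq[OF SD(9)[OF x]] by (simp add: add.assoc)
        qed
        then have "(\<Sum>i<?n. ?N f (act (- (ks ! i)) x)) = (\<Sum>i<?n. \<Sum>c\<in>R. f (c + \<tau> (act c x) + ks ! i))" by simp
        also have "\<dots> = (\<Sum>c\<in>R. \<Sum>i<?n. f (c + \<tau> (act c x) + ks ! i))" by (rule sum.swap)
        also have "\<dots> = (\<Sum>c\<in>R. of_nat ?n * list_average ks f (c + \<tau> (act c x)))"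
          using n by (simp add: list_average_nth)
        finally show ?thesis by (simp add: sum_distrib_left)
      qed
      have near: "norm ((\<Sum>i<?n. ?N f (act (- (ks ! i)) x)) - of_nat ?n * a) \<le> ?n * (real (card R) * d)"
        if x: "x \<in> X0" for x
      proof -
        have "norm (list_average ks f (c + \<tau> (act c x)) - list_average ks f c) \<le> d" for c
          using ks(3) SD(5)[OF SD(9)[OF x], of c] by simp
        then have "norm (\<Sum>c\<in>R. list_average ks f (c + \<tau> (act c x)) - list_average ks f c) \<le> (\<Sum>c\<in>R. d)"
          by (intro sum_norm_le)
        then have "norm ((\<Sum>c\<in>R. list_average ks f (c + \<tau> (act c x))) - a) \<le> real (card R) * d"
          by (simp add: a_def sum_subtractf)
        then show ?thesis
          unfolding sum_eq[OF x] right_diff_distrib[symmetric] norm_mult norm_of_nat by (rule mult_left_mono) simp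
      qed
      have shift_int: "integrable M (\<lambda>x. ?N f (act g x))" "(\<integral>x. ?N f (act g x) \<partial>M) = m" for g
      proof -
        have [measurable]: "act g \<in> measurable M M" by measurable
        have "integrable (distr M M (act g)) (?N f)" using N_int act_preserving by simp
        then show "integrable M (\<lambda>x. ?N f (act g x))" by (rule integrable_distr[rotated]) measurable
        have "(\<integral>x. ?N f x \<partial>distr M M (act g)) = (\<integral>x. ?N f (act g x) \<partial>M)" by (rule integral_distr) measurable
        then show "(\<integral>x. ?N f (act g x) \<partial>M) = m" by (simp add: act_preserving m_def)
      qed
      have "norm (\<integral>x. (\<Sum>i<?n. ?N f (act (- (ks ! i)) x)) - of_nat ?n * a \<partial>M) \<le> ?n * (real (card R) * d)"
      proof (rule norm_integral_le_const)
        show "integrable M (\<lambda>x. (\<Sum>i<?n. ?N f (act (- (ks ! i)) x)) - of_nat ?n * a)"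
          by (intro Bochner_Integration.integrable_diff Bochner_Integration.integrable_sum shift_int) simp
        show "AE x in M. norm ((\<Sum>i<?n. ?N f (act (- (ks ! i)) x)) - of_nat ?n * a) \<le> ?n * (real (card R) * d)"
          using AE_X0 by eventually_elim (rule near)
      qed
      also have "(\<integral>x. (\<Sum>i<?n. ?N f (act (- (ks ! i)) x)) - of_nat ?n * a \<partial>M) = of_nat ?n * m - of_nat ?n * a"
        by (subst Bochner_Integration.integral_diff)
           (auto simp: shift_int prob_space intro!: Bochner_Integration.integrable_sum)
      finally have ma: "norm (of_nat ?n * m - of_nat ?n * a) \<le> ?n * (real (card R) * d)" .
      have "norm (\<Sum>i<?n. centred M (?N f) (act (- (ks ! i)) x)) \<le> e * ?n" if x: "x \<in> X0" for x
      proof -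
        have "(\<Sum>i<?n. centred M (?N f) (act (- (ks ! i)) x))
            = ((\<Sum>i<?n. ?N f (act (- (ks ! i)) x)) - of_nat ?n * a) - (of_nat ?n * m - of_nat ?n * a)"
          unfolding F by (simp add: sum_subtractf)
        then have "norm (\<Sum>i<?n. centred M (?N f) (act (- (ks ! i)) x)) \<le> ?n * (real (card R) * d) + ?n * (real (card R) * d)"
          using order_trans[OF norm_triangle_ineq4 add_mono[OF near[OF x] ma]] by (simp only:)
        also have "\<dots> = ?n * (2 * (real (card R) * d))" by simp
        also have "\<dots> \<le> ?n * e" using d(2) by (rule mult_left_mono) simp
        finally show ?thesis by (simp add: mult.commute)
      qed
      then show ?thesis using ks(1,2) by blast
    qed
    have "emeasure \<sigma> U = 0" if "is_spectral_measure M act (centred M (?N f)) \<sigma>" for \<sigma>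
    proof (rule spectral_measure_null_on_annihilator[OF SD(1) F_meas _ _ that openin_dual_borel[OF U_open]])
      show "norm (centred M (?N f) x) \<le> 2 * B" if "x \<in> space M" for x by (rule F_bound[OF that])
      show "\<exists>ks. ks \<noteq> [] \<and> set ks \<subseteq> K \<and>
          (\<forall>x\<in>X0. norm (\<Sum>i<length ks. centred M (?N f) (act (- (ks ! i)) x)) \<le> e * real (length ks))"
        if "e > 0" for e :: real by (rule avg[OF that])
      show "\<xi> k = 1" if "\<xi> \<in> U" "k \<in> K" for \<xi> k by (rule U_triv[OF that])
    qed
    then show ?thesis using sq by blast
  qed
  show ?thesis
    unfolding stealthy_def
    using orbit_section_cross_section[OF K S] main U_open U_one by blast
qed

end

section \<open>Generating transversals\<close>

primrec nmul :: "nat \<Rightarrow> 'g::ab_group_add \<Rightarrow> 'g" where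
  "nmul 0 x = 0"
| "nmul (Suc n) x = x + nmul n x"

lemma nmul_add: "nmul (m + n) x = nmul m x + nmul n x"
  by (induction m) (simp_all add: add.assoc)

lemma nmul_add_right: "nmul n (x + y) = nmul n x + nmul n y"
  by (induction n) (simp_all add: algebra_simps)

lemma nmul_zero_right [simp]: "nmul n 0 = 0"
  by (induction n) simp_all

lemma nmul_minus_right: "nmul n (- x) = - nmul n x"
  by (induction n) simp_all

lemma nmul_diff_right: "nmul n (x - y) = nmul n x - nmul n y"
  using nmul_add_right[of n x "- y"] by (simp add: nmul_minus_right)

lemma nmul_mult: "nmul (m * n) x = nmul m (nmul n x)"
  by (induction m) (simp_all add: nmul_add)

lemma nmul_sum: "nmul n x = (\<Sum>i<n. x)"
  by (induction n) (simp_all add: add.commute)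

lemma continuous_on_nmul: "continuous_on UNIV (nmul n :: 'g::topological_ab_group_add \<Rightarrow> 'g)"
proof (induction n)
  case 0
  show ?case by (simp add: continuous_on_const)
next
  case (Suc n)
  then show ?case by (simp add: continuous_on_add continuous_on_id)
qed

lemma nmul_in_subgroup:
  assumes "compact_open_subgroup K" "x \<in> K" shows "nmul n x \<in> K"
  using compact_open_subgroupD[OF assms(1)] assms(2) by (induction n) simp_all

text \<open>By regularity and second countability, an open set is the union of the countably many basic sets
  whose closure it contains; the limit lies in it iff the sequence ends up in one of them.\<close>

lemma borel_measurable_pointwise_limit:
  fixes f :: "nat \<Rightarrow> 'x \<Rightarrow> 'g::{second_countable_topology, t2_space}"
  assumes lc: "locally_compact_space (euclidean :: 'g topology)"
    and f: "\<And>n. f n \<in> borel_measurable M" and lim: "\<And>x. x \<in> space M \<Longrightarrow> (\<lambda>n. f n x) \<longlonglongrightarrow> F x"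
  shows "F \<in> borel_measurable M"
proof (rule borel_measurableI)
  fix U :: "'g set" assume U: "open U"
  obtain B :: "'g set set" where B: "countable B" "topological_basis B" "{} \<notin> B"
    by (rule countable_basis_nonempty)
  have regular: "regular_space (euclidean :: 'g topology)"
    by (rule locally_compact_Hausdorff_imp_regular_space[OF lc Hausdorff_space_t2])
  have small: "\<exists>V\<in>B. z \<in> V \<and> closure V \<subseteq> U" if z: "z \<in> U" for z
  proof -
    have "\<exists>S T. openin euclidean S \<and> openin euclidean T \<and> z \<in> S \<and> - U \<subseteq> T \<and> disjnt S T"
      by (rule regular[unfolded regular_space_def, rule_format]) (use U z in auto)
    then obtain S T where ST: "open S" "open T" "z \<in> S" "- U \<subseteq> T" "disjnt S T" by auto
    obtain V where V: "V \<in> B" "z \<in> V" "V \<subseteq> S" by (rule topological_basisE[OF B(2) ST(1,3)])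
    have "V \<subseteq> - T" using V(3) ST(5) by (auto simp: disjnt_iff)
    then have "closure V \<subseteq> - T" using ST(2) by (intro closure_minimal) auto
    then show ?thesis using V ST(4) by blast
  qed
  let ?B = "{V \<in> B. closure V \<subseteq> U}"
  have mem: "F x \<in> U \<longleftrightarrow> (\<exists>V\<in>?B. \<exists>N. \<forall>n. N \<le> n \<longrightarrow> f n x \<in> V)" if x: "x \<in> space M" for x
  proof
    assume "F x \<in> U"
    then obtain V where V: "V \<in> B" "F x \<in> V" "closure V \<subseteq> U" using small by blast
    have "\<forall>\<^sub>F n in sequentially. f n x \<in> V"
      by (rule topological_tendstoD[OF lim[OF x] topological_basis_open[OF B(2) V(1)] V(2)])
    then show "\<exists>V\<in>?B. \<exists>N. \<forall>n. N \<le> n \<longrightarrow> f n x \<in> V"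
      unfolding eventually_sequentially using V(1,3) by blast
  next
    assume "\<exists>V\<in>?B. \<exists>N. \<forall>n. N \<le> n \<longrightarrow> f n x \<in> V"
    then obtain V N where V: "V \<in> B" "closure V \<subseteq> U" "\<forall>n. N \<le> n \<longrightarrow> f n x \<in> V" by blast
    have "\<forall>\<^sub>F n in sequentially. f n x \<in> closure V"
      unfolding eventually_sequentially using V(3) closure_subset by blast
    then have "F x \<in> closure V" by (intro Lim_in_closed_set[OF closed_closure _ _ lim[OF x]]) auto
    then show "F x \<in> U" using V(2) by blast
  qed
  have "F -` U \<inter> space M = (\<Union>V\<in>?B. \<Union>N. {x \<in> space M. \<forall>n. N \<le> n \<longrightarrow> f n x \<in> V})"
  proof (rule set_eqI)
    fix x
    show "x \<in> F -` U \<inter> space M \<longleftrightarrow> x \<in> (\<Union>V\<in>?B. \<Union>N. {x \<in> space M. \<forall>n. N \<le> n \<longrightarrow> f n x \<in> V})"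
      using mem[of x] by (cases "x \<in> space M") simp_all
  qed
  also have "\<dots> \<in> sets M"
  proof (intro sets.countable_UN'' countable_subset[OF _ B(1)])
    fix V N assume "V \<in> ?B"
    then have "V \<in> sets borel" using topological_basis_open[OF B(2)] by auto
    then have "{x \<in> space M. f n x \<in> V} \<in> sets M" for n
      using measurable_sets[OF f] by (simp add: vimage_def Int_def conj_commute)
    then show "{x \<in> space M. \<forall>n. N \<le> n \<longrightarrow> f n x \<in> V} \<in> sets M"
      by (intro sets.sets_Collect_countable_All sets.sets_Collect_imp) auto
  qed auto
  finally show "F -` U \<inter> space M \<in> sets M" .
qed

context lc_borel_space
begin

text \<open>The code of \<open>x\<close> is the \<open>p\<close>-adic number with digits 0 and 1 that record which of countably many
  separating sets contain \<open>x\<close>. The partial sums \<open>s m x\<close> determine \<open>w x\<close> modulo \<open>p ^ m\<close> times \<open>K\<close>, and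
  compactness supplies an element with all these residues. If two codes agreed while the digits
  first differ at place \<open>n\<close>, then \<open>p ^ n\<close> times \<open>e\<close> would be \<open>p ^ Suc n\<close> times an element of \<open>K\<close>, so \<open>e\<close>
  would be \<open>p\<close> times an element of \<open>K\<close>.\<close>

lemma injective_coding:
  fixes K :: "'g set" and e :: 'g
  assumes K: "compact_open_subgroup K" and inj: "\<And>x :: 'g. nmul p x = 0 \<Longrightarrow> x = 0"
    and e: "e \<in> K" "e \<notin> nmul p ` K"
    and shrink: "\<And>U :: 'g set. open U \<Longrightarrow> 0 \<in> U \<Longrightarrow> \<exists>n. nmul (p ^ n) ` K \<subseteq> U"
  obtains w where "w \<in> borel_measurable M" "\<forall>x. w x \<in> K" "inj_on w (space M)"
proof -
  note KD = compact_open_subgroupD[OF K]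
  obtain A :: "nat \<Rightarrow> 'x set" where A: "\<forall>n. A n \<in> sets M"
    "\<forall>x\<in>space M. \<forall>y\<in>space M. (\<forall>n. x \<in> A n \<longleftrightarrow> y \<in> A n) \<longrightarrow> x = y"
    by (rule countable_separating_sets)
  have [measurable]: "A n \<in> sets M" for n using A(1) by simp
  let ?P = "\<lambda>m. nmul (p ^ m) ` K"
  have P_add: "x + y \<in> ?P m" if "x \<in> ?P m" "y \<in> ?P m" for x y m
  proof -
    obtain a b where "a \<in> K" "b \<in> K" "x = nmul (p ^ m) a" "y = nmul (p ^ m) b" using \<open>x \<in> ?P m\<close> \<open>y \<in> ?P m\<close> by blast
    then show ?thesis by (intro image_eqI[of _ _ "a + b"]) (simp_all add: nmul_add_right KD(4))
  qed
  have P_minus: "- x \<in> ?P m" if "x \<in> ?P m" for x m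
  proof -
    obtain a where "a \<in> K" "x = nmul (p ^ m) a" using \<open>x \<in> ?P m\<close> by blast
    then show ?thesis by (intro image_eqI[of _ _ "- a"]) (simp_all add: nmul_minus_right KD(5))
  qed
  have P_mono: "?P n \<subseteq> ?P m" if "m \<le> n" for m n
  proof
    fix x assume "x \<in> ?P n"
    then obtain a where a: "a \<in> K" "x = nmul (p ^ n) a" by blast
    have "p ^ n = p ^ m * p ^ (n - m)" using that by (simp add: power_add[symmetric])
    then have "x = nmul (p ^ m) (nmul (p ^ (n - m)) a)" using a(2) by (simp add: nmul_mult)
    then show "x \<in> ?P m" using nmul_in_subgroup[OF K a(1)] by blast
  qed
  have P_zero: "0 \<in> ?P m" for m using KD(3) by (intro image_eqI[of _ _ 0]) simp_all
  have P_closed: "closed (?P m)" for m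
    by (intro compact_imp_closed compact_continuous_image[OF continuous_on_subset[OF continuous_on_nmul] KD(1)]) simp
  define s where "s m x = (\<Sum>n<m. if x \<in> A n then nmul (p ^ n) e else 0)" for m x
  have s_K: "s m x \<in> K" for m x
    unfolding s_def by (induction m) (simp_all add: KD(3,4) nmul_in_subgroup[OF K e(1)])
  have s_tail: "s (m + k) x - s m x \<in> ?P m" for m k x
  proof (induction k)
    case 0
    show ?case using P_zero by simp
  next
    case (Suc k)
    have "(if x \<in> A (m + k) then nmul (p ^ (m + k)) e else 0) \<in> ?P (m + k)"
      using e(1) P_zero by simp
    then have "(if x \<in> A (m + k) then nmul (p ^ (m + k)) e else 0) \<in> ?P m" using P_mono[of m "m + k"] by auto
    then have "(s (m + k) x - s m x) + (if x \<in> A (m + k) then nmul (p ^ (m + k)) e else 0) \<in> ?P m"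
      by (rule P_add[OF Suc])
    moreover have "s (m + Suc k) x = s (m + k) x + (if x \<in> A (m + k) then nmul (p ^ (m + k)) e else 0)"
      by (simp add: s_def)
    ultimately show ?case by (simp only: diff_add_eq)
  qed
  have "\<exists>y\<in>K. \<forall>m. y - s m x \<in> ?P m" for x
  proof -
    have "K \<inter> (\<Inter>m\<in>UNIV. {y. y + (- s m x) \<in> ?P m}) \<noteq> {}"
    proof (rule compact_imp_fip_image[OF KD(1)])
      fix m
      show "closed {y. y + (- s m x) \<in> ?P m}"
        using open_shift[of "- ?P m" "- s m x"] P_closed[of m] by (simp add: closed_def Collect_neg_eq)
    next
      fix I :: "nat set" assume "finite I"
      then obtain N where N: "\<forall>n\<in>I. n \<le> N" using finite_nat_set_iff_bounded_le by blast
      have "s N x \<in> {y. y + (- s m x) \<in> ?P m}" if "m \<in> I" for m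
      proof -
        have "m \<le> N" using N that by blast
        then show ?thesis using s_tail[of m "N - m" x] by simp
      qed
      then show "K \<inter> (\<Inter>m\<in>I. {y. y + (- s m x) \<in> ?P m}) \<noteq> {}" using s_K[of N x] by blast
    qed
    then obtain y where "y \<in> K" "y \<in> (\<Inter>m\<in>UNIV. {y. y + (- s m x) \<in> ?P m})" by blast
    then show ?thesis by (intro bexI[of _ y]) auto
  qed
  then have "\<forall>x. \<exists>y. y \<in> K \<and> (\<forall>m. y - s m x \<in> ?P m)" by blast
  from choice[OF this] obtain w where w: "\<forall>x. w x \<in> K \<and> (\<forall>m. w x - s m x \<in> ?P m)" ..
  have "w \<in> borel_measurable M"
  proof (rule borel_measurable_pointwise_limit[OF locally_compact])
    show "s m \<in> borel_measurable M" for m unfolding s_def by measurable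
    show "(\<lambda>m. s m x) \<longlonglongrightarrow> w x" if "x \<in> space M" for x
    proof (rule topological_tendstoI)
      fix U :: "'g set" assume U: "open U" "w x \<in> U"
      have "continuous_on UNIV (\<lambda>y. - y + w x)"
        by (intro continuous_on_add continuous_on_minus continuous_on_id continuous_on_const)
      then have "open ((\<lambda>y. - y + w x) -` U)" using U(1) by (intro open_vimage)
      moreover have "0 \<in> (\<lambda>y. - y + w x) -` U" using U(2) by simp
      ultimately obtain N where N: "?P N \<subseteq> (\<lambda>y. - y + w x) -` U" using shrink by blast
      have "s m x \<in> U" if "N \<le> m" for m
      proof -
        have "w x - s m x \<in> ?P m" using w by blast
        then have "w x - s m x \<in> (\<lambda>y. - y + w x) -` U" using P_mono[OF that] N by blast
        then show ?thesis by simp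
      qed
      then show "\<forall>\<^sub>F m in sequentially. s m x \<in> U" unfolding eventually_sequentially by blast
    qed
  qed
  moreover have "inj_on w (space M)"
  proof (rule inj_onI, rule ccontr)
    fix x y assume x: "x \<in> space M" and y: "y \<in> space M" and eq: "w x = w y" and ne: "x \<noteq> y"
    have "\<exists>n. (x \<in> A n) \<noteq> (y \<in> A n)" using A(2) x y ne by blast
    then obtain n where n: "(x \<in> A n) \<noteq> (y \<in> A n)" "\<forall>m<n. (x \<in> A m) = (y \<in> A m)"
      using exists_least_iff[of "\<lambda>n. (x \<in> A n) \<noteq> (y \<in> A n)"] by blast
    have low: "s n x = s n y" unfolding s_def using n(2) by (intro sum.cong) auto
    have "(w y - s (Suc n) y) + (- (w x - s (Suc n) x)) \<in> ?P (Suc n)"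
      using w by (intro P_add P_minus) blast+
    then have d: "s (Suc n) x - s (Suc n) y \<in> ?P (Suc n)" using eq by (simp add: algebra_simps)
    have "nmul (p ^ n) e \<in> ?P (Suc n)"
    proof (cases "x \<in> A n")
      case True
      then have "s (Suc n) x - s (Suc n) y = nmul (p ^ n) e" using n(1) low by (simp add: s_def)
      then show ?thesis using d by simp
    next
      case False
      then have "s (Suc n) x - s (Suc n) y = - nmul (p ^ n) e" using n(1) low by (simp add: s_def)
      then show ?thesis using P_minus[OF d] by simp
    qed
    then obtain k where k: "k \<in> K" "nmul (p ^ n) e = nmul (p ^ Suc n) k" by blast
    have "nmul (p ^ n) (e - nmul p k) = 0"
      using k(2) nmul_mult[of "p ^ n" p k] by (simp add: nmul_diff_right mult.commute)
    moreover have inj_pow: "z = 0" if "nmul (p ^ n) z = 0" for z :: 'g and n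
      using that by (induction n) (auto simp: nmul_mult dest: inj)
    ultimately have "e - nmul p k = 0" by blast
    then show False using e(2) k(1) by auto
  qed
  moreover have "\<forall>x. w x \<in> K" using w by simp
  ultimately show ?thesis by (intro that)
qed

text \<open>The subgroup \<open>L\<close> consists of the \<open>p\<close> cosets of \<open>K\<close> by multiples of \<open>g\<close>. In an \<open>L\<close>-orbit with marked
  point \<open>y\<close>, the transversal \<open>Y\<close> has its points at the times \<open>j * g\<close> from \<open>y\<close>, one in each coset, except
  that the point for \<open>j = 1\<close> is displaced by \<open>p * w y\<close>, where \<open>w\<close> is an injective code with values in \<open>K\<close>.
  So \<open>t j x\<close> below are the return times of \<open>x\<close> in \<open>L\<close>.

  The return times determine \<open>x\<close>. Their sum over \<open>L\<close> is \<open>p * (\<tau>1 x + w y)\<close> plus a constant; that the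
  displacement is divisible by \<open>p\<close> allows one to divide, and \<open>\<tau>1 x\<close> is known modulo \<open>K\<close>. This singles
  out the return time \<open>t 0 x = \<tau>1 x\<close> among the others, since they lie in different cosets of \<open>K\<close>. Then
  \<open>w y\<close> is known too, hence \<open>y\<close>, and \<open>x\<close> is \<open>y\<close> translated back by \<open>\<tau>1 x\<close>.\<close>

lemma generating_orbit_section_exists:
  fixes K :: "'g set" and g :: 'g
  assumes free: "essentially_free M act" and K: "compact_open_subgroup K" and p: "prime p"
    and inj: "\<And>x :: 'g. nmul p x = 0 \<Longrightarrow> x = 0"
    and g: "nmul p g \<in> K" "nmul p g \<notin> nmul p ` K"
    and shrink: "\<And>U :: 'g set. open U \<Longrightarrow> 0 \<in> U \<Longrightarrow> \<exists>n. nmul (p ^ n) ` K \<subseteq> U"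
  obtains Y \<tau> where "orbit_section K free_part Y \<tau>" "generating M act Y"
proof -
  note KD = compact_open_subgroupD[OF K]
  have p2: "2 \<le> p" by (rule prime_ge_2_nat[OF p])
  have g_notin: "g \<notin> K" using g(2) by blast
  have distinct0: "i = j" if ij: "nmul i g - nmul j g \<in> K" "j \<le> i" "i < p" for i j
  proof (rule ccontr)
    assume "i \<noteq> j"
    define d where "d = i - j"
    have d: "0 < d" "d < p" "i = j + d" using \<open>i \<noteq> j\<close> ij(2,3) by (auto simp: d_def)
    have dK: "nmul d g \<in> K" using ij(1) unfolding d(3) nmul_add by simp
    \<comment> \<open>by Bezout, \<open>g\<close> would be a combination of \<open>d * g\<close> and \<open>p * g\<close>\<close>
    obtain q a b where q: "q dvd d" "q dvd p" "d * a = p * b + q" using bezout_add_strong_nat[of d p] d(1) by blast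
    have "q \<noteq> p" using q(1) d(1,2) dvd_imp_le by fastforce
    then have "q = 1" using q(2) p by (auto simp: prime_nat_iff)
    have "nmul (a * d) g \<in> K" unfolding nmul_mult by (rule nmul_in_subgroup[OF K dK])
    moreover have "nmul (b * p) g \<in> K" unfolding nmul_mult by (rule nmul_in_subgroup[OF K g(1)])
    moreover have "nmul (a * d) g = nmul (b * p) g + g"
    proof -
      have "a * d = b * p + 1" using q(3) \<open>q = 1\<close> by (simp add: mult.commute)
      then show ?thesis by (simp add: nmul_add)
    qed
    ultimately have "g \<in> K" using KD(6)[of "nmul (a * d) g" "nmul (b * p) g"] by simp
    then show False using g_notin by simp
  qed
  have distinct: "i = j" if ij: "nmul i g - nmul j g \<in> K" "i < p" "j < p" for i j
  proof (cases "j \<le> i")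
    case False
    have "nmul j g - nmul i g \<in> K" using KD(5)[OF ij(1)] by simp
    then show ?thesis using distinct0[of j i] False ij(3) by simp
  qed (use distinct0 ij in blast)
  define L where "L = (\<Union>j<p. {x. x + (- nmul j g) \<in> K})"
  have L_iff: "x \<in> L \<longleftrightarrow> (\<exists>j<p. x - nmul j g \<in> K)" for x by (auto simp: L_def)
  have KL: "x \<in> L" if "x \<in> K" for x using that p2 L_iff[of x] by (intro L_iff[THEN iffD2] exI[of _ 0]) simp
  have L: "compact_open_subgroup L"
    unfolding compact_open_subgroup_def
  proof (intro conjI ballI)
    have "{x. x + (- nmul j g) \<in> K} = (\<lambda>x. x + nmul j g) ` K" for j
      by (auto intro!: image_eqI[of _ _ "_ - nmul j g"])
    moreover have "compact ((\<lambda>x. x + nmul j g) ` K)" for j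
      by (intro compact_continuous_image[OF _ KD(1)] continuous_on_add continuous_on_id continuous_on_const)
    ultimately show "compact L" unfolding L_def by (intro compact_UN) auto
    show "open L" unfolding L_def by (intro open_UN ballI open_shift KD(2))
    show "0 \<in> L" by (rule KL[OF KD(3)])
    fix a assume "a \<in> L"
    then obtain i where i: "i < p" "a - nmul i g \<in> K" unfolding L_iff by blast
    show "- a \<in> L"
    proof (cases "i = 0")
      case True
      then show ?thesis using KL[OF KD(5)[OF i(2)]] by simp
    next
      case False
      have "- (a - nmul i g) - nmul p g \<in> K" by (intro KD(5,6) i g(1))
      moreover have "nmul p g = nmul (p - i) g + nmul i g" using i(1) by (simp add: nmul_add[symmetric])
      ultimately have "- a - nmul (p - i) g \<in> K" by (simp add: algebra_simps)
      then show ?thesis unfolding L_iff using False i(1) by (intro exI[of _ "p - i"]) simp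
    qed
    fix b assume "b \<in> L"
    then obtain j where j: "j < p" "b - nmul j g \<in> K" unfolding L_iff by blast
    have sum: "(a - nmul i g) + (b - nmul j g) \<in> K" by (rule KD(4)[OF i(2) j(2)])
    show "a + b \<in> L"
    proof (cases "i + j < p")
      case True
      have "a + b - nmul (i + j) g \<in> K" using sum by (simp add: nmul_add algebra_simps)
      then show ?thesis unfolding L_iff using True by blast
    next
      case False
      have "nmul (i + j - p) g + nmul p g = nmul i g + nmul j g"
        using False by (simp add: nmul_add[symmetric])
      moreover have "(a - nmul i g) + (b - nmul j g) + nmul p g \<in> K" by (rule KD(4)[OF sum g(1)])
      moreover have "a + b - z \<in> K" if "z + nmul p g = nmul i g + nmul j g"
        "(a - nmul i g) + (b - nmul j g) + nmul p g \<in> K" for z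
      proof -
        have "(a - nmul i g) + (b - nmul j g) + nmul p g = a + b - (nmul i g + nmul j g) + nmul p g"
          by (simp add: algebra_simps)
        also have "\<dots> = a + b - (z + nmul p g) + nmul p g" by (simp only: that(1))
        also have "\<dots> = a + b - z" by simp
        finally have eq: "(a - nmul i g) + (b - nmul j g) + nmul p g = a + b - z" .
        show ?thesis using that(2) unfolding eq .
      qed
      ultimately have "a + b - nmul (i + j - p) g \<in> K" by blast
      then show ?thesis unfolding L_iff using i(1) j(1) False by (intro exI[of _ "i + j - p"]) simp
    qed
  qed
  obtain Y1 \<tau>1 where S1: "orbit_section L free_part Y1 \<tau>1" by (rule orbit_section_exists[OF free L])
  note SD = orbit_sectionD[OF S1] and LD = compact_open_subgroupD[OF L]
  obtain w where w: "w \<in> borel_measurable M" "\<forall>x. w x \<in> K" "inj_on w (space M)"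
    by (rule injective_coding[OF K inj g shrink])
  have [measurable]: "w \<in> borel_measurable M" "\<tau>1 \<in> borel_measurable M" by (rule w(1), rule SD(4))
  define \<pi> where "\<pi> x = act (\<tau>1 x) x" for x
  define t where "t j x = \<tau>1 x + nmul j g + (if j = 1 then nmul p (w (\<pi> x)) else 0)" for j x
  have w': "(if j = 1 then nmul p (w (\<pi> x)) else 0) \<in> K" for j :: nat and x
    using w(2) KD(3) nmul_in_subgroup[OF K] by simp
  have t_coset: "t j x - (\<tau>1 x + nmul j g) \<in> K" for j x using w'[of j x] by (simp add: t_def)
  have t_L: "t j x \<in> L" if "x \<in> free_part" "j < p" for j x
  proof -
    have "nmul j g \<in> L" unfolding L_iff using that(2) KD(3) by (intro exI[of _ j]) simp
    then show ?thesis unfolding t_def by (intro LD(4) SD(5)[OF that(1)] KL[OF w'])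
  qed
  have t_distinct: "i = j" if "t i x - t j x \<in> K" "i < p" "j < p" for i j x
  proof (rule distinct[OF _ that(2,3)])
    have "(t i x - t j x) - (t i x - (\<tau>1 x + nmul i g)) + (t j x - (\<tau>1 x + nmul j g)) \<in> K"
      by (intro KD(4,6) that(1) t_coset)
    then show "nmul i g - nmul j g \<in> K" by (simp add: algebra_simps)
  qed
  have xs: "x \<in> space M" if "x \<in> free_part" for x using SD(7) that by blast
  have t_shift: "t j (act k x) = t j x - k" if x: "x \<in> free_part" and k: "k \<in> L" for j k x
  proof -
    have "\<tau>1 (act k x) = \<tau>1 x - k" by (rule orbit_section_shift[OF L S1 x k])
    moreover from this have "\<pi> (act k x) = \<pi> x" using xs[OF x] by (simp add: \<pi>_def act_act)
    ultimately show ?thesis by (simp add: t_def algebra_simps)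
  qed
  have \<pi>_measurable [measurable]: "\<pi> \<in> measurable M M" unfolding \<pi>_def by measurable
  have t_measurable [measurable]: "t j \<in> borel_measurable M" for j
  proof -
    have "nmul p \<in> borel_measurable (borel :: 'g measure)" by (rule borel_measurable_continuous_onI[OF continuous_on_nmul])
    then have "(\<lambda>x. nmul p (w (\<pi> x))) \<in> borel_measurable M"
      by (rule measurable_compose[rotated]) measurable
    then show ?thesis unfolding t_def by (cases "j = 1") simp_all
  qed
  define Y where "Y = {x \<in> free_part. \<exists>j\<in>{..<p}. t j x = 0}"
  have Y_hit: "act k x \<in> Y \<longleftrightarrow> (\<exists>j<p. t j x = k)" if x: "x \<in> free_part" and k: "k \<in> L" for x k
    using SD(9)[OF x] t_shift[OF x k] by (auto simp: Y_def)
  have Y_sets: "Y \<in> sets M"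
  proof -
    have zero: "t j -` {0} \<inter> space M \<in> sets M" for j by (rule measurable_sets[OF t_measurable]) simp
    have "free_part \<inter> (\<Union>j\<in>{..<p}. t j -` {0} \<inter> space M) \<in> sets M"
      by (intro sets.Int free_part_measurable sets.finite_UN finite_lessThan zero)
    moreover have "free_part \<inter> (\<Union>j\<in>{..<p}. t j -` {0} \<inter> space M) = Y" using xs by (auto simp: Y_def)
    ultimately show ?thesis by simp
  qed
  define \<tau> where "\<tau> x = (\<Sum>j<p. if t j x \<in> K then t j x else 0)" for x
  have K_sets [measurable]: "K \<in> sets borel" using KD(2) by (rule borel_open)
  have \<tau>_measurable: "\<tau> \<in> borel_measurable M" unfolding \<tau>_def by measurable
  have \<tau>: "\<exists>j<p. \<tau> x = t j x \<and> t j x \<in> K \<and> (\<forall>i<p. t i x \<in> K \<longrightarrow> i = j)" if x: "x \<in> free_part" for x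
  proof -
    obtain j where j: "j < p" "- \<tau>1 x - nmul j g \<in> K" using LD(5)[OF SD(5)[OF x]] unfolding L_iff by blast
    have "(t j x - (\<tau>1 x + nmul j g)) - (- \<tau>1 x - nmul j g) \<in> K" by (rule KD(6)[OF t_coset j(2)])
    then have tj: "t j x \<in> K" by (simp add: algebra_simps)
    have only: "i = j" if "i < p" "t i x \<in> K" for i
      by (rule t_distinct[OF KD(6)[OF that(2) tj] that(1) j(1)])
    have "\<tau> x = (\<Sum>i<p. if i = j then t j x else 0)"
      unfolding \<tau>_def
    proof (rule sum.cong[OF refl])
      fix i assume i: "i \<in> {..<p}"
      show "(if t i x \<in> K then t i x else 0) = (if i = j then t j x else 0)"
      proof (cases "i = j")
        case False
        then have "t i x \<notin> K" using only[of i] i by auto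
        then show ?thesis using False by (simp only: if_False)
      qed (simp add: tj)
    qed
    then have "\<tau> x = t j x" using j(1) by simp
    then show ?thesis using j(1) tj only by (intro exI[of _ j] conjI allI impI)
  qed
  have S: "orbit_section K free_part Y \<tau>"
    unfolding orbit_section_def
  proof (intro conjI ballI)
    show "invariant_conull M act free_part" by (rule SD(1))
    show "Y \<in> sets M" by (rule Y_sets)
    show "Y \<subseteq> free_part" by (auto simp: Y_def)
    show "\<tau> \<in> borel_measurable M" by (rule \<tau>_measurable)
    fix x assume x: "x \<in> free_part"
    then obtain j where j: "j < p" "\<tau> x = t j x" "t j x \<in> K" "\<forall>i<p. t i x \<in> K \<longrightarrow> i = j" using \<tau> by blast
    show "\<tau> x \<in> K" unfolding j(2) by (rule j(3))
    fix k assume k: "k \<in> K"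
    have "(\<exists>i<p. t i x = k) \<longleftrightarrow> k = t j x"
    proof
      assume "\<exists>i<p. t i x = k"
      then obtain i where i: "i < p" "t i x = k" by blast
      then have "i = j" using j(4) k by blast
      then show "k = t j x" using i(2) by (simp only:)
    qed (use j(1) in blast)
    then show "act k x \<in> Y \<longleftrightarrow> k = \<tau> x" unfolding Y_hit[OF x KL[OF k]] j(2) .
  qed
  have "inj_on (return_times act Y) free_part"
  proof (rule inj_onI)
    fix x y assume x: "x \<in> free_part" and y: "y \<in> free_part" and eq: "return_times act Y x = return_times act Y y"
    have window: "return_times act Y z \<inter> L = (\<lambda>j. t j z) ` {..<p}" if z: "z \<in> free_part" for z
      using Y_hit[OF z] t_L[OF z] by (auto simp: return_times_def)
    have inj_t: "inj_on (\<lambda>j. t j z) {..<p}" for z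
      using t_distinct[of _ z] KD(3) by (intro inj_onI) auto
    have sum_t: "(\<Sum>j<p. t j z) = nmul p (\<tau>1 z + w (\<pi> z)) + (\<Sum>j<p. nmul j g)" for z
    proof -
      have "(\<Sum>j<p. if j = 1 then nmul p (w (\<pi> z)) else 0) = nmul p (w (\<pi> z))"
        using p2 by simp
      then show ?thesis unfolding t_def sum.distrib nmul_add_right nmul_sum[symmetric] by (simp add: algebra_simps)
    qed
    have t0: "t 0 z = \<tau>1 z" for z by (simp add: t_def)
    have image_eq: "(\<lambda>j. t j x) ` {..<p} = (\<lambda>j. t j y) ` {..<p}" using window[OF x] window[OF y] eq by simp
    have "(\<Sum>j<p. t j x) = \<Sum>((\<lambda>j. t j x) ` {..<p})" by (simp add: sum.reindex[OF inj_t])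
    also have "\<dots> = (\<Sum>j<p. t j y)" unfolding image_eq by (simp add: sum.reindex[OF inj_t])
    finally have "nmul p ((\<tau>1 x + w (\<pi> x)) - (\<tau>1 y + w (\<pi> y))) = 0"
      unfolding sum_t nmul_diff_right by simp
    then have "(\<tau>1 x + w (\<pi> x)) - (\<tau>1 y + w (\<pi> y)) = 0" by (rule inj)
    then have wd: "\<tau>1 x - \<tau>1 y = w (\<pi> y) - w (\<pi> x)" by (simp add: algebra_simps)
    then have dK: "\<tau>1 x - \<tau>1 y \<in> K" using KD(6) w(2) by simp
    have "t 0 x \<in> (\<lambda>j. t j y) ` {..<p}" unfolding image_eq[symmetric] using p2 by simp
    then obtain i where i: "i < p" "t 0 x = t i y" by blast
    have "(\<tau>1 x - \<tau>1 y) - (t i y - (\<tau>1 y + nmul i g)) \<in> K" by (rule KD(6)[OF dK t_coset])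
    moreover have "t i y = \<tau>1 x" using i(2) unfolding t0 by (rule sym)
    ultimately have "nmul i g - nmul 0 g \<in> K" by (simp add: algebra_simps)
    then have "i = 0" using distinct[of i 0] i(1) p2 by simp
    then have \<tau>_eq: "\<tau>1 x = \<tau>1 y" using i(2) by (simp only: t0)
    then have "w (\<pi> x) = w (\<pi> y)" using wd by simp
    moreover have "\<pi> x \<in> space M" "\<pi> y \<in> space M" using xs[OF x] xs[OF y] by (simp_all add: \<pi>_def)
    ultimately have "\<pi> x = \<pi> y" by (intro inj_onD[OF w(3)])
    then have "act (- \<tau>1 x) (act (\<tau>1 x) x) = act (- \<tau>1 x) (act (\<tau>1 x) y)" unfolding \<pi>_def \<tau>_eq by simp
    then show "x = y" unfolding act_minus_cancel[OF xs[OF x]] act_minus_cancel[OF xs[OF y]] .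
  qed
  then have "generating M act Y" unfolding generating_def using SD(1) by blast
  then show ?thesis by (rule that[OF S])
qed

end

section \<open>Groups isomorphic to the p-adic numbers\<close>

lemma padic_abs_p_times:
  assumes p: "prime p"
  shows "padic_abs p (of_nat p * q) = padic_abs p q / real p"
proof (cases "q = 0")
  case False
  obtain a b where q: "q = Fract a b" "b > 0" using Rat_cases[of q] by metis
  have a: "a \<noteq> 0" using False q by (auto simp: Zero_rat_def eq_rat)
  have p0: "real p > 0" "int p \<noteq> 0" using prime_gt_0_nat[OF p] by simp_all
  have "of_nat p * q = Fract (int p * a) b"
    unfolding q(1) by (simp add: of_nat_rat)
  then have "padic_abs p (of_nat p * q) = real p powi (int (multiplicity (int p) b) - int (multiplicity (int p) (int p * a)))"
    using a q(2) p0 by (simp only:) (rule padic_abs_Fract[OF p]; simp)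
  also have "multiplicity (int p) (int p * a) = Suc (multiplicity (int p) a)"
    using a p0 p by (intro multiplicity_times_same) (auto simp: prime_nat_iff)
  also have "real p powi (int (multiplicity (int p) b) - int (Suc (multiplicity (int p) a)))
      = real p powi (int (multiplicity (int p) b) - int (multiplicity (int p) a)) / real p"
    using p0 power_int_diff[of "real p" "int (multiplicity (int p) b) - int (multiplicity (int p) a)" 1]
    by (simp add: algebra_simps)
  also have "real p powi (int (multiplicity (int p) b) - int (multiplicity (int p) a)) = padic_abs p q"
    using a q p by (simp add: padic_abs_Fract)
  finally show ?thesis .
qed simp

lemma padic_abs_p_power: "prime p \<Longrightarrow> padic_abs p (of_nat p ^ n) = (1 / real p) ^ n"
proof (induction n)
  case 0
  have "padic_abs p (Fract 1 1) = real p powi (int (multiplicity (int p) 1) - int (multiplicity (int p) 1))"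
    using 0 by (intro padic_abs_Fract) auto
  then show ?case by (simp add: One_rat_def)
next
  case (Suc n)
  then show ?case by (simp add: padic_abs_p_times)
qed

lemma padic_abs_tendsto_cong:
  assumes p: "prime p" and d: "(\<lambda>n. padic_abs p (a n - b n)) \<longlonglongrightarrow> 0"
    and a: "(\<lambda>n. padic_abs p (a n)) \<longlonglongrightarrow> l"
  shows "(\<lambda>n. padic_abs p (b n)) \<longlonglongrightarrow> l"
proof -
  have "norm (padic_abs p (b n) - padic_abs p (a n)) \<le> padic_abs p (a n - b n)" for n
    using padic_abs_triangle[OF p, of "a n" 0 "b n"] padic_abs_triangle[OF p, of "b n" 0 "a n"]
      padic_abs_minus_commute[of p "b n" "a n"] by simp
  then have "(\<lambda>n. padic_abs p (b n) - padic_abs p (a n)) \<longlonglongrightarrow> 0"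
    by (intro tendsto_0_le[OF d, of _ 1] always_eventually allI) simp
  from tendsto_add[OF this a] show ?thesis by simp
qed

lemma padic_abs_tendsto_add:
  assumes p: "prime p" and a: "(\<lambda>n. padic_abs p (a n)) \<longlonglongrightarrow> 0" and b: "(\<lambda>n. padic_abs p (b n)) \<longlonglongrightarrow> 0"
  shows "(\<lambda>n. padic_abs p (a n + b n)) \<longlonglongrightarrow> 0"
proof (rule tendsto_sandwich[OF _ _ tendsto_const])
  have "(\<lambda>n. padic_abs p (a n) + padic_abs p (b n)) \<longlonglongrightarrow> 0 + 0" using a b by (rule tendsto_add)
  then show "(\<lambda>n. padic_abs p (a n) + padic_abs p (b n)) \<longlonglongrightarrow> 0" by simp
  show "\<forall>\<^sub>F n in sequentially. padic_abs p (a n + b n) \<le> padic_abs p (a n) + padic_abs p (b n)"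
    using padic_abs_triangle[OF p, of "a _" "- b _" 0] by (intro always_eventually allI) simp
qed simp

locale Qp_group =
  fixes p :: nat and \<phi> :: "'g::{topological_ab_group_add, t2_space} \<Rightarrow> (nat \<Rightarrow> rat) set"
  assumes p: "prime p" and iso: "Qp_isomorphism p \<phi>"
begin

definition rep :: "'g \<Rightarrow> nat \<Rightarrow> rat" where
  "rep x = Qp_rep (\<phi> x)"

text \<open>The \<open>p\<close>-adic absolute value, transported to the group along the isomorphism.\<close>

definition val :: "'g \<Rightarrow> real" where
  "val x = lim (\<lambda>n. padic_abs p (rep x n))"

lemma homeo: "homeomorphic_map euclidean (Qp_topology p) \<phi>"
  and phi_add: "\<phi> (x + y) = Qp_add p (\<phi> x) (\<phi> y)"
  using iso by (simp_all add: Qp_isomorphism_def)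

lemma topspace_Qp: "topspace (Qp_topology p) = Qp p"
  unfolding Qp_topology_def by (rule Metric_space.topspace_mtopology[OF Metric_space_Qp[OF p]])

lemma phi_image: "\<phi> ` UNIV = Qp p"
  using homeomorphic_imp_surjective_map[OF homeo] topspace_Qp by simp

lemma phi_in: "\<phi> x \<in> Qp p"
  using phi_image by blast

lemma phi_inj: "inj \<phi>"
  using homeomorphic_imp_injective_map[OF homeo] by simp

lemma rep_cauchy: "rep x \<in> padic_cauchy p"
  unfolding rep_def by (rule Qp_rep(2)[OF p phi_in])

lemma zero_cauchy: "(\<lambda>_. 0) \<in> padic_cauchy p"
  by (simp add: padic_cauchy_def)

lemma val_lim: "(\<lambda>n. padic_abs p (rep x n)) \<longlonglongrightarrow> val x"
  using convergent_padic_abs_diff[OF p rep_cauchy zero_cauchy, of x]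
  by (simp add: val_def convergent_LIMSEQ_iff)

lemma rep_class:
  assumes "\<phi> x = padic_rel p `` {s}"
  shows "(\<lambda>n. padic_abs p (s n - rep x n)) \<longlonglongrightarrow> 0"
proof -
  have "rep x \<in> padic_rel p `` {s}" using Qp_rep(1)[OF p phi_in[of x]] assms by (simp add: rep_def)
  then show ?thesis by (simp add: padic_rel_def)
qed

lemma rep_add: "(\<lambda>n. padic_abs p (rep x n + rep y n - rep (x + y) n)) \<longlonglongrightarrow> 0"
  by (rule rep_class) (simp add: phi_add Qp_add_def rep_def)

lemma rep_zero: "(\<lambda>n. padic_abs p (rep 0 n)) \<longlonglongrightarrow> 0"
  using rep_add[of 0 0] by simp

lemma val_eqI: "(\<lambda>n. padic_abs p (a n - rep x n)) \<longlonglongrightarrow> 0 \<Longrightarrow> (\<lambda>n. padic_abs p (a n)) \<longlonglongrightarrow> l \<Longrightarrow> val x = l"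
  using padic_abs_tendsto_cong[OF p] val_lim LIMSEQ_unique by blast

lemma val_zero: "val 0 = 0"
  using val_lim rep_zero LIMSEQ_unique by blast

lemma val_add: "val (x + y) \<le> max (val x) (val y)"
proof -
  have d: "(\<lambda>n. padic_abs p (rep (x + y) n - (rep x n + rep y n))) \<longlonglongrightarrow> 0"
    using rep_add[of x y] by (subst padic_abs_minus_commute)
  have "(\<lambda>n. padic_abs p (rep x n + rep y n)) \<longlonglongrightarrow> val (x + y)"
    by (rule padic_abs_tendsto_cong[OF p d val_lim])
  moreover have "(\<lambda>n. max (padic_abs p (rep x n)) (padic_abs p (rep y n))) \<longlonglongrightarrow> max (val x) (val y)"
    by (intro tendsto_max val_lim)
  ultimately show ?thesis
    by (rule LIMSEQ_le) (use padic_abs_ultra[OF p] in blast)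
qed

lemma val_minus: "val (- x) = val x"
proof (rule val_eqI)
  have "(\<lambda>n. padic_abs p ((rep x n + rep (- x) n - rep (x + - x) n) + rep 0 n)) \<longlonglongrightarrow> 0"
    by (intro padic_abs_tendsto_add[OF p] rep_add rep_zero)
  then have "(\<lambda>n. padic_abs p (- (- rep x n - rep (- x) n))) \<longlonglongrightarrow> 0" by (simp add: algebra_simps)
  then show "(\<lambda>n. padic_abs p (- rep x n - rep (- x) n)) \<longlonglongrightarrow> 0" by (simp only: padic_abs_uminus)
  show "(\<lambda>n. padic_abs p (- rep x n)) \<longlonglongrightarrow> val x" using val_lim by simp
qed

lemma rep_nmul: "(\<lambda>n. padic_abs p (of_nat k * rep x n - rep (nmul k x) n)) \<longlonglongrightarrow> 0"
proof (induction k)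
  case 0
  show ?case using rep_zero by simp
next
  case (Suc k)
  have "(\<lambda>n. padic_abs p ((of_nat k * rep x n - rep (nmul k x) n)
      + (rep x n + rep (nmul k x) n - rep (x + nmul k x) n))) \<longlonglongrightarrow> 0"
    by (rule padic_abs_tendsto_add[OF p Suc rep_add])
  then show ?case by (simp add: algebra_simps)
qed

lemma val_nmul_p: "val (nmul p x) = val x / real p"
proof (rule val_eqI[OF rep_nmul])
  show "(\<lambda>n. padic_abs p (of_nat p * rep x n)) \<longlonglongrightarrow> val x / real p"
    unfolding padic_abs_p_times[OF p] by (intro tendsto_divide val_lim tendsto_const) (use prime_gt_0_nat[OF p] in simp)
qed

lemma val_nmul_p_power: "val (nmul (p ^ n) x) = val x / real p ^ n"
  by (induction n) (simp_all add: nmul_mult val_nmul_p)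

lemma dist_val: "Qp_dist p (\<phi> 0) (\<phi> x) = val x"
proof -
  have "(\<lambda>n. padic_abs p ((- rep x n) - (rep 0 n - rep x n))) \<longlonglongrightarrow> 0" using rep_zero by simp
  moreover have "(\<lambda>n. padic_abs p (- rep x n)) \<longlonglongrightarrow> val x" using val_lim by simp
  ultimately have "(\<lambda>n. padic_abs p (rep 0 n - rep x n)) \<longlonglongrightarrow> val x" by (rule padic_abs_tendsto_cong[OF p])
  then show ?thesis using phi_in by (simp add: Qp_dist_def rep_def limI)
qed

lemma val_eq_0: "val x = 0 \<Longrightarrow> x = 0"
proof -
  assume "val x = 0"
  then have "Qp_dist p (\<phi> 0) (\<phi> x) = 0" by (simp add: dist_val)
  then have "\<phi> 0 = \<phi> x" using Metric_space.zero[OF Metric_space_Qp[OF p] phi_in phi_in] by blast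
  then show "x = 0" using phi_inj by (metis injD)
qed

lemma open_val_ball: "open {x. val x < r}"
proof -
  have "openin (Qp_topology p) (Metric_space.mball (Qp p) (Qp_dist p) (\<phi> 0) r)"
    unfolding Qp_topology_def by (rule Metric_space.openin_mball[OF Metric_space_Qp[OF p]])
  then have "openin euclidean {x \<in> topspace euclidean. \<phi> x \<in> Metric_space.mball (Qp p) (Qp_dist p) (\<phi> 0) r}"
    by (rule openin_continuous_map_preimage[OF homeomorphic_imp_continuous_map[OF homeo]])
  then show ?thesis
    by (simp add: Metric_space.in_mball[OF Metric_space_Qp[OF p]] phi_in dist_val)
qed

lemma val_ball_subset:
  assumes U: "open U" "0 \<in> U"
  obtains r where "r > 0" "\<forall>x. val x < r \<longrightarrow> x \<in> U"
proof -
  have "openin (Qp_topology p) (\<phi> ` U)"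
    using homeomorphic_map_openness_eq[OF homeo] U(1) by (metis open_openin open_map_def homeomorphic_imp_open_map homeo)
  then obtain r where r: "r > 0" "Metric_space.mball (Qp p) (Qp_dist p) (\<phi> 0) r \<subseteq> \<phi> ` U"
    using U(2) unfolding Qp_topology_def Metric_space.openin_mtopology[OF Metric_space_Qp[OF p]] by blast
  show ?thesis
  proof (rule that[OF r(1)], intro allI impI)
    fix x assume "val x < r"
    then have "\<phi> x \<in> Metric_space.mball (Qp p) (Qp_dist p) (\<phi> 0) r"
      by (simp add: Metric_space.in_mball[OF Metric_space_Qp[OF p]] phi_in dist_val)
    then have "\<phi> x \<in> \<phi> ` U" using r(2) by blast
    then show "x \<in> U" using phi_inj by (simp add: inj_image_mem_iff)
  qed
qed

lemma val_p_power: "\<exists>x. val x = (1 / real p) ^ m"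
proof -
  let ?q = "(of_nat p ^ m :: rat)"
  have "(\<lambda>_. ?q) \<in> padic_cauchy p" by (simp add: padic_cauchy_def)
  then have "padic_rel p `` {\<lambda>_. ?q} \<in> Qp p" unfolding Qp_def by (rule quotientI)
  then obtain x where x: "\<phi> x = padic_rel p `` {\<lambda>_. ?q}" using phi_image by (metis imageE)
  have "val x = (1 / real p) ^ m"
    by (rule val_eqI[OF rep_class[OF x]]) (simp add: padic_abs_p_power[OF p])
  then show ?thesis by blast
qed

text \<open>By the ultrametric inequality balls around 0 are open subgroups, hence also closed, and therefore
  compact when they lie in a compact set.\<close>

lemma val_ball_compact_open_subgroup:
  assumes C: "compact C" "\<forall>x. val x < r \<longrightarrow> x \<in> C" and r: "r > 0"
  shows "compact_open_subgroup {x. val x < r}"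
proof -
  let ?K = "{x. val x < r}"
  have add: "x + y \<in> ?K" if "x \<in> ?K" "y \<in> ?K" for x y using val_add[of x y] that by auto
  have minus: "- x \<in> ?K" if "x \<in> ?K" for x using that by (simp add: val_minus)
  have "open (- ?K)"
  proof (subst open_subopen, rule ballI)
    fix y assume y: "y \<in> - ?K"
    show "\<exists>T. open T \<and> y \<in> T \<and> T \<subseteq> - ?K"
    proof (intro exI[of _ "{x. x + (- y) \<in> ?K}"] conjI subsetI)
      show "open {x. x + (- y) \<in> ?K}" by (rule open_shift[OF open_val_ball])
      show "y \<in> {x. x + (- y) \<in> ?K}" using r by (simp add: val_zero)
      fix x assume x: "x \<in> {x. x + (- y) \<in> ?K}"
      show "x \<in> - ?K"
      proof
        assume xK: "x \<in> ?K"
        have "x + - y \<in> ?K" using x by (rule CollectD)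
        then have "x + - (x + - y) \<in> ?K" by (rule add[OF xK minus])
        then show False using y by simp
      qed
    qed
  qed
  then have "closed ?K" by (simp add: closed_def)
  moreover have "?K = C \<inter> ?K" using C(2) by blast
  ultimately have "compact ?K" using compact_Int_closed[OF C(1)] by metis
  then show ?thesis unfolding compact_open_subgroup_def
    using open_val_ball add minus r by (simp add: val_zero)
qed

text \<open>\<open>K\<close> is the open ball of radius \<open>p\<close> to the power \<open>-m\<close>, for \<open>m\<close> so large that the ball lies in a compact
  neighbourhood of 0, and \<open>g\<close> is an element of absolute value exactly \<open>p\<close> to the power \<open>-m\<close>. Then
  \<open>p * g\<close> lies in \<open>K\<close>; it is not \<open>p\<close> times an element of \<open>K\<close>, since that element would have to have
  the same absolute value as \<open>g\<close>.\<close>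

lemma coding_subgroup_exists:
  assumes lc: "locally_compact_space (euclidean :: 'g topology)"
  obtains K :: "'g set" and g where "compact_open_subgroup K" "nmul p g \<in> K" "nmul p g \<notin> nmul p ` K"
    "\<forall>U. open U \<longrightarrow> 0 \<in> U \<longrightarrow> (\<exists>n. nmul (p ^ n) ` K \<subseteq> U)"
proof -
  have p1: "real p > 1" using prime_gt_1_nat[OF p] by simp
  have lim: "(\<lambda>m. (1 / real p) ^ m * c) \<longlonglongrightarrow> 0" for c
  proof -
    have "(\<lambda>m. (1 / real p) ^ m * c) \<longlonglongrightarrow> 0 * c"
      using p1 by (intro tendsto_mult LIMSEQ_power_zero tendsto_const) simp
    then show ?thesis by simp
  qed
  have small: "\<exists>m. (1 / real p) ^ m * c < r" if "r > 0" for r c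
    using order_tendstoD(2)[OF lim[of c] that] unfolding eventually_sequentially by blast
  have "\<exists>U C. open U \<and> compact C \<and> (0 :: 'g) \<in> U \<and> U \<subseteq> C"
    using lc unfolding locally_compact_space_def by simp
  then obtain U C where UC: "open U" "compact C" "(0 :: 'g) \<in> U" "U \<subseteq> C" by blast
  obtain r where r: "r > 0" "\<forall>x. val x < r \<longrightarrow> x \<in> U" by (rule val_ball_subset[OF UC(1,3)])
  obtain m where "(1 / real p) ^ m * 1 < r" using small[OF r(1)] by blast
  then have m: "(1 / real p) ^ m < r" by simp
  let ?r = "(1 / real p) ^ m"
  let ?K = "{x. val x < ?r}"
  have r0: "?r > 0" using p1 by simp
  have K: "compact_open_subgroup ?K"
  proof (rule val_ball_compact_open_subgroup[OF UC(2) _ r0], intro allI impI)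
    fix x assume "val x < ?r"
    then have "x \<in> U" using r(2) m by (meson less_trans)
    then show "x \<in> C" using UC(4) by blast
  qed
  obtain g where g: "val g = ?r" using val_p_power by blast
  show ?thesis
  proof (rule that[OF K])
    show "nmul p g \<in> ?K" using r0 p1 by (simp add: val_nmul_p g divide_less_eq)
    show "nmul p g \<notin> nmul p ` ?K"
    proof
      assume "nmul p g \<in> nmul p ` ?K"
      then obtain k where k: "val k < ?r" "nmul p g = nmul p k" by blast
      from k(2) have "val g / real p = val k / real p" unfolding val_nmul_p[symmetric] by simp
      then show False using k(1) g p1 by simp
    qed
    show "\<forall>U. open U \<longrightarrow> 0 \<in> U \<longrightarrow> (\<exists>n. nmul (p ^ n) ` ?K \<subseteq> U)"
    proof (intro allI impI)
      fix U :: "'g set" assume "open U" "0 \<in> U"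
      then obtain d where d: "d > 0" "\<forall>x. val x < d \<longrightarrow> x \<in> U" by (rule val_ball_subset)
      obtain n where n: "(1 / real p) ^ n * ?r < d" using small[OF d(1)] by blast
      have "nmul (p ^ n) k \<in> U" if "k \<in> ?K" for k
      proof -
        have "val (nmul (p ^ n) k) = (1 / real p) ^ n * val k" by (simp add: val_nmul_p_power power_divide)
        also have "\<dots> \<le> (1 / real p) ^ n * ?r" using that p1 by (intro mult_left_mono) auto
        finally show ?thesis using n d(2) by (meson le_less_trans)
      qed
      then show "\<exists>n. nmul (p ^ n) ` ?K \<subseteq> U" by blast
    qed
  qed
qed

lemma nmul_p_eq_0:
  fixes x :: 'g
  assumes "nmul p x = 0" shows "x = 0"
proof (rule val_eq_0)
  have "val x / real p = 0" using assms val_nmul_p[of x] val_zero by simp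
  then show "val x = 0" using prime_gt_0_nat[OF p] by simp
qed

end

theorem theorem1p7:
  fixes M :: "'x measure"
    and act :: "'g::{topological_ab_group_add, second_countable_topology, t2_space} \<Rightarrow> 'x \<Rightarrow> 'x"
  assumes "locally_compact_space (euclidean :: 'g topology)"
    and "pp_borel_space M act"
    and "essentially_free M act"
  shows "((\<exists>K :: 'g set. compact_open_subgroup K) \<longrightarrow> (\<exists>Y. stealthy M act Y)) \<and>
         (\<forall>p. prime p \<longrightarrow> (\<exists>\<phi> :: 'g \<Rightarrow> (nat \<Rightarrow> rat) set. Qp_isomorphism p \<phi>) \<longrightarrow>
              (\<exists>Y. generating M act Y \<and> stealthy M act Y))"
proof -
  interpret pp_borel_space M act by (rule assms(2))
  interpret lc_borel_space M act by unfold_locales (rule assms(1))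
  show ?thesis
  proof (intro conjI allI impI)
    assume "\<exists>K :: 'g set. compact_open_subgroup K"
    then obtain K :: "'g set" where K: "compact_open_subgroup K" by blast
    obtain Y \<tau> where "orbit_section K free_part Y \<tau>" by (rule orbit_section_exists[OF assms(3) K])
    then have "stealthy M act Y" by (rule orbit_section_stealthy[OF K])
    then show "\<exists>Y. stealthy M act Y" by blast
  next
    fix p :: nat
    assume p: "prime p" and "\<exists>\<phi> :: 'g \<Rightarrow> (nat \<Rightarrow> rat) set. Qp_isomorphism p \<phi>"
    then obtain \<phi> :: "'g \<Rightarrow> (nat \<Rightarrow> rat) set" where \<phi>: "Qp_isomorphism p \<phi>" by blast
    interpret G: Qp_group p \<phi> by unfold_locales (rule p, rule \<phi>)
    obtain K :: "'g set" and g where K: "compact_open_subgroup K" "nmul p g \<in> K" "nmul p g \<notin> nmul p ` K"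
      "\<forall>U. open U \<longrightarrow> 0 \<in> U \<longrightarrow> (\<exists>n. nmul (p ^ n) ` K \<subseteq> U)"
      by (rule G.coding_subgroup_exists[OF assms(1)])
    obtain Y \<tau> where Y: "orbit_section K free_part Y \<tau>" "generating M act Y"
      by (rule generating_orbit_section_exists[OF assms(3) K(1) p G.nmul_p_eq_0 K(2,3) K(4)[rule_format]])
    have "stealthy M act Y" by (rule orbit_section_stealthy[OF K(1) Y(1)])
    then show "\<exists>Y. generating M act Y \<and> stealthy M act Y" using Y(2) by blast
  qed
qed

end
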